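(* Let $M$ be an oriented smooth Riemannian manifold of dimension $n+1$, let $s>0$, and let $\mathcal{S}=S_sM$ be the tangent sphere bundle of radius $s$, with the induced Sasaki metric and canonical orientation, the 1-form $\theta$ and the natural $n$-forms $\alpha_0,\dots,\alpha_n$ (all as defined in the context). Then for any $0\le i\le n$: $$ *\theta = s\,\alpha_0\wedge\alpha_n=\frac{s(-1)^{\frac{n(n+1)}{2}}}{n!}\,(d\theta)^{n}, $$ $$ *\,(d\theta)^i=(-1)^{\frac{n(n+1)}{2}}\frac{i!}{(n-i)!\,s}\,\theta\wedge(d\theta)^{n-i},\qquad *\alpha_i=\frac{(-1)^{n-i}}{s}\,\theta\wedge\alpha_{n-i}. $$ Moreover, $$ \alpha_i\wedge d\theta=0\qquad\text{and}\qquad \alpha_i\wedge\alpha_j=0,\ \ \forall j\neq n-i,\ 0\le j\le n. $$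
   Context: Let $(M,g=\langle\,,\rangle)$ be an oriented Riemannian manifold of dimension $n+1$ with Levi-Civita connection $\nabla$ and let $\pi:TM\to M$ be the tangent bundle. The connection gives a splitting $TTM=H\oplus V$, with $V=\ker d\pi\simeq\pi^*TM$ (vertical) and $H\simeq\pi^*TM$ via $d\pi$ (horizontal). The mirror map $B:TTM\to TTM$ is the endomorphism sending $H$ to $V$ by the identification $H\simeq\pi^*TM\simeq V$ and vanishing on $V$. $\xi$ is the canonical vertical vector field on $TM$, $\xi_u=u$. The Sasaki metric on $TM$ (also written $\langle\,,\rangle$) is the one for which $H\perp V$ and both identifications with $\pi^*TM$ are isometric. For $s>0$, $\mathcal{S}=S_sM=\{u\in TM:\|u\|=s\}$ carries the induced metric; $\xi/s$ is its unit normal. The 1-form $\theta$ on $\mathcal{S}$ is $\theta=\langle\xi,B\,\cdot\,\rangle$, i.e. $\theta_u(w)=\langle u,d\pi(w)\rangle$. Let $\mathrm{vol}=\pi^*\mathrm{vol}_M$. Let $\pi^{-1}\mathrm{vol}_M$ denote the vertical pullback of the volume form: the $(n+1)$-form on $TM$ which vanishes when contracted with a horizontal vector and equals $\mathrm{vol}_M$ on $V\simeq\pi^*TM$. Define $\alpha_n=\frac{\xi}{\|\xi\|}\lrcorner\,\pi^{-1}\mathrm{vol}_M$ and, for $0\le i\le n$, the $n$-form $\alpha_i$ on $\mathcal{S}$ by $$\alpha_i(v_1,\dots,v_n)=\frac{1}{i!(n-i)!}\sum_{\sigma\in S_n}\mathrm{sg}(\sigma)\,\alpha_n(Bv_{\sigma_1},\dots,Bv_{\sigma_{n-i}},v_{\sigma_{n-i+1}},\dots,v_{\sigma_n}).$$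 The orientation of $\mathcal{S}$ is given by $\mathrm{vol}\wedge\alpha_n$, and $*$ is the Hodge star operator of $\mathcal{S}$. *)

theory Defs
  imports "HOL-Analysis.Analysis" "HOL-Combinatorics.Permutations"
begin

section \<open>Smooth maps between open subsets of Euclidean spaces\<close>

primrec Ck_on :: "nat \<Rightarrow> 'a::real_normed_vector set \<Rightarrow> ('a \<Rightarrow> 'b::real_normed_vector) \<Rightarrow> bool" where
  "Ck_on 0 S f = continuous_on S f"
| "Ck_on (Suc k) S f =
     ((\<forall>x\<in>S. f differentiable (at x)) \<and> (\<forall>v. Ck_on k S (\<lambda>x. frechet_derivative f (at x) v)))"

text \<open>Only used for open \<open>S\<close>, since the derivatives are taken in the ambient space.\<close>

definition smooth_on :: "'a::real_normed_vector set \<Rightarrow> ('a \<Rightarrow> 'b::real_normed_vector) \<Rightarrow> bool" where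
  "smooth_on S f \<longleftrightarrow> (\<forall>k. Ck_on k S f)"


section \<open>Smooth manifolds\<close>

text \<open>A chart is a pair of its domain and its coordinate map. A manifold is given by an atlas,
  which also determines its underlying set and its topology.\<close>

type_synonym ('a, 'e) chart = "'a set \<times> ('a \<Rightarrow> 'e)"

definition carrier_of :: "('a, 'e) chart set \<Rightarrow> 'a set" where
  "carrier_of A = (\<Union>c\<in>A. fst c)"

definition smooth_atlas :: "('a, 'e::euclidean_space) chart set \<Rightarrow> bool" where
  "smooth_atlas A \<longleftrightarrow>
     (\<forall>(U, \<phi>)\<in>A. inj_on \<phi> U \<and> open (\<phi> ` U)) \<and>
     (\<forall>(U, \<phi>)\<in>A. \<forall>(V, \<psi>)\<in>A.
        open (\<phi> ` (U \<inter> V)) \<and> smooth_on (\<phi> ` (U \<inter> V)) (\<psi> \<circ> inv_into U \<phi>))"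

definition manifold_topology :: "('a, 'e::euclidean_space) chart set \<Rightarrow> 'a topology" where
  "manifold_topology A =
     topology (\<lambda>W. W \<subseteq> carrier_of A \<and> (\<forall>(U, \<phi>)\<in>A. open (\<phi> ` (W \<inter> U))))"

lemma openin_manifold_topology:
  assumes "smooth_atlas A"
  shows "openin (manifold_topology A) W \<longleftrightarrow>
    W \<subseteq> carrier_of A \<and> (\<forall>(U, \<phi>)\<in>A. open (\<phi> ` (W \<inter> U)))"
proof -
  have inj: "inj_on \<phi> U" if "(U, \<phi>) \<in> A" for U \<phi>
    using assms that unfolding smooth_atlas_def by fastforce
  have "istopology (\<lambda>W. W \<subseteq> carrier_of A \<and> (\<forall>(U, \<phi>)\<in>A. open (\<phi> ` (W \<inter> U))))"
    unfolding istopology_def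
  proof (intro conjI allI impI)
    fix S T
    assume S: "S \<subseteq> carrier_of A \<and> (\<forall>(U, \<phi>)\<in>A. open (\<phi> ` (S \<inter> U)))"
      and T: "T \<subseteq> carrier_of A \<and> (\<forall>(U, \<phi>)\<in>A. open (\<phi> ` (T \<inter> U)))"
    show "S \<inter> T \<subseteq> carrier_of A" using S by blast
    show "\<forall>(U, \<phi>)\<in>A. open (\<phi> ` (S \<inter> T \<inter> U))"
    proof clarify
      fix U \<phi> assume c: "(U, \<phi>) \<in> A"
      have "\<phi> ` (S \<inter> T \<inter> U) = \<phi> ` (S \<inter> U) \<inter> \<phi> ` (T \<inter> U)"
        using inj[OF c] unfolding inj_on_def by blast
      then show "open (\<phi> ` (S \<inter> T \<inter> U))" using S T c by fastforce
    qed
  next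
    fix \<K> assume K: "\<forall>K\<in>\<K>. K \<subseteq> carrier_of A \<and> (\<forall>(U, \<phi>)\<in>A. open (\<phi> ` (K \<inter> U)))"
    show "\<Union>\<K> \<subseteq> carrier_of A" using K by blast
    show "\<forall>(U, \<phi>)\<in>A. open (\<phi> ` (\<Union>\<K> \<inter> U))"
    proof clarify
      fix U \<phi> assume c: "(U, \<phi>) \<in> A"
      have "\<phi> ` (\<Union>\<K> \<inter> U) = (\<Union>K\<in>\<K>. \<phi> ` (K \<inter> U))" by blast
      then show "open (\<phi> ` (\<Union>\<K> \<inter> U))" using K c by fastforce
    qed
  qed
  then show ?thesis unfolding manifold_topology_def by (simp add: topology_inverse')
qed

definition smooth_manifold :: "('a, 'e::euclidean_space) chart set \<Rightarrow> bool" where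
  "smooth_manifold A \<longleftrightarrow> smooth_atlas A \<and>
     Hausdorff_space (manifold_topology A) \<and>
     (\<exists>\<B>. countable \<B> \<and> (\<forall>B\<in>\<B>. openin (manifold_topology A) B) \<and>
        (\<forall>W. openin (manifold_topology A) W \<longrightarrow> (\<exists>\<C>\<subseteq>\<B>. W = \<Union>\<C>)))"

definition eucl_atlas :: "('e::euclidean_space, 'e) chart set" where
  "eucl_atlas = {(UNIV, \<lambda>x. x)}"

text \<open>Openness of the coordinate domains is what makes a smooth map continuous.\<close>

definition smooth_map ::
  "('a, 'e::euclidean_space) chart set \<Rightarrow> ('b, 'f::euclidean_space) chart set \<Rightarrow> 'a set \<Rightarrow> ('a \<Rightarrow> 'b) \<Rightarrow> bool"
where
  "smooth_map A B W F \<longleftrightarrow> openin (manifold_topology A) W \<and> F ` W \<subseteq> carrier_of B \<and>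
     (\<forall>(U, \<phi>)\<in>A. \<forall>(V, \<psi>)\<in>B.
        open (\<phi> ` (W \<inter> U \<inter> F -` V)) \<and>
        smooth_on (\<phi> ` (W \<inter> U \<inter> F -` V)) (\<psi> \<circ> F \<circ> inv_into U \<phi>))"


section \<open>Tangent vectors\<close>

text \<open>Every point \<open>p\<close> is assigned a preferred chart around it, and a tangent vector at \<open>p\<close> is
  represented by its coordinates in that chart. So every tangent space is a copy of the model
  space \<open>'e\<close>, the points of the tangent bundle are the pairs \<open>(p, v)\<close>, and a vector field is a
  function \<open>'a \<Rightarrow> 'e\<close>. Vectors at different points, however, are expressed in charts that have
  nothing to do with each other, so a smooth vector field need not be a smooth function into \<open>'e\<close>.\<close>

definition chart_at :: "('a, 'e) chart set \<Rightarrow> 'a \<Rightarrow> ('a, 'e) chart" where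
  "chart_at A p = (SOME c. c \<in> A \<and> p \<in> fst c)"

text \<open>Change of coordinates, from the chart \<open>c\<close> to the chart \<open>c'\<close>, for tangent vectors at \<open>p\<close>.\<close>

definition coord_change ::
  "('a, 'e::euclidean_space) chart \<Rightarrow> ('a, 'e) chart \<Rightarrow> 'a \<Rightarrow> 'e \<Rightarrow> 'e" where
  "coord_change c c' p = frechet_derivative (snd c' \<circ> inv_into (fst c) (snd c)) (at (snd c p))"

definition tangent_map ::
  "('a, 'e::euclidean_space) chart set \<Rightarrow> ('b, 'f::euclidean_space) chart set \<Rightarrow> ('a \<Rightarrow> 'b) \<Rightarrow> 'a \<Rightarrow> 'e \<Rightarrow> 'f"
where
  "tangent_map A B F p =
     (let c = chart_at A p; c' = chart_at B (F p) in
      frechet_derivative (snd c' \<circ> F \<circ> inv_into (fst c) (snd c)) (at (snd c p)))"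

definition tangent_atlas ::
  "('a, 'e::euclidean_space) chart set \<Rightarrow> ('a \<times> 'e, 'e \<times> 'e) chart set" where
  "tangent_atlas A =
     (\<lambda>c. (fst c \<times> UNIV, \<lambda>(p, v). (snd c p, coord_change (chart_at A p) c p v))) ` A"

definition smooth_vector_field ::
  "('a, 'e::euclidean_space) chart set \<Rightarrow> 'a set \<Rightarrow> ('a \<Rightarrow> 'e) \<Rightarrow> bool" where
  "smooth_vector_field A W X \<longleftrightarrow> smooth_map A (tangent_atlas A) W (\<lambda>p. (p, X p))"

definition smooth_function ::
  "('a, 'e::euclidean_space) chart set \<Rightarrow> 'a set \<Rightarrow> ('a \<Rightarrow> real) \<Rightarrow> bool" where
  "smooth_function A W f \<longleftrightarrow> smooth_map A eucl_atlas W f"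

definition differential ::
  "('a, 'e::euclidean_space) chart set \<Rightarrow> ('a \<Rightarrow> real) \<Rightarrow> 'a \<Rightarrow> 'e \<Rightarrow> real" where
  "differential A f p = tangent_map A eucl_atlas f p"

text \<open>The Lie bracket \<open>dY(X) - dX(Y)\<close>, computed in the preferred chart at the point.\<close>

definition lie_bracket ::
  "('a, 'e::euclidean_space) chart set \<Rightarrow> ('a \<Rightarrow> 'e) \<Rightarrow> ('a \<Rightarrow> 'e) \<Rightarrow> 'a \<Rightarrow> 'e" where
  "lie_bracket A X Y p =
     (let c = chart_at A p;
          rep = (\<lambda>Z x. let q = inv_into (fst c) (snd c) x in coord_change (chart_at A q) c q (Z q))
      in frechet_derivative (rep Y) (at (snd c p)) (X p) -
         frechet_derivative (rep X) (at (snd c p)) (Y p))"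

definition embedded_submanifold ::
  "('b, 'k::euclidean_space) chart set \<Rightarrow> ('b, 'f::euclidean_space) chart set \<Rightarrow> 'b set \<Rightarrow> bool" where
  "embedded_submanifold AS B S \<longleftrightarrow>
     smooth_atlas AS \<and> carrier_of AS = S \<and>
     smooth_map AS B S (\<lambda>u. u) \<and>
     (\<forall>u\<in>S. inj (tangent_map AS B (\<lambda>u. u) u)) \<and>
     manifold_topology AS = subtopology (manifold_topology B) S"


section \<open>Alternating forms\<close>

text \<open>A form of degree \<open>k\<close> takes a sequence of vectors of which it only inspects the first \<open>k\<close>.\<close>

type_synonym 'v form = "(nat \<Rightarrow> 'v) \<Rightarrow> real"

definition alt_form :: "nat \<Rightarrow> 'v::real_vector form \<Rightarrow> bool" where
  "alt_form k \<omega> \<longleftrightarrow>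
     (\<forall>v w. (\<forall>i<k. v i = w i) \<longrightarrow> \<omega> v = \<omega> w) \<and>
     (\<forall>v. \<forall>i<k. linear (\<lambda>x. \<omega> (v(i := x)))) \<and>
     (\<forall>v. \<forall>i<k. \<forall>j<k. i \<noteq> j \<longrightarrow> v i = v j \<longrightarrow> \<omega> v = 0)"

text \<open>The determinant convention: \<open>e\<^sup>1 \<and> e\<^sup>2\<close> takes the value \<open>1\<close> at \<open>(e\<^sub>1, e\<^sub>2)\<close>.\<close>

definition wedge :: "nat \<Rightarrow> nat \<Rightarrow> 'v form \<Rightarrow> 'v form \<Rightarrow> 'v form" where
  "wedge k l \<alpha> \<beta> = (\<lambda>v.
     (\<Sum>\<sigma> | \<sigma> permutes {..<k + l}.
        of_int (sign \<sigma>) * \<alpha> (\<lambda>i. v (\<sigma> i)) * \<beta> (\<lambda>i. v (\<sigma> (k + i)))) / (fact k * fact l))"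

primrec wedge_power :: "nat \<Rightarrow> 'v form \<Rightarrow> nat \<Rightarrow> 'v form" where
  "wedge_power k \<alpha> 0 = (\<lambda>v. 1)"
| "wedge_power k \<alpha> (Suc i) = wedge k (k * i) \<alpha> (wedge_power k \<alpha> i)"

definition pullback_form :: "('v \<Rightarrow> 'w) \<Rightarrow> 'w form \<Rightarrow> 'v form" where
  "pullback_form L \<omega> = (\<lambda>v. \<omega> (\<lambda>i. L (v i)))"

definition interior_product :: "'v \<Rightarrow> 'v form \<Rightarrow> 'v form" where
  "interior_product x \<omega> = (\<lambda>v. \<omega> (case_nat x v))"

text \<open>In the preferred chart at \<open>p\<close>, \<open>d\<omega>(v\<^sub>0,\<dots>,v\<^sub>k) = \<Sum>\<^sub>i (-1)\<^sup>i \<partial>\<^bsub>v i\<^esub> \<omega>(v\<^sub>0,\<dots>,v\<^sub>k)\<close>, the argument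
  \<open>v\<^sub>i\<close> being omitted and the \<open>v\<^sub>j\<close> being extended as constant fields in that chart.\<close>

definition exterior_derivative ::
  "('a, 'e::euclidean_space) chart set \<Rightarrow> nat \<Rightarrow> ('a \<Rightarrow> 'e form) \<Rightarrow> 'a \<Rightarrow> 'e form" where
  "exterior_derivative A k \<omega> p = (\<lambda>v.
     let c = chart_at A p;
         rep = (\<lambda>x. let q = inv_into (fst c) (snd c) x
                    in pullback_form (coord_change c (chart_at A q) q) (\<omega> q))
     in \<Sum>i\<le>k. (-1) ^ i *
          frechet_derivative (\<lambda>x. rep x (\<lambda>j. if j < i then v j else v (Suc j))) (at (snd c p)) (v i))"


section \<open>Oriented inner product spaces and the Hodge star\<close>

definition inner_product :: "('v::real_vector \<Rightarrow> 'v \<Rightarrow> real) \<Rightarrow> bool" where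
  "inner_product G \<longleftrightarrow> bilinear G \<and> (\<forall>x y. G x y = G y x) \<and> (\<forall>x. x \<noteq> 0 \<longrightarrow> 0 < G x x)"

definition ordered_basis :: "(nat \<Rightarrow> 'v::euclidean_space) \<Rightarrow> bool" where
  "ordered_basis b \<longleftrightarrow> inj_on b {..<DIM('v)} \<and> independent (b ` {..<DIM('v)})"

definition orthonormal_basis ::
  "('v::euclidean_space \<Rightarrow> 'v \<Rightarrow> real) \<Rightarrow> (nat \<Rightarrow> 'v) \<Rightarrow> bool" where
  "orthonormal_basis G b \<longleftrightarrow>
     (\<forall>i<DIM('v). \<forall>j<DIM('v). G (b i) (b j) = (if i = j then 1 else 0))"

definition same_orientation :: "(nat \<Rightarrow> real^'m) \<Rightarrow> (nat \<Rightarrow> real^'m) \<Rightarrow> bool" where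
  "same_orientation b c \<longleftrightarrow>
     (\<exists>L. linear L \<and> (\<forall>i<CARD('m). L (b i) = c i) \<and> 0 < det (matrix L))"

text \<open>An orientation of a vector space is represented by the set \<open>P\<close> of all its positive ordered
  bases.\<close>

definition volume_form ::
  "('v::euclidean_space \<Rightarrow> 'v \<Rightarrow> real) \<Rightarrow> (nat \<Rightarrow> 'v) set \<Rightarrow> 'v form" where
  "volume_form G P =
     (THE \<omega>. alt_form DIM('v) \<omega> \<and> (\<forall>b\<in>P. orthonormal_basis G b \<longrightarrow> \<omega> b = 1))"

text \<open>The inner product of \<open>k\<close>-forms for which the \<open>e\<^sup>I\<close>, with \<open>I\<close> increasing, are orthonormal.
  The sum runs over all multi-indices, whence the factor \<open>1/k!\<close>.\<close>

definition form_inner ::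
  "('v::euclidean_space \<Rightarrow> 'v \<Rightarrow> real) \<Rightarrow> nat \<Rightarrow> 'v form \<Rightarrow> 'v form \<Rightarrow> real" where
  "form_inner G k \<alpha> \<beta> =
     (let e = (SOME e. orthonormal_basis G e) in
      (\<Sum>I \<in> {..<k} \<rightarrow>\<^sub>E {..<DIM('v)}. \<alpha> (\<lambda>i. e (I i)) * \<beta> (\<lambda>i. e (I i))) / fact k)"

text \<open>\<open>*\<beta>\<close> is determined by \<open>\<omega> \<and> *\<beta> = \<langle>\<omega>, \<beta>\<rangle> vol\<close>.\<close>

definition hodge_star ::
  "('v::euclidean_space \<Rightarrow> 'v \<Rightarrow> real) \<Rightarrow> (nat \<Rightarrow> 'v) set \<Rightarrow> nat \<Rightarrow> 'v form \<Rightarrow> 'v form" where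
  "hodge_star G P k \<beta> =
     (THE \<gamma>. alt_form (DIM('v) - k) \<gamma> \<and>
        (\<forall>\<omega>. alt_form k \<omega> \<longrightarrow>
           wedge k (DIM('v) - k) \<omega> \<gamma> = (\<lambda>v. form_inner G k \<omega> \<beta> * volume_form G P v)))"


section \<open>Oriented Riemannian manifolds\<close>

definition riemannian_metric ::
  "('a, 'e::euclidean_space) chart set \<Rightarrow> ('a \<Rightarrow> 'e \<Rightarrow> 'e \<Rightarrow> real) \<Rightarrow> bool" where
  "riemannian_metric A g \<longleftrightarrow>
     (\<forall>p\<in>carrier_of A. inner_product (g p)) \<and>
     (\<forall>W X Y. smooth_vector_field A W X \<longrightarrow> smooth_vector_field A W Y \<longrightarrow>
        smooth_function A W (\<lambda>p. g p (X p) (Y p)))"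

definition manifold_orientation ::
  "('a, real^'m) chart set \<Rightarrow> ('a \<Rightarrow> (nat \<Rightarrow> real^'m) set) \<Rightarrow> bool" where
  "manifold_orientation A ori \<longleftrightarrow>
     (\<forall>p\<in>carrier_of A. \<exists>b. ordered_basis b \<and> ori p = {c. ordered_basis c \<and> same_orientation b c}) \<and>
     (\<forall>p\<in>carrier_of A. \<exists>W E. openin (manifold_topology A) W \<and> p \<in> W \<and>
        (\<forall>i<CARD('m). smooth_vector_field A W (E i)) \<and> (\<forall>q\<in>W. (\<lambda>i. E i q) \<in> ori q))"

text \<open>\<open>D p v X\<close> stands for \<open>\<nabla>\<^sub>v X\<close>, where \<open>v\<close> is a tangent vector at \<open>p\<close> and \<open>X\<close> is a vector field
  that is smooth on some neighbourhood of \<open>p\<close>.\<close>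

type_synonym ('a, 'e) connection = "'a \<Rightarrow> 'e \<Rightarrow> ('a \<Rightarrow> 'e) \<Rightarrow> 'e"

definition affine_connection ::
  "('a, 'e::euclidean_space) chart set \<Rightarrow> ('a, 'e) connection \<Rightarrow> bool" where
  "affine_connection A D \<longleftrightarrow>
     (\<forall>W X. smooth_vector_field A W X \<longrightarrow> (\<forall>p\<in>W. linear (\<lambda>v. D p v X))) \<and>
     (\<forall>W X Y. smooth_vector_field A W X \<longrightarrow> smooth_vector_field A W Y \<longrightarrow>
        (\<forall>p\<in>W. \<forall>v. D p v (\<lambda>q. X q + Y q) = D p v X + D p v Y)) \<and>
     (\<forall>W f X. smooth_function A W f \<longrightarrow> smooth_vector_field A W X \<longrightarrow>
        (\<forall>p\<in>W. \<forall>v. D p v (\<lambda>q. f q *\<^sub>R X q) = differential A f p v *\<^sub>R X p + f p *\<^sub>R D p v X)) \<and>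
     (\<forall>W X Y. smooth_vector_field A W X \<longrightarrow> (\<forall>q\<in>W. X q = Y q) \<longrightarrow>
        (\<forall>p\<in>W. \<forall>v. D p v X = D p v Y)) \<and>
     (\<forall>W X Y. smooth_vector_field A W X \<longrightarrow> smooth_vector_field A W Y \<longrightarrow>
        smooth_vector_field A W (\<lambda>p. D p (X p) Y))"

definition levi_civita ::
  "('a, 'e::euclidean_space) chart set \<Rightarrow> ('a \<Rightarrow> 'e \<Rightarrow> 'e \<Rightarrow> real) \<Rightarrow> ('a, 'e) connection \<Rightarrow> bool" where
  "levi_civita A g D \<longleftrightarrow> affine_connection A D \<and>
     (\<forall>W X Y. smooth_vector_field A W X \<longrightarrow> smooth_vector_field A W Y \<longrightarrow>
        (\<forall>p\<in>W. D p (X p) Y - D p (Y p) X = lie_bracket A X Y p \<and>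
           (\<forall>v. differential A (\<lambda>q. g q (X q) (Y q)) p v =
                g p (D p v X) (Y p) + g p (X p) (D p v Y))))"


section \<open>Geometry of the tangent bundle\<close>

text \<open>Below, \<open>u = (p, v)\<close> is a point of \<open>TM\<close>; its tangent vectors are elements of \<open>'e \<times> 'e\<close>, namely
  coordinates in the preferred chart of \<open>tangent_atlas A\<close> at \<open>u\<close>. The two components are in
  general not the horizontal and the vertical part.\<close>

definition bundle_proj ::
  "('a, 'e::euclidean_space) chart set \<Rightarrow> 'a \<times> 'e \<Rightarrow> 'e \<times> 'e \<Rightarrow> 'e" where
  "bundle_proj A u = tangent_map (tangent_atlas A) A fst u"

text \<open>The identification of \<open>\<pi>\<^sup>*TM\<close> with \<open>V\<close>: the velocity at \<open>0\<close> of the curve \<open>t \<mapsto> u + t a\<close>.\<close>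

definition vertical_lift ::
  "('a, 'e::euclidean_space) chart set \<Rightarrow> 'a \<times> 'e \<Rightarrow> 'e \<Rightarrow> 'e \<times> 'e" where
  "vertical_lift A u a =
     tangent_map eucl_atlas (tangent_atlas A) (\<lambda>t::real. (fst u, snd u + t *\<^sub>R a)) 0 1"

text \<open>The horizontal space at \<open>u\<close>: the vectors \<open>dX(v)\<close>, for a local vector field \<open>X\<close> through \<open>u\<close>
  with \<open>\<nabla>\<^sub>v X = 0\<close>.\<close>

definition horizontal ::
  "('a, 'e::euclidean_space) chart set \<Rightarrow> ('a, 'e) connection \<Rightarrow> 'a \<times> 'e \<Rightarrow> ('e \<times> 'e) set" where
  "horizontal A D u =
     {tangent_map A (tangent_atlas A) (\<lambda>q. (q, X q)) (fst u) v | X v W.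
        smooth_vector_field A W X \<and> fst u \<in> W \<and> X (fst u) = snd u \<and> D (fst u) v X = 0}"

text \<open>The vertical part of a vector in \<open>H \<oplus> V\<close>, read in \<open>\<pi>\<^sup>*TM\<close>.\<close>

definition vertical_part ::
  "('a, 'e::euclidean_space) chart set \<Rightarrow> ('a, 'e) connection \<Rightarrow> 'a \<times> 'e \<Rightarrow> 'e \<times> 'e \<Rightarrow> 'e" where
  "vertical_part A D u w = (THE a. w - vertical_lift A u a \<in> horizontal A D u)"

text \<open>The mirror map \<open>B\<close>; it vanishes on \<open>V = ker d\<pi>\<close>.\<close>

definition mirror :: "('a, 'e::euclidean_space) chart set \<Rightarrow> 'a \<times> 'e \<Rightarrow> 'e \<times> 'e \<Rightarrow> 'e \<times> 'e" where
  "mirror A u w = vertical_lift A u (bundle_proj A u w)"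

definition canonical_field :: "('a, 'e::euclidean_space) chart set \<Rightarrow> 'a \<times> 'e \<Rightarrow> 'e \<times> 'e" where
  "canonical_field A u = vertical_lift A u (snd u)"

definition sasaki ::
  "('a, 'e::euclidean_space) chart set \<Rightarrow> ('a \<Rightarrow> 'e \<Rightarrow> 'e \<Rightarrow> real) \<Rightarrow> ('a, 'e) connection \<Rightarrow>
   'a \<times> 'e \<Rightarrow> 'e \<times> 'e \<Rightarrow> 'e \<times> 'e \<Rightarrow> real" where
  "sasaki A g D u w w' =
     g (fst u) (bundle_proj A u w) (bundle_proj A u w') +
     g (fst u) (vertical_part A D u w) (vertical_part A D u w')"

definition sphere_bundle ::
  "('a, 'e::euclidean_space) chart set \<Rightarrow> ('a \<Rightarrow> 'e \<Rightarrow> 'e \<Rightarrow> real) \<Rightarrow> real \<Rightarrow> ('a \<times> 'e) set" where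
  "sphere_bundle A g s = {(p, v). p \<in> carrier_of A \<and> sqrt (g p v v) = s}"

text \<open>\<open>\<theta>\<close>, \<open>vol = \<pi>\<^sup>*vol\<^sub>M\<close>, \<open>\<pi>\<^sup>-\<^sup>1vol\<^sub>M\<close> and the \<open>\<alpha>\<^sub>i\<close> as forms at the point \<open>u\<close> of \<open>TM\<close>.\<close>

definition theta ::
  "('a, 'e::euclidean_space) chart set \<Rightarrow> ('a \<Rightarrow> 'e \<Rightarrow> 'e \<Rightarrow> real) \<Rightarrow> ('a, 'e) connection \<Rightarrow>
   'a \<times> 'e \<Rightarrow> ('e \<times> 'e) form" where
  "theta A g D u = (\<lambda>v. sasaki A g D u (canonical_field A u) (mirror A u (v 0)))"

definition vol ::
  "('a, 'e::euclidean_space) chart set \<Rightarrow> ('a \<Rightarrow> 'e \<Rightarrow> 'e \<Rightarrow> real) \<Rightarrow> ('a \<Rightarrow> (nat \<Rightarrow> 'e) set) \<Rightarrow>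
   'a \<times> 'e \<Rightarrow> ('e \<times> 'e) form" where
  "vol A g ori u = pullback_form (bundle_proj A u) (volume_form (g (fst u)) (ori (fst u)))"

definition vertical_vol ::
  "('a, 'e::euclidean_space) chart set \<Rightarrow> ('a \<Rightarrow> 'e \<Rightarrow> 'e \<Rightarrow> real) \<Rightarrow> ('a \<Rightarrow> (nat \<Rightarrow> 'e) set) \<Rightarrow>
   ('a, 'e) connection \<Rightarrow> 'a \<times> 'e \<Rightarrow> ('e \<times> 'e) form" where
  "vertical_vol A g ori D u =
     pullback_form (vertical_part A D u) (volume_form (g (fst u)) (ori (fst u)))"

definition alpha_top ::
  "('a, 'e::euclidean_space) chart set \<Rightarrow> ('a \<Rightarrow> 'e \<Rightarrow> 'e \<Rightarrow> real) \<Rightarrow> ('a \<Rightarrow> (nat \<Rightarrow> 'e) set) \<Rightarrow>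
   ('a, 'e) connection \<Rightarrow> 'a \<times> 'e \<Rightarrow> ('e \<times> 'e) form" where
  "alpha_top A g ori D u =
     (let \<xi> = canonical_field A u in
      interior_product (\<xi> /\<^sub>R sqrt (sasaki A g D u \<xi> \<xi>)) (vertical_vol A g ori D u))"

text \<open>\<open>\<alpha>\<^sub>i\<close>, where the dimension of \<open>M\<close> is \<open>n + 1\<close>; \<open>alpha A g ori D n n\<close> is \<open>alpha_top A g ori D\<close>.\<close>

definition alpha ::
  "('a, 'e::euclidean_space) chart set \<Rightarrow> ('a \<Rightarrow> 'e \<Rightarrow> 'e \<Rightarrow> real) \<Rightarrow> ('a \<Rightarrow> (nat \<Rightarrow> 'e) set) \<Rightarrow>
   ('a, 'e) connection \<Rightarrow> nat \<Rightarrow> nat \<Rightarrow> 'a \<times> 'e \<Rightarrow> ('e \<times> 'e) form" where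
  "alpha A g ori D n i u = (\<lambda>v.
     (\<Sum>\<sigma> | \<sigma> permutes {..<n}. of_int (sign \<sigma>) *
        alpha_top A g ori D u (\<lambda>j. if j < n - i then mirror A u (v (\<sigma> j)) else v (\<sigma> j))) /
     (fact i * fact (n - i)))"


section \<open>The tangent sphere bundle\<close>

text \<open>\<open>AS\<close> is the atlas of \<open>\<S>\<close>, meant to be any atlas that makes \<open>\<S>\<close> an embedded submanifold
  of \<open>TM\<close>; its model space \<open>'k\<close> is any Euclidean space of dimension \<open>2n + 1\<close>. Tangent vectors of \<open>\<S>\<close> are pushed to \<open>TM\<close> by the differential of
  the inclusion, and forms on \<open>TM\<close> are restricted to \<open>\<S>\<close> by pulling them back along it.\<close>

definition sphere_incl ::
  "('a, 'e::euclidean_space) chart set \<Rightarrow> ('a \<times> 'e, 'k::euclidean_space) chart set \<Rightarrow>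
   'a \<times> 'e \<Rightarrow> 'k \<Rightarrow> 'e \<times> 'e" where
  "sphere_incl A AS u = tangent_map AS (tangent_atlas A) (\<lambda>u. u) u"

definition sphere_form ::
  "('a, 'e::euclidean_space) chart set \<Rightarrow> ('a \<times> 'e, 'k::euclidean_space) chart set \<Rightarrow>
   ('a \<times> 'e \<Rightarrow> ('e \<times> 'e) form) \<Rightarrow> 'a \<times> 'e \<Rightarrow> 'k form" where
  "sphere_form A AS \<omega> u = pullback_form (sphere_incl A AS u) (\<omega> u)"

definition sphere_metric ::
  "('a, 'e::euclidean_space) chart set \<Rightarrow> ('a \<Rightarrow> 'e \<Rightarrow> 'e \<Rightarrow> real) \<Rightarrow> ('a, 'e) connection \<Rightarrow>
   ('a \<times> 'e, 'k::euclidean_space) chart set \<Rightarrow> 'a \<times> 'e \<Rightarrow> 'k \<Rightarrow> 'k \<Rightarrow> real" where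
  "sphere_metric A g D AS u x y =
     sasaki A g D u (sphere_incl A AS u x) (sphere_incl A AS u y)"

text \<open>The orientation given by \<open>vol \<and> \<alpha>\<^sub>n\<close>.\<close>

definition sphere_orientation ::
  "('a, 'e::euclidean_space) chart set \<Rightarrow> ('a \<Rightarrow> 'e \<Rightarrow> 'e \<Rightarrow> real) \<Rightarrow> ('a \<Rightarrow> (nat \<Rightarrow> 'e) set) \<Rightarrow>
   ('a, 'e) connection \<Rightarrow> nat \<Rightarrow> ('a \<times> 'e, 'k::euclidean_space) chart set \<Rightarrow>
   'a \<times> 'e \<Rightarrow> (nat \<Rightarrow> 'k) set" where
  "sphere_orientation A g ori D n AS u =
     {b. ordered_basis b \<and>
         0 < wedge (n + 1) n (sphere_form A AS (vol A g ori) u)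
                             (sphere_form A AS (alpha_top A g ori D) u) b}"

definition sphere_star ::
  "('a, 'e::euclidean_space) chart set \<Rightarrow> ('a \<Rightarrow> 'e \<Rightarrow> 'e \<Rightarrow> real) \<Rightarrow> ('a \<Rightarrow> (nat \<Rightarrow> 'e) set) \<Rightarrow>
   ('a, 'e) connection \<Rightarrow> nat \<Rightarrow> ('a \<times> 'e, 'k::euclidean_space) chart set \<Rightarrow>
   'a \<times> 'e \<Rightarrow> nat \<Rightarrow> 'k form \<Rightarrow> 'k form" where
  "sphere_star A g ori D n AS u =
     hodge_star (sphere_metric A g D AS u) (sphere_orientation A g ori D n AS u)"

end

theory Submission
  imports Defs
begin

text \<open>The proof reduces the statement to exterior algebra in one well chosen orthonormal frame.

Let \<open>u\<close> be a point of the sphere bundle, with base point \<open>p\<close>. Sending a tangent vector of \<open>\<S>\<close> at \<open>u\<close>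
to its horizontal and its vertical part, both read in \<open>T\<^sub>pM\<close>, is an injective map whose image consists of
the pairs with second component orthogonal to \<open>u\<close>: the vertical part is a covariant derivative of
the position vector, whose length is constant, and the dimensions agree. So an orthonormal basis
\<open>e\<^sub>0 = u/s, e\<^sub>1, \<dots>, e\<^sub>n\<close> of \<open>T\<^sub>pM\<close> yields an orthonormal basis of \<open>T\<^sub>u\<S>\<close>: the horizontal lifts of
\<open>e\<^sub>0, \<dots>, e\<^sub>n\<close>, followed by the vertical lifts of \<open>e\<^sub>1, \<dots>, e\<^sub>n\<close>. Let \<open>e\<^sup>0, \<dots>, e\<^sup>2\<^sup>n\<close> be its dual basis.

The geometric input is the formula \<open>d\<theta>(v, w) = \<langle>ver v, hor w\<rangle> - \<langle>ver w, hor v\<rangle>\<close>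
(\<open>exterior_derivative_theta\<close>). In coordinates \<open>(\<zeta>, \<eta>)\<close> of \<open>TM\<close> the form is \<open>\<theta> = \<langle>\<eta>, d\<zeta>\<rangle>\<close>, and the derivative of
the metric is expressed by Christoffel symbols. The second derivatives of \<open>\<zeta>\<close> cancel by symmetry, the
Christoffel symbols between \<open>\<zeta>\<close>-directions cancel because there is no torsion, and the others complete the
derivatives of \<open>\<eta>\<close> to vertical parts.

In the frame, then, \<open>\<theta> = s e\<^sup>0\<close> and \<open>d\<theta> = \<Sum>\<^sub>j e\<^sup>n\<^sup>+\<^sup>j \<and> e\<^sup>j\<close>, and \<open>\<alpha>\<^sub>i\<close> is \<open>\<epsilon>\<close> times the sum of the products obtained from
\<open>e\<^sup>1 \<and> \<dots> \<and> e\<^sup>n\<close> by replacing \<open>i\<close> of the factors \<open>e\<^sup>j\<close> by \<open>e\<^sup>n\<^sup>+\<^sup>j\<close>. Here \<open>\<epsilon>\<close> is the sign telling whether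
\<open>e\<^sub>0, \<dots>, e\<^sub>n\<close> is positively oriented. It enters twice into \<open>vol \<and> \<alpha>\<^sub>n\<close>, so \<open>e\<^sup>0 \<and> \<dots> \<and> e\<^sup>2\<^sup>n\<close> is the volume
form in any case, and carrying \<open>\<epsilon>\<close> along avoids the choice of a positive basis starting with \<open>u/s\<close>, which does
not exist when \<open>n = 0\<close> and \<open>u/s\<close> is negative.

It remains to compute with products of the \<open>e\<^sup>j\<close>. The Hodge dual of such a product is the product of
the complementary factors, with the sign of the permutation that puts all of them in order
(\<open>is_star_basis_form\<close>), and all claims follow by linearity. In
\<open>*(d\<theta>)\<^sup>i\<close> the factors come in pairs, which commute, so the only sign is that of turning
\<open>n\<close> pairs \<open>e\<^sup>n\<^sup>+\<^sup>j \<and> e\<^sup>j\<close> into \<open>e\<^sup>1 \<and> \<dots> \<and> e\<^sup>2\<^sup>n\<close>; in \<open>*\<alpha>\<^sub>i\<close> the \<open>i\<close> vertical factors contribute one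
sign each, and moving \<open>e\<^sup>0\<close> to the front contributes \<open>n\<close> more.
The last two claims hold because every product that occurs has a repeated factor.\<close>

section \<open>Exterior products of linear functionals\<close>

text \<open>The exterior product \<open>f\<^sub>0 \<and> \<dots> \<and> f\<^sub>k\<^sub>-\<^sub>1\<close> of linear functionals, that is \<open>det (f\<^sub>i (v\<^sub>j))\<close>. With lists, wedging becomes
concatenation, and all sign computations become rearrangements of lists.\<close>

definition ext_prod :: "('v \<Rightarrow> real) list \<Rightarrow> 'v form" where
  "ext_prod fs v = (\<Sum>\<sigma> | \<sigma> permutes {..<length fs}.
     of_int (sign \<sigma>) * (\<Prod>i<length fs. (fs ! i) (v (\<sigma> i))))"

lemma permutes_lessThan_imp_permutation [simp]: "\<sigma> permutes {..<n::nat} \<Longrightarrow> permutation \<sigma>"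
  by (rule permutes_imp_permutation) auto

lemma sum_permutes_compose_right:
  fixes F :: "(nat \<Rightarrow> nat) \<Rightarrow> real"
  assumes "\<rho> permutes {..<n}"
  shows "(\<Sum>\<sigma> | \<sigma> permutes {..<n}. F (\<sigma> \<circ> \<rho>)) = (\<Sum>\<sigma> | \<sigma> permutes {..<n}. F \<sigma>)"
  using sum_permutations_compose_right[OF assms, of F] by simp

lemma sum_permutes_compose_left:
  fixes F :: "(nat \<Rightarrow> nat) \<Rightarrow> real"
  assumes "\<rho> permutes {..<n}"
  shows "(\<Sum>\<sigma> | \<sigma> permutes {..<n}. F (\<rho> \<circ> \<sigma>)) = (\<Sum>\<sigma> | \<sigma> permutes {..<n}. F \<sigma>)"
  using setum_permutations_compose_left[OF assms, of F] by simp

lemma ext_prod_permute_args: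
  assumes \<rho>: "\<rho> permutes {..<length fs}"
  shows "ext_prod fs (\<lambda>i. v (\<rho> i)) = of_int (sign \<rho>) * ext_prod fs v"
proof -
  let ?F = "\<lambda>\<sigma>. of_int (sign \<sigma>) * (\<Prod>i<length fs. (fs ! i) (v (\<sigma> i)))"
  have "ext_prod fs v = (\<Sum>\<sigma> | \<sigma> permutes {..<length fs}. ?F (\<rho> \<circ> \<sigma>))"
    unfolding ext_prod_def by (rule sum_permutes_compose_left[OF \<rho>, symmetric])
  also have "\<dots> = (\<Sum>\<sigma> | \<sigma> permutes {..<length fs}.
      of_int (sign \<rho>) * (of_int (sign \<sigma>) * (\<Prod>i<length fs. (fs ! i) (v (\<rho> (\<sigma> i))))))"
    by (rule sum.cong) (use \<rho> in \<open>auto simp: sign_compose\<close>)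
  also have "\<dots> = of_int (sign \<rho>) * ext_prod fs (\<lambda>i. v (\<rho> i))"
    by (simp add: ext_prod_def sum_distrib_left)
  finally show ?thesis by (cases \<rho> rule: sign_cases) auto
qed

lemma ext_prod_permute_list:
  assumes \<rho>: "\<rho> permutes {..<length fs}"
  shows "ext_prod (permute_list \<rho> fs) v = of_int (sign \<rho>) * ext_prod fs v"
proof -
  let ?n = "length fs"
  have inv: "inv \<rho> permutes {..<?n}" by (rule permutes_inv[OF \<rho>])
  let ?F = "\<lambda>\<sigma>. of_int (sign \<sigma>) * (\<Prod>i<?n. (fs ! \<rho> i) (v (\<sigma> i)))"
  have "ext_prod (permute_list \<rho> fs) v = (\<Sum>\<sigma> | \<sigma> permutes {..<?n}. ?F \<sigma>)"
    unfolding ext_prod_def by (intro sum.cong) (auto simp: permute_list_nth[OF \<rho>])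
  also have "\<dots> = (\<Sum>\<sigma> | \<sigma> permutes {..<?n}. ?F (\<sigma> \<circ> \<rho>))"
    by (rule sum_permutes_compose_right[OF \<rho>, symmetric])
  also have "\<dots> = (\<Sum>\<sigma> | \<sigma> permutes {..<?n}.
      of_int (sign \<rho>) * (of_int (sign \<sigma>) * (\<Prod>i<?n. (fs ! i) (v (\<sigma> i)))))"
  proof (rule sum.cong)
    fix \<sigma> assume "\<sigma> \<in> {\<sigma>. \<sigma> permutes {..<?n}}"
    moreover have "(\<Prod>i<?n. (fs ! \<rho> i) (v (\<sigma> (\<rho> i)))) = (\<Prod>i<?n. (fs ! i) (v (\<sigma> i)))"
      using prod.permute[OF \<rho>, of "\<lambda>i. (fs ! i) (v (\<sigma> i))"] by (simp add: o_def)
    ultimately show "?F (\<sigma> \<circ> \<rho>) =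
      of_int (sign \<rho>) * (of_int (sign \<sigma>) * (\<Prod>i<?n. (fs ! i) (v (\<sigma> i))))"
      using \<rho> by (simp add: sign_compose)
  qed simp
  also have "\<dots> = of_int (sign \<rho>) * ext_prod fs v" by (simp add: ext_prod_def sum_distrib_left)
  finally show ?thesis .
qed

lemma permute_list_transpose_Suc:
  "permute_list (Transposition.transpose (length xs) (Suc (length xs))) (xs @ x # y # zs) = xs @ y # x # zs"
proof (rule nth_equalityI)
  let ?\<rho> = "Transposition.transpose (length xs) (Suc (length xs))"
  have \<rho>: "?\<rho> permutes {..<length (xs @ x # y # zs)}"
    by (rule permutes_swap_id) auto
  fix i assume "i < length (permute_list ?\<rho> (xs @ x # y # zs))"
  then show "permute_list ?\<rho> (xs @ x # y # zs) ! i = (xs @ y # x # zs) ! i"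
    using permute_list_nth[OF \<rho>, of i]
    by (auto simp: Transposition.transpose_def nth_append nth_Cons split: nat.splits)
qed simp

lemma ext_prod_swap: "ext_prod (xs @ x # y # zs) v = - ext_prod (xs @ y # x # zs) v"
proof -
  let ?\<rho> = "Transposition.transpose (length xs) (Suc (length xs))"
  have \<rho>: "?\<rho> permutes {..<length (xs @ y # x # zs)}"
    by (rule permutes_swap_id) auto
  show ?thesis
    using ext_prod_permute_list[OF \<rho>, of v]
    by (simp only: permute_list_transpose_Suc) (simp add: sign_swap_id)
qed

lemma ext_prod_move:
  "ext_prod (xs @ ys @ z # zs) v = (-1) ^ length ys * ext_prod (xs @ z # ys @ zs) v"
proof (induction ys arbitrary: xs)
  case (Cons y ys)
  have "ext_prod (xs @ (y # ys) @ z # zs) v = ext_prod ((xs @ [y]) @ ys @ z # zs) v" by simp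
  also have "\<dots> = (-1) ^ length ys * ext_prod (xs @ y # z # ys @ zs) v"
    by (subst Cons.IH) simp
  finally show ?case by (subst (asm) ext_prod_swap) simp
qed simp

lemma ext_prod_move_block:
  "ext_prod (xs @ ys @ zs @ ws) v = (-1) ^ (length ys * length zs) * ext_prod (xs @ zs @ ys @ ws) v"
proof (induction zs arbitrary: xs)
  case (Cons z zs)
  have "ext_prod (xs @ ys @ (z # zs) @ ws) v = (-1) ^ length ys * ext_prod ((xs @ [z]) @ ys @ zs @ ws) v"
    using ext_prod_move[of xs ys z "zs @ ws"] by simp
  also have "\<dots> = (-1) ^ length ys * ((-1) ^ (length ys * length zs) * ext_prod ((xs @ [z]) @ zs @ ys @ ws) v)"
    by (simp only: Cons.IH)
  finally show ?case by (simp add: power_add)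
qed simp

lemma ext_prod_not_distinct:
  assumes "\<not> distinct fs"
  shows "ext_prod fs v = 0"
proof -
  obtain xs ys zs y where fs: "fs = xs @ [y] @ ys @ [y] @ zs"
    using not_distinct_decomp[OF assms] by blast
  have "ext_prod fs v = (-1) ^ length ys * ext_prod (xs @ y # y # ys @ zs) v"
    using ext_prod_move[of "xs @ [y]" ys y zs] by (simp add: fs)
  moreover have "ext_prod (xs @ y # y # ys @ zs) v = 0"
    using ext_prod_swap[of xs y y "ys @ zs" v] by simp
  ultimately show ?thesis by simp
qed

lemma ext_prod_permute_block:
  assumes \<sigma>: "\<sigma> permutes {..<n}"
  shows "ext_prod (map (\<lambda>j. a (\<sigma> j)) [0..<n] @ ys) v = of_int (sign \<sigma>) * ext_prod (map a [0..<n] @ ys) v"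
proof -
  have \<sigma>': "\<sigma> permutes {..<length (map a [0..<n] @ ys)}"
    by (rule permutes_subset[OF \<sigma>]) auto
  have "permute_list \<sigma> (map a [0..<n] @ ys) = map (\<lambda>j. a (\<sigma> j)) [0..<n] @ ys"
  proof (rule nth_equalityI)
    fix i assume "i < length (permute_list \<sigma> (map a [0..<n] @ ys))"
    then have i: "i < n + length ys" by simp
    show "permute_list \<sigma> (map a [0..<n] @ ys) ! i = (map (\<lambda>j. a (\<sigma> j)) [0..<n] @ ys) ! i"
    proof (cases "i < n")
      case True
      then have "\<sigma> i < n" using permutes_in_image[OF \<sigma>, of i] by simp
      then show ?thesis using permute_list_nth[OF \<sigma>', of i] i True by (simp add: nth_append)
    next
      case False
      then have "\<sigma> i = i" using permutes_not_in[OF \<sigma>, of i] by simp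
      then show ?thesis using permute_list_nth[OF \<sigma>', of i] i False by (simp add: nth_append)
    qed
  qed simp
  then show ?thesis using ext_prod_permute_list[OF \<sigma>', of v] by simp
qed

text \<open>The sign of a perfect shuffle: bringing \<open>a\<^sub>j\<close> next to \<open>b\<^sub>j\<close> takes it past \<open>b\<^sub>0, \<dots>, b\<^sub>j\<^sub>-\<^sub>1\<close>, and
\<open>0 + 1 + \<dots> + (n - 1) = n (n - 1) / 2\<close>.\<close>

lemma ext_prod_interleave:
  "ext_prod (xs @ map a [0..<n] @ map b [0..<n] @ zs) v =
     (-1) ^ (n * (n - 1) div 2) * ext_prod (xs @ concat (map (\<lambda>j. [a j, b j]) [0..<n]) @ zs) v"
proof (induction n arbitrary: zs)
  case (Suc n)
  have ev: "Suc n * (Suc n - 1) div 2 = n * (n - 1) div 2 + n"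
  proof -
    have "even (n * (n - 1))" by (cases n) auto
    then obtain k where "n * (n - 1) = 2 * k" by blast
    moreover have "Suc n * (Suc n - 1) = n * (n - 1) + 2 * n" by (cases n) (auto simp: algebra_simps)
    ultimately show ?thesis by simp
  qed
  have "ext_prod (xs @ map a [0..<Suc n] @ map b [0..<Suc n] @ zs) v =
     ext_prod ((xs @ map a [0..<n]) @ [a n] @ map b [0..<n] @ (b n # zs)) v" by simp
  also have "\<dots> = (-1) ^ n * ext_prod (xs @ map a [0..<n] @ map b [0..<n] @ (a n # b n # zs)) v"
    by (subst ext_prod_move_block) simp
  also have "\<dots> = (-1) ^ n * (-1) ^ (n * (n - 1) div 2) *
      ext_prod (xs @ concat (map (\<lambda>j. [a j, b j]) [0..<n]) @ (a n # b n # zs)) v"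
    by (simp only: Suc.IH mult.assoc)
  finally show ?case by (simp only: ev power_add) simp
qed simp

lemma ext_prod_swap_pairs:
  "ext_prod (xs @ concat (map (\<lambda>j. [a j, b j]) js) @ zs) v =
     (-1) ^ length js * ext_prod (xs @ concat (map (\<lambda>j. [b j, a j]) js) @ zs) v"
proof (induction js arbitrary: xs)
  case (Cons j js)
  have "ext_prod (xs @ concat (map (\<lambda>j. [a j, b j]) (j # js)) @ zs) v =
     ext_prod ((xs @ [a j, b j]) @ concat (map (\<lambda>j. [a j, b j]) js) @ zs) v" by simp
  also have "\<dots> = (-1) ^ length js * ext_prod ((xs @ [a j, b j]) @ concat (map (\<lambda>j. [b j, a j]) js) @ zs) v"
    by (rule Cons.IH)
  also have "\<dots> = (-1) ^ length js * ext_prod (xs @ a j # b j # concat (map (\<lambda>j. [b j, a j]) js) @ zs) v"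
    by simp
  finally show ?case by (subst (asm) ext_prod_swap) simp
qed simp

lemma alt_form_cong: "alt_form k \<omega> \<Longrightarrow> (\<And>i. i < k \<Longrightarrow> v i = w i) \<Longrightarrow> \<omega> v = \<omega> w"
  unfolding alt_form_def by (elim conjE allE[of _ v] allE[of _ w]) simp

lemma alt_form_linear: "alt_form k \<omega> \<Longrightarrow> i < k \<Longrightarrow> linear (\<lambda>x. \<omega> (v(i := x)))"
  unfolding alt_form_def by blast

lemma alt_form_zero: "alt_form k \<omega> \<Longrightarrow> i < k \<Longrightarrow> j < k \<Longrightarrow> i \<noteq> j \<Longrightarrow> v i = v j \<Longrightarrow> \<omega> v = 0"
  unfolding alt_form_def by blast

lemma alt_form_ext_prod:
  assumes lin: "\<And>f. f \<in> set fs \<Longrightarrow> linear f" and k: "k = length fs"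
  shows "alt_form k (ext_prod fs)"
  unfolding alt_form_def
proof (intro conjI allI impI)
  fix v w :: "nat \<Rightarrow> 'a" assume "\<forall>i<k. v i = w i"
  then have eq: "v (\<sigma> i) = w (\<sigma> i)" if "\<sigma> permutes {..<length fs}" "i < length fs" for \<sigma> i
    using that permutes_in_image[OF that(1), of i] k by simp
  show "ext_prod fs v = ext_prod fs w"
    unfolding ext_prod_def by (intro sum.cong arg_cong2[where f="(*)"] prod.cong) (auto simp: eq)
next
  fix v :: "nat \<Rightarrow> 'a" and i assume i: "i < k"
  show "linear (\<lambda>x. ext_prod fs (v(i := x)))"
    unfolding ext_prod_def
  proof (rule linear_compose_sum, rule ballI)
    fix \<sigma> assume "\<sigma> \<in> {\<sigma>. \<sigma> permutes {..<length fs}}"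
    then have \<sigma>: "\<sigma> permutes {..<length fs}" by simp
    obtain r where r: "r < length fs" "\<sigma> r = i"
      using permutes_image[OF \<sigma>] i k by (metis imageE lessThan_iff)
    have ne: "\<sigma> j \<noteq> i" if "j \<noteq> r" for j
      using r that permutes_inj[OF \<sigma>] by (metis injD)
    have "(\<lambda>x. of_int (sign \<sigma>) * (\<Prod>j<length fs. (fs ! j) ((v(i := x)) (\<sigma> j)))) =
          (\<lambda>x. (of_int (sign \<sigma>) * (\<Prod>j\<in>{..<length fs} - {r}. (fs ! j) (v (\<sigma> j)))) *\<^sub>R (fs ! r) x)"
    proof
      fix x
      have "(\<Prod>j<length fs. (fs ! j) ((v(i := x)) (\<sigma> j))) =
         (fs ! r) ((v(i := x)) (\<sigma> r)) * (\<Prod>j\<in>{..<length fs} - {r}. (fs ! j) ((v(i := x)) (\<sigma> j)))"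
        using r by (intro prod.remove) auto
      also have "(\<Prod>j\<in>{..<length fs} - {r}. (fs ! j) ((v(i := x)) (\<sigma> j))) =
         (\<Prod>j\<in>{..<length fs} - {r}. (fs ! j) (v (\<sigma> j)))"
        by (intro prod.cong) (auto simp: ne)
      finally show "of_int (sign \<sigma>) * (\<Prod>j<length fs. (fs ! j) ((v(i := x)) (\<sigma> j))) =
          (of_int (sign \<sigma>) * (\<Prod>j\<in>{..<length fs} - {r}. (fs ! j) (v (\<sigma> j)))) *\<^sub>R (fs ! r) x"
        using r by simp
    qed
    moreover have "linear (fs ! r)" using r by (intro lin) simp
    ultimately show "linear (\<lambda>x. of_int (sign \<sigma>) * (\<Prod>j<length fs. (fs ! j) ((v(i := x)) (\<sigma> j))))"
      by (simp only: linear_compose_scale_right)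
  qed
next
  fix v :: "nat \<Rightarrow> 'a" and i j assume ij: "i < k" "j < k" "i \<noteq> j" "v i = v j"
  have tr: "Transposition.transpose i j permutes {..<length fs}" using ij k by (intro permutes_swap_id) auto
  have "(\<lambda>r. v (Transposition.transpose i j r)) = v"
    using ij by (intro ext) (simp add: Transposition.transpose_def)
  then show "ext_prod fs v = 0" using ext_prod_permute_args[OF tr, of v] ij by (simp add: sign_swap_id)
qed

text \<open>Polarization: expand the value at the equal arguments \<open>x + y, x + y\<close>, which is \<open>0\<close>.\<close>

lemma alt_form_transpose:
  assumes alt: "alt_form k \<omega>" and ij: "i < k" "j < k" "i \<noteq> j"
  shows "\<omega> (\<lambda>r. v (Transposition.transpose i j r)) = - \<omega> v"
proof -
  let ?f = "\<lambda>x y. \<omega> ((v(i := x))(j := y))"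
  have z: "?f x x = 0" for x using alt_form_zero[OF alt ij] by simp
  have l2: "?f x (y + y') = ?f x y + ?f x y'" for x y y'
    using linear_add[OF alt_form_linear[OF alt ij(2)]] .
  have l1: "?f (x + x') y = ?f x y + ?f x' y" for x x' y
    using linear_add[OF alt_form_linear[OF alt ij(1), of "v(j := y)"]] ij(3)
    by (simp add: fun_upd_twist)
  have "?f (v i + v j) (v i + v j) = ?f (v i) (v i) + ?f (v i) (v j) + (?f (v j) (v i) + ?f (v j) (v j))"
    by (simp only: l1 l2)
  then have "0 = ?f (v i) (v j) + ?f (v j) (v i)" by (simp only: z add_0_left add_0_right)
  then have "?f (v j) (v i) = - ?f (v i) (v j)" by linarith
  moreover have "(v(i := v j))(j := v i) = (\<lambda>r. v (Transposition.transpose i j r))"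
    using ij by (auto simp: Transposition.transpose_def)
  moreover have "(v(i := v i))(j := v j) = v" by simp
  ultimately show ?thesis by metis
qed

lemma alt_form_permute:
  assumes alt: "alt_form k \<omega>" and \<sigma>: "\<sigma> permutes {..<k}"
  shows "\<omega> (\<lambda>r. v (\<sigma> r)) = of_int (sign \<sigma>) * \<omega> v"
  using \<sigma> finite_lessThan
proof (induction \<sigma> arbitrary: v rule: permutes_induct)
  case id
  then show ?case by (simp add: id_def)
next
  case (swap a b p)
  have "\<omega> (\<lambda>r. v ((Transposition.transpose a b \<circ> p) r)) = of_int (sign p) * \<omega> (\<lambda>r. v (Transposition.transpose a b r))"
    using swap.IH(1)[of "\<lambda>r. v (Transposition.transpose a b r)"] by (simp add: o_def)
  also have "\<dots> = of_int (sign p) * (- \<omega> v)"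
    using alt_form_transpose[OF alt, of a b v] swap.hyps by simp
  also have "\<dots> = of_int (sign (Transposition.transpose a b \<circ> p)) * \<omega> v"
    using swap.hyps by (simp add: sign_compose permutation_swap_id sign_swap_id)
  finally show ?case .
qed

lemma alt_form_scale: "alt_form k \<omega> \<Longrightarrow> alt_form k (\<lambda>v. c * \<omega> v)"
  unfolding alt_form_def by (auto intro!: linear_compose_scale_right[where 'b=real, simplified])

lemma alt_form_sum:
  assumes "\<And>x. x \<in> X \<Longrightarrow> alt_form k (\<omega> x)"
  shows "alt_form k (\<lambda>v. \<Sum>x\<in>X. \<omega> x v)"
  using assms unfolding alt_form_def by (auto intro!: linear_compose_sum sum.cong sum.neutral)

lemma alt_form_diff: "alt_form k \<omega> \<Longrightarrow> alt_form k \<eta> \<Longrightarrow> alt_form k (\<lambda>v. \<omega> v - \<eta> v)"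
  unfolding alt_form_def by (auto intro!: linear_compose_sub) metis

lemma prod_lessThan_add: "(\<Prod>i<k + l. h i) = (\<Prod>i<k. h i) * (\<Prod>j<l. h (k + j :: nat))"
  for h :: "nat \<Rightarrow> 'a::comm_monoid_mult"
  by (induction l) (simp_all add: mult.assoc)

text \<open>The wedge product averages over all permutations of the \<open>k + l\<close> arguments. Permuting within the two blocks
of arguments changes nothing but signs that cancel, so each term of the determinant on the right is
met \<open>k! l!\<close> times, which is the denominator in the definition.\<close>

theorem wedge_ext_prod: "wedge (length fs) (length gs) (ext_prod fs) (ext_prod gs) = ext_prod (fs @ gs)"
proof
  fix v :: "nat \<Rightarrow> 'a"
  let ?k = "length fs" and ?l = "length gs"
  define F where "F \<sigma> = of_int (sign \<sigma>) * ((\<Prod>i<?k. (fs ! i) (v (\<sigma> i))) * (\<Prod>j<?l. (gs ! j) (v (\<sigma> (?k + j)))))"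
    for \<sigma> :: "nat \<Rightarrow> nat"
  define J where "J \<rho> \<tau> = \<rho> \<circ> map_permutation {..<?l} ((+) ?k) \<tau>" for \<rho> \<tau> :: "nat \<Rightarrow> nat"
  have inj: "inj_on ((+) ?k) {..<?l}" by simp
  have J: "J \<rho> \<tau> permutes {..<?k + ?l}" "sign (J \<rho> \<tau>) = sign \<rho> * sign \<tau>"
    "\<And>i. i < ?k \<Longrightarrow> J \<rho> \<tau> i = \<rho> i" "\<And>j. j < ?l \<Longrightarrow> J \<rho> \<tau> (?k + j) = ?k + \<tau> j"
    if \<rho>: "\<rho> permutes {..<?k}" and \<tau>: "\<tau> permutes {..<?l}" for \<rho> \<tau>
  proof -
    let ?\<tau> = "map_permutation {..<?l} ((+) ?k) \<tau>"
    have \<tau>0: "?\<tau> permutes (+) ?k ` {..<?l}"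
      using \<tau> inj by (intro map_permutation_permutes) (auto simp: bij_betw_def)
    then have \<tau>1: "?\<tau> permutes {..<?k + ?l}" by (rule permutes_subset) auto
    have \<rho>1: "\<rho> permutes {..<?k + ?l}" using \<rho> by (rule permutes_subset) auto
    show "J \<rho> \<tau> permutes {..<?k + ?l}" unfolding J_def by (rule permutes_compose[OF \<tau>1 \<rho>1])
    show "sign (J \<rho> \<tau>) = sign \<rho> * sign \<tau>"
      unfolding J_def using \<tau>1 \<rho>1 \<tau> by (simp add: sign_compose sign_map_permutation)
    show "J \<rho> \<tau> i = \<rho> i" if "i < ?k" for i
      using permutes_not_in[OF \<tau>0, of i] that by (simp add: J_def image_iff)
    show "J \<rho> \<tau> (?k + j) = ?k + \<tau> j" if "j < ?l" for j
      using map_permutation_apply[OF inj, of j \<tau>] permutes_not_in[OF \<rho>, of "?k + \<tau> j"] that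
      by (simp add: J_def)
  qed
  have "ext_prod (fs @ gs) v = (\<Sum>\<sigma> | \<sigma> permutes {..<?k + ?l}. F \<sigma>)"
    unfolding ext_prod_def F_def by (simp add: prod_lessThan_add nth_append)
  then have F: "(\<Sum>\<sigma> | \<sigma> permutes {..<?k + ?l}. F (\<sigma> \<circ> J \<rho> \<tau>)) = ext_prod (fs @ gs) v"
    if "\<rho> permutes {..<?k}" "\<tau> permutes {..<?l}" for \<rho> \<tau>
    using sum_permutes_compose_right[OF J(1)[OF that], of F] by simp
  have "(\<Sum>\<sigma> | \<sigma> permutes {..<?k + ?l}.
      of_int (sign \<sigma>) * ext_prod fs (\<lambda>i. v (\<sigma> i)) * ext_prod gs (\<lambda>i. v (\<sigma> (?k + i)))) =
    (\<Sum>\<sigma> | \<sigma> permutes {..<?k + ?l}. \<Sum>\<rho> | \<rho> permutes {..<?k}. \<Sum>\<tau> | \<tau> permutes {..<?l}. F (\<sigma> \<circ> J \<rho> \<tau>))"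
  proof (rule sum.cong[OF refl])
    fix \<sigma> assume "\<sigma> \<in> {\<sigma>. \<sigma> permutes {..<?k + ?l}}"
    then have \<sigma>: "\<sigma> permutes {..<?k + ?l}" by simp
    have "of_int (sign \<sigma>) * ext_prod fs (\<lambda>i. v (\<sigma> i)) * ext_prod gs (\<lambda>i. v (\<sigma> (?k + i))) =
      (\<Sum>\<rho> | \<rho> permutes {..<?k}. \<Sum>\<tau> | \<tau> permutes {..<?l}.
         of_int (sign \<sigma>) * (of_int (sign \<rho>) * (\<Prod>i<?k. (fs ! i) (v (\<sigma> (\<rho> i)))) *
           (of_int (sign \<tau>) * (\<Prod>j<?l. (gs ! j) (v (\<sigma> (?k + \<tau> j)))))))"
      unfolding ext_prod_def mult.assoc sum_product by (simp only: sum_distrib_left)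
    also have "\<dots> = (\<Sum>\<rho> | \<rho> permutes {..<?k}. \<Sum>\<tau> | \<tau> permutes {..<?l}. F (\<sigma> \<circ> J \<rho> \<tau>))"
    proof (intro sum.cong refl)
      fix \<rho> \<tau> assume "\<rho> \<in> {\<rho>. \<rho> permutes {..<?k}}" "\<tau> \<in> {\<tau>. \<tau> permutes {..<?l}}"
      then have \<rho>: "\<rho> permutes {..<?k}" and \<tau>: "\<tau> permutes {..<?l}" by auto
      show "of_int (sign \<sigma>) * (of_int (sign \<rho>) * (\<Prod>i<?k. (fs ! i) (v (\<sigma> (\<rho> i)))) *
           (of_int (sign \<tau>) * (\<Prod>j<?l. (gs ! j) (v (\<sigma> (?k + \<tau> j)))))) = F (\<sigma> \<circ> J \<rho> \<tau>)"
        using \<sigma> J[OF \<rho> \<tau>] by (simp add: F_def sign_compose)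
    qed
    finally show "of_int (sign \<sigma>) * ext_prod fs (\<lambda>i. v (\<sigma> i)) * ext_prod gs (\<lambda>i. v (\<sigma> (?k + i))) =
      (\<Sum>\<rho> | \<rho> permutes {..<?k}. \<Sum>\<tau> | \<tau> permutes {..<?l}. F (\<sigma> \<circ> J \<rho> \<tau>))" .
  qed
  also have "\<dots> = (\<Sum>\<rho> | \<rho> permutes {..<?k}. \<Sum>\<tau> | \<tau> permutes {..<?l}.
      \<Sum>\<sigma> | \<sigma> permutes {..<?k + ?l}. F (\<sigma> \<circ> J \<rho> \<tau>))"
    by (subst sum.swap, intro sum.cong refl sum.swap)
  also have "\<dots> = (\<Sum>\<rho> | \<rho> permutes {..<?k}. \<Sum>\<tau> | \<tau> permutes {..<?l}. ext_prod (fs @ gs) v)"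
    by (intro sum.cong refl) (simp add: F)
  also have "\<dots> = fact ?k * fact ?l * ext_prod (fs @ gs) v"
    by (simp add: card_permutations[OF refl])
  finally show "wedge ?k ?l (ext_prod fs) (ext_prod gs) v = ext_prod (fs @ gs) v"
    by (simp add: wedge_def)
qed

text \<open>Splitting off the last entry of a multi-index, for the induction that expands a form slot by slot.\<close>

lemma sum_PiE_Suc:
  assumes "finite T"
  shows "(\<Sum>I\<in>{..<Suc m} \<rightarrow>\<^sub>E T. f I) = (\<Sum>I\<in>{..<m} \<rightarrow>\<^sub>E T. \<Sum>y\<in>T. f (I(m := y)))"
proof -
  have "(\<Sum>I\<in>{..<Suc m} \<rightarrow>\<^sub>E T. f I) = (\<Sum>(y, I)\<in>T \<times> ({..<m} \<rightarrow>\<^sub>E T). f (I(m := y)))"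
    unfolding lessThan_Suc PiE_insert_eq
    by (subst sum.reindex[OF inj_combinator]) (auto simp: case_prod_beta)
  also have "\<dots> = (\<Sum>y\<in>T. \<Sum>I\<in>{..<m} \<rightarrow>\<^sub>E T. f (I(m := y)))"
    by (rule sum.cartesian_product[symmetric])
  finally show ?thesis by (subst (asm) sum.swap)
qed

lemma wedge_sum_right: "wedge k l \<alpha> (\<lambda>v. \<Sum>x\<in>X. \<beta> x v) = (\<lambda>v. \<Sum>x\<in>X. wedge k l \<alpha> (\<beta> x) v)"
  unfolding wedge_def
  by (rule ext, simp add: sum_distrib_left sum_divide_distrib, rule sum.swap)

lemma wedge_sum_left: "wedge k l (\<lambda>v. \<Sum>x\<in>X. \<alpha> x v) \<beta> = (\<lambda>v. \<Sum>x\<in>X. wedge k l (\<alpha> x) \<beta> v)"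
  unfolding wedge_def
  by (rule ext, simp add: sum_distrib_left sum_distrib_right sum_divide_distrib, rule sum.swap)

lemma wedge_scale_right: "wedge k l \<alpha> (\<lambda>v. c * \<beta> v) = (\<lambda>v. c * wedge k l \<alpha> \<beta> v)"
  unfolding wedge_def by (rule ext) (simp add: sum_distrib_left mult.left_commute)

lemma wedge_scale_left: "wedge k l (\<lambda>v. c * \<alpha> v) \<beta> = (\<lambda>v. c * wedge k l \<alpha> \<beta> v)"
  unfolding wedge_def by (rule ext) (simp add: sum_distrib_left mult.assoc mult.left_commute)

lemma wedge_diff_right: "wedge k l \<alpha> (\<lambda>v. \<beta> v - \<gamma> v) = (\<lambda>v. wedge k l \<alpha> \<beta> v - wedge k l \<alpha> \<gamma> v)"
  unfolding wedge_def by (rule ext) (simp add: sum_subtractf algebra_simps diff_divide_distrib)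

lemma form_inner_sum_right:
  "form_inner G k \<omega> (\<lambda>v. \<Sum>x\<in>X. \<beta> x v) = (\<Sum>x\<in>X. form_inner G k \<omega> (\<beta> x))"
  unfolding form_inner_def Let_def by (simp add: sum_distrib_left sum_divide_distrib, rule sum.swap)

lemma form_inner_scale_right: "form_inner G k \<omega> (\<lambda>v. c * \<beta> v) = c * form_inner G k \<omega> \<beta>"
  unfolding form_inner_def Let_def by (simp add: sum_distrib_left mult.left_commute)

lemma ext_prod_permute_middle:
  assumes \<sigma>: "\<sigma> permutes {..<n}"
  shows "ext_prod (xs @ map (\<lambda>j. a (\<sigma> j)) [0..<n] @ ys) v =
    of_int (sign \<sigma>) * ext_prod (xs @ map a [0..<n] @ ys) v"
proof -
  have "ext_prod (xs @ map (\<lambda>j. a (\<sigma> j)) [0..<n] @ ys) v =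
     (-1) ^ (length xs * n) * ext_prod (map (\<lambda>j. a (\<sigma> j)) [0..<n] @ xs @ ys) v"
    using ext_prod_move_block[of "[]" xs "map (\<lambda>j. a (\<sigma> j)) [0..<n]" ys v] by simp
  also have "\<dots> = of_int (sign \<sigma>) * ((-1) ^ (length xs * n) * ext_prod (map a [0..<n] @ xs @ ys) v)"
    by (simp add: ext_prod_permute_block[OF \<sigma>])
  also have "\<dots> = of_int (sign \<sigma>) * ext_prod (xs @ map a [0..<n] @ ys) v"
    using ext_prod_move_block[of "[]" xs "map a [0..<n]" ys v] by simp
  finally show ?thesis .
qed

lemma bij_betw_map_permutation:
  assumes "bij_betw f A B"
  shows "bij_betw (map_permutation A f) {p. p permutes A} {p. p permutes B}"
proof -
  have "map_permutation A f = (\<lambda>\<pi> x. if x \<in> B then f (\<pi> (inv_into A f x)) else x)"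
    using assms by (auto simp: map_permutation_def restrict_id_def fun_eq_iff bij_betw_def)
  then show ?thesis using bij_betw_permutations[OF assms] by simp
qed

lemma ext_prod_precompose: "ext_prod fs (\<lambda>i. f (v i)) = ext_prod (map (\<lambda>\<phi> x. \<phi> (f x)) fs) v"
  by (simp add: ext_prod_def)

lemma ext_prod_single: "ext_prod [f] v = f (v 0)"
proof -
  have "{\<sigma>. \<sigma> permutes {0::nat}} = {id}" by auto
  then show ?thesis by (simp add: ext_prod_def lessThan_Suc)
qed

lemma ext_prod_pair: "ext_prod [f, h] v = f (v 0) * h (v 1) - f (v 1) * h (v 0)"
proof -
  have "{..<length [f, h]} = {0, 1}" by auto
  moreover have "{\<sigma>. \<sigma> permutes {0, 1 :: nat}} = {id, Transposition.transpose 0 1}"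
    by (auto simp: permutes_doubleton_iff)
  moreover have "id \<noteq> Transposition.transpose 0 (1::nat)"
    by (metis id_apply transpose_apply_first zero_neq_one)
  ultimately show ?thesis by (simp add: ext_prod_def sign_swap_id)
qed

text \<open>The interior product with a vector that only the first factor detects. In the determinant, only
permutations fixing \<open>0\<close> survive.\<close>

lemma ext_prod_Cons_eval:
  assumes e: "e x = 1" and 0: "\<And>f. f \<in> set fs \<Longrightarrow> f x = 0"
  shows "ext_prod (e # fs) (case_nat x y) = ext_prod fs y"
proof -
  let ?n = "length fs"
  let ?t = "\<lambda>\<sigma>. of_int (sign \<sigma>) * (\<Prod>i<Suc ?n. ((e # fs) ! i) (case_nat x y (\<sigma> i)))"
  have bij: "bij_betw Suc {..<?n} (Suc ` {..<?n})" by (auto simp: bij_betw_def)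
  have "ext_prod (e # fs) (case_nat x y) = (\<Sum>\<sigma> | \<sigma> permutes {..<Suc ?n}. ?t \<sigma>)"
    by (simp add: ext_prod_def)
  also have "\<dots> = (\<Sum>\<sigma> | \<sigma> permutes Suc ` {..<?n}. ?t \<sigma>)"
  proof (rule sum.mono_neutral_right)
    show "{\<sigma>. \<sigma> permutes Suc ` {..<?n}} \<subseteq> {\<sigma>. \<sigma> permutes {..<Suc ?n}}"
      by (auto elim!: permutes_subset)
    show "\<forall>\<sigma>\<in>{\<sigma>. \<sigma> permutes {..<Suc ?n}} - {\<sigma>. \<sigma> permutes Suc ` {..<?n}}. ?t \<sigma> = 0"
    proof
      fix \<sigma> assume "\<sigma> \<in> {\<sigma>. \<sigma> permutes {..<Suc ?n}} - {\<sigma>. \<sigma> permutes Suc ` {..<?n}}"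
      then have \<sigma>: "\<sigma> permutes {..<Suc ?n}" "\<not> \<sigma> permutes Suc ` {..<?n}" by auto
      have "\<sigma> 0 \<noteq> 0"
      proof
        assume "\<sigma> 0 = 0"
        then have "\<sigma> permutes Suc ` {..<?n}"
        proof (intro permutes_superset[OF \<sigma>(1)])
          fix x assume "x \<in> {..<Suc ?n} - Suc ` {..<?n}"
          then have "x = 0" by (cases x) auto
          then show "\<sigma> x = x" using \<open>\<sigma> 0 = 0\<close> by simp
        qed
        then show False using \<sigma> by simp
      qed
      obtain r where r: "r < Suc ?n" "\<sigma> r = 0" using permutes_image[OF \<sigma>(1)] by (metis imageE lessThan_iff zero_less_Suc)
      then obtain r' where r': "r = Suc r'" using \<open>\<sigma> 0 \<noteq> 0\<close> by (cases r) auto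
      have "((e # fs) ! r) (case_nat x y (\<sigma> r)) = 0" using r r' by (simp add: 0)
      then have "\<exists>i\<in>{..<Suc ?n}. ((e # fs) ! i) (case_nat x y (\<sigma> i)) = 0" using r(1) by blast
      then have "(\<Prod>i<Suc ?n. ((e # fs) ! i) (case_nat x y (\<sigma> i))) = 0" by (rule prod_zero[OF finite_lessThan])
      then show "?t \<sigma> = 0" by simp
    qed
  qed (simp add: finite_permutations)
  also have "\<dots> = (\<Sum>\<tau> | \<tau> permutes {..<?n}. ?t (map_permutation {..<?n} Suc \<tau>))"
    by (rule sum.reindex_bij_betw[OF bij_betw_map_permutation[OF bij], symmetric])
  also have "\<dots> = ext_prod fs y"
    unfolding ext_prod_def
  proof (rule sum.cong)
    fix \<tau> assume "\<tau> \<in> {\<tau>. \<tau> permutes {..<?n}}"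
    then have \<tau>: "\<tau> permutes {..<?n}" by simp
    let ?\<sigma> = "map_permutation {..<?n} Suc \<tau>"
    have s0: "?\<sigma> 0 = 0"
      using permutes_not_in[OF map_permutation_permutes[OF bij \<tau>], of 0] by auto
    have "?\<sigma> (Suc i) = Suc (\<tau> i)" if "i < ?n" for i
      using map_permutation_apply[of Suc "{..<?n}" i \<tau>] that by simp
    then show "?t ?\<sigma> = of_int (sign \<tau>) * (\<Prod>i<?n. (fs ! i) (y (\<tau> i)))"
      using sign_map_permutation[of Suc "{..<?n}" \<tau>] \<tau>
      by (simp add: prod.lessThan_Suc_shift s0 e del: prod.lessThan_Suc)
  qed simp
  finally show ?thesis .
qed

section \<open>Orthonormal frames\<close>

text \<open>The inner product \<open>G\<close> is an arbitrary one, unrelated to that of the Euclidean space, which only supplies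
the dimension.\<close>

locale ortho_frame =
  fixes G :: "'v::euclidean_space \<Rightarrow> 'v \<Rightarrow> real" and E :: "nat \<Rightarrow> 'v"
  assumes inner: "inner_product G" and onb: "orthonormal_basis G E"
begin

lemma linear_G: "linear (G x)" and linear_G_left: "linear (\<lambda>x. G x y)" and G_sym: "G x y = G y x"
  and G_pos: "x \<noteq> 0 \<Longrightarrow> 0 < G x x"
  using inner unfolding inner_product_def bilinear_def by blast+

lemma G_E: "i < DIM('v) \<Longrightarrow> j < DIM('v) \<Longrightarrow> G (E i) (E j) = (if i = j then 1 else 0)"
  using onb unfolding orthonormal_basis_def by blast

lemma G_sum: "G x (\<Sum>i\<in>X. c i *\<^sub>R y i) = (\<Sum>i\<in>X. c i * G x (y i))"
  by (simp add: linear_sum[OF linear_G] linear_cmul[OF linear_G])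

lemma G_E_combination: "j < DIM('v) \<Longrightarrow> G (E j) (\<Sum>i<DIM('v). c i *\<^sub>R E i) = c j"
proof -
  assume j: "j < DIM('v)"
  then have "(\<Sum>i<DIM('v). c i * G (E j) (E i)) = (\<Sum>i<DIM('v). if j = i then c i else 0)"
    by (intro sum.cong) (auto simp: G_E)
  then show ?thesis using j by (simp add: G_sum)
qed

lemma inj_E: "inj_on E {..<DIM('v)}"
  by (rule inj_onI) (metis G_E lessThan_iff zero_neq_one)

lemma independent_E: "independent (E ` {..<DIM('v)})"
proof -
  have "u (E j) = 0" if "(\<Sum>v\<in>E ` {..<DIM('v)}. u v *\<^sub>R v) = 0" "j < DIM('v)" for u j
  proof -
    have "(\<Sum>i<DIM('v). u (E i) *\<^sub>R E i) = 0" using that by (simp add: sum.reindex[OF inj_E])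
    then show ?thesis using G_E_combination[OF that(2), of "\<lambda>i. u (E i)"] by (simp add: linear_0[OF linear_G])
  qed
  then show ?thesis by (subst dependent_finite) auto
qed

lemma expansion: "x = (\<Sum>i<DIM('v). G (E i) x *\<^sub>R E i)"
proof -
  have span: "span (E ` {..<DIM('v)}) = UNIV"
    using independent_E inj_E
    by (metis card_image card_lessThan dim_eq_card_independent dim_eq_full)
  define y where "y = x - (\<Sum>i<DIM('v). G (E i) x *\<^sub>R E i)"
  have "G y (E j) = 0" if "j < DIM('v)" for j
    using G_E_combination[OF that, of "\<lambda>i. G (E i) x"]
    by (simp add: y_def G_sym[of _ "E j"] linear_diff[OF linear_G])
  then have "G y y = 0"
    using linear_eq_0_on_span[OF linear_G, of "E ` {..<DIM('v)}" y y] span by auto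
  then have "y = 0" using G_pos[of y] by fastforce
  then show ?thesis by (simp add: y_def)
qed

lemma parseval: "G x y = (\<Sum>i<DIM('v). G (E i) x * G (E i) y)"
  by (subst expansion[of y]) (simp add: G_sum G_sym[of x] mult.commute)

text \<open>For \<open>js = [j\<^sub>1, \<dots>, j\<^sub>k]\<close> this is \<open>e\<^sup>j\<^sup>1 \<and> \<dots> \<and> e\<^sup>j\<^sup>k\<close>, in terms of the basis \<open>e\<^sup>j\<close> dual to \<open>E\<close>.\<close>

definition basis_form :: "nat list \<Rightarrow> 'v form" where
  "basis_form js = ext_prod (map (\<lambda>j. G (E j)) js)"

lemma alt_form_basis_form: "length js = k \<Longrightarrow> alt_form k (basis_form js)"
  unfolding basis_form_def by (rule alt_form_ext_prod) (auto simp: linear_G)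

lemma wedge_basis_form:
  "length js = k \<Longrightarrow> length is = l \<Longrightarrow> wedge k l (basis_form js) (basis_form is) = basis_form (js @ is)"
  using wedge_ext_prod[of "map (\<lambda>j. G (E j)) js" "map (\<lambda>j. G (E j)) is"] by (simp add: basis_form_def)

lemma basis_form_not_distinct: "\<not> distinct js \<Longrightarrow> basis_form js v = 0"
  unfolding basis_form_def by (rule ext_prod_not_distinct) (auto simp: distinct_map)

lemma basis_form_permute:
  "\<sigma> permutes {..<length js} \<Longrightarrow> basis_form (permute_list \<sigma> js) v = of_int (sign \<sigma>) * basis_form js v"
  unfolding basis_form_def using ext_prod_permute_list[of \<sigma> "map (\<lambda>j. G (E j)) js" v]
  by (simp add: permute_list_map)

lemma basis_form_eval:
  assumes js: "set js \<subseteq> {..<DIM('v)}" and I: "\<And>r. r < length js \<Longrightarrow> I r < DIM('v)"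
  shows "basis_form js (\<lambda>r. E (I r)) =
    (\<Sum>\<sigma> | \<sigma> permutes {..<length js}. if \<forall>r<length js. js ! r = I (\<sigma> r) then of_int (sign \<sigma>) else 0)"
  unfolding basis_form_def ext_prod_def
proof (intro sum.cong)
  fix \<sigma> assume "\<sigma> \<in> {\<sigma>. \<sigma> permutes {..<length js}}"
  then have \<sigma>: "\<sigma> r < length js" if "r < length js" for r
    using that permutes_in_image[of \<sigma> "{..<length js}" r] by simp
  have "(\<Prod>r<length js. (map (\<lambda>j. G (E j)) js ! r) (E (I (\<sigma> r)))) =
     (\<Prod>r<length js. if js ! r = I (\<sigma> r) then 1 else 0)"
    using js I \<sigma> by (intro prod.cong) (auto simp: G_E subset_iff)
  also have "\<dots> = (if \<forall>r<length js. js ! r = I (\<sigma> r) then 1 else 0)"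
    by (auto intro!: prod.neutral prod_zero)
  finally show "of_int (sign \<sigma>) *
      (\<Prod>r<length (map (\<lambda>j. G (E j)) js). (map (\<lambda>j. G (E j)) js ! r) (E (I (\<sigma> r)))) =
      (if \<forall>r<length js. js ! r = I (\<sigma> r) then of_int (sign \<sigma>) else 0)" by simp
qed auto

lemma basis_form_self:
  assumes js: "set js \<subseteq> {..<DIM('v)}" "distinct js"
  shows "basis_form js (\<lambda>r. E (js ! r)) = 1"
proof -
  have "(\<forall>r<length js. js ! r = js ! \<sigma> r) \<longleftrightarrow> \<sigma> = id" if \<sigma>: "\<sigma> permutes {..<length js}" for \<sigma>
  proof
    assume *: "\<forall>r<length js. js ! r = js ! \<sigma> r"
    show "\<sigma> = id"
    proof
      fix r show "\<sigma> r = id r"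
        using * js(2) \<sigma> permutes_in_image[OF \<sigma>, of r] permutes_not_in[OF \<sigma>, of r]
        by (cases "r < length js") (auto simp: nth_eq_iff_index_eq)
    qed
  qed auto
  note eq = this
  have "basis_form js (\<lambda>r. E (js ! r)) = (\<Sum>\<sigma> | \<sigma> permutes {..<length js}.
      if \<forall>r<length js. js ! r = js ! \<sigma> r then of_int (sign \<sigma>) else 0)"
    using js by (intro basis_form_eval) (auto simp: subset_iff)
  also have "\<dots> = (\<Sum>\<sigma> | \<sigma> permutes {..<length js}. if \<sigma> = id then 1 else 0)"
    using eq by (intro sum.cong refl) auto
  also have "\<dots> = 1" by (simp add: finite_permutations)
  finally show ?thesis .
qed

lemma alt_form_partial_expansion:
  assumes alt: "alt_form k \<omega>" and "m \<le> k"
  shows "\<omega> v = (\<Sum>I\<in>{..<m} \<rightarrow>\<^sub>E {..<DIM('v)}.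
     \<omega> (\<lambda>r. if r < m then E (I r) else v r) * (\<Prod>r<m. G (E (I r)) (v r)))"
  using \<open>m \<le> k\<close>
proof (induction m)
  case (Suc m)
  have step: "\<omega> (\<lambda>r. if r < m then E (I r) else v r) * P =
      (\<Sum>y<DIM('v). \<omega> (\<lambda>r. if r < Suc m then E ((I(m := y)) r) else v r) * (P * G (E y) (v m)))" for I P
  proof -
    let ?w = "\<lambda>r. if r < m then E (I r) else v r"
    have lin: "linear (\<lambda>x. \<omega> (?w(m := x)))" using alt_form_linear[OF alt, of m ?w] Suc.prems by simp
    have upd: "?w(m := E y) = (\<lambda>r. if r < Suc m then E ((I(m := y)) r) else v r)" for y
      by (auto simp: less_Suc_eq)
    have "\<omega> ?w = \<omega> (?w(m := v m))" by (simp add: fun_upd_idem)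
    also have "\<dots> = \<omega> (?w(m := \<Sum>y<DIM('v). G (E y) (v m) *\<^sub>R E y))" by (simp only: expansion[of "v m", symmetric])
    also have "\<dots> = (\<Sum>y<DIM('v). G (E y) (v m) * \<omega> (?w(m := E y)))"
      by (simp only: linear_sum[OF lin] linear_cmul[OF lin] real_scaleR_def)
    finally show ?thesis unfolding upd by (simp add: sum_distrib_left sum_distrib_right algebra_simps)
  qed
  have prd: "(\<Prod>r<Suc m. G (E ((I(m := y)) r)) (v r)) = (\<Prod>r<m. G (E (I r)) (v r)) * G (E y) (v m)" for I y
    by simp
  have "\<omega> v = (\<Sum>I\<in>{..<m} \<rightarrow>\<^sub>E {..<DIM('v)}.
     \<omega> (\<lambda>r. if r < m then E (I r) else v r) * (\<Prod>r<m. G (E (I r)) (v r)))"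
    using Suc by simp
  then show ?case
    unfolding sum_PiE_Suc[OF finite_lessThan] prd step .
qed (simp add: PiE_def)

lemma alt_form_expansion:
  assumes alt: "alt_form k \<omega>"
  shows "\<omega> v = (\<Sum>I\<in>{..<k} \<rightarrow>\<^sub>E {..<DIM('v)}. \<omega> (\<lambda>r. E (I r)) * (\<Prod>r<k. G (E (I r)) (v r)))"
proof -
  have "\<omega> (\<lambda>r. if r < k then E (I r) else v r) = \<omega> (\<lambda>r. E (I r))" for I
    by (rule alt_form_cong[OF alt]) simp
  then show ?thesis using alt_form_partial_expansion[OF alt order_refl, of v] by simp
qed

text \<open>Every multi-index is summed over, not only the increasing ones, so each product of dual vectors occurs
once for each of its \<open>k!\<close> arrangements.\<close>

lemma alt_form_basis_expansion:
  assumes alt: "alt_form k \<omega>"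
  shows "\<omega> = (\<lambda>v. (\<Sum>I\<in>{..<k} \<rightarrow>\<^sub>E {..<DIM('v)}. \<omega> (\<lambda>r. E (I r)) * basis_form (map I [0..<k]) v) / fact k)"
proof
  fix v
  have "(\<Sum>\<sigma> | \<sigma> permutes {..<k}. of_int (sign \<sigma>) * \<omega> (\<lambda>r. v (\<sigma> r))) = (\<Sum>\<sigma> | \<sigma> permutes {..<k}. \<omega> v)"
  proof (rule sum.cong)
    fix \<sigma> assume "\<sigma> \<in> {\<sigma>. \<sigma> permutes {..<k}}"
    then show "of_int (sign \<sigma>) * \<omega> (\<lambda>r. v (\<sigma> r)) = \<omega> v"
      using alt_form_permute[OF alt, of \<sigma> v] by (cases \<sigma> rule: sign_cases) auto
  qed simp
  also have "\<dots> = fact k * \<omega> v" by (simp add: card_permutations[OF refl])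
  finally have "fact k * \<omega> v = (\<Sum>\<sigma> | \<sigma> permutes {..<k}. of_int (sign \<sigma>) * \<omega> (\<lambda>r. v (\<sigma> r)))" by simp
  also have "\<dots> = (\<Sum>\<sigma> | \<sigma> permutes {..<k}. \<Sum>I\<in>{..<k} \<rightarrow>\<^sub>E {..<DIM('v)}.
      \<omega> (\<lambda>r. E (I r)) * (of_int (sign \<sigma>) * (\<Prod>r<k. G (E (I r)) (v (\<sigma> r)))))"
    by (subst alt_form_expansion[OF alt]) (simp add: sum_distrib_left algebra_simps)
  also have "\<dots> = (\<Sum>I\<in>{..<k} \<rightarrow>\<^sub>E {..<DIM('v)}. \<omega> (\<lambda>r. E (I r)) *
      (\<Sum>\<sigma> | \<sigma> permutes {..<k}. of_int (sign \<sigma>) * (\<Prod>r<k. G (E (I r)) (v (\<sigma> r)))))"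
    by (subst sum.swap) (simp only: sum_distrib_left)
  also have "\<dots> = (\<Sum>I\<in>{..<k} \<rightarrow>\<^sub>E {..<DIM('v)}. \<omega> (\<lambda>r. E (I r)) * basis_form (map I [0..<k]) v)"
    by (simp add: basis_form_def ext_prod_def)
  finally show "\<omega> v = (\<Sum>I\<in>{..<k} \<rightarrow>\<^sub>E {..<DIM('v)}. \<omega> (\<lambda>r. E (I r)) * basis_form (map I [0..<k]) v) / fact k"
    by (simp add: field_simps)
qed

text \<open>Pairing with a product of dual vectors extracts one coefficient of a form: the \<open>k!\<close> terms of the determinant
select the rearrangements of \<open>js\<close>, and by antisymmetry their contributions are equal.\<close>

lemma sum_alt_form_basis_form:
  assumes alt: "alt_form k \<gamma>" and js: "length js = k" "set js \<subseteq> {..<DIM('v)}"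
  shows "(\<Sum>I\<in>{..<k} \<rightarrow>\<^sub>E {..<DIM('v)}. \<gamma> (\<lambda>r. E (I r)) * basis_form js (\<lambda>r. E (I r))) =
    fact k * \<gamma> (\<lambda>r. E (js ! r))"
proof -
  let ?I = "{..<k} \<rightarrow>\<^sub>E {..<DIM('v)}"
  have "(\<Sum>I\<in>?I. \<gamma> (\<lambda>r. E (I r)) * basis_form js (\<lambda>r. E (I r))) =
    (\<Sum>I\<in>?I. \<Sum>\<sigma> | \<sigma> permutes {..<k}.
       \<gamma> (\<lambda>r. E (I r)) * (if \<forall>r<k. js ! r = I (\<sigma> r) then of_int (sign \<sigma>) else 0))"
    using js by (intro sum.cong refl) (subst basis_form_eval, auto simp: sum_distrib_left)
  also have "\<dots> = (\<Sum>\<sigma> | \<sigma> permutes {..<k}. \<Sum>I\<in>?I.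
       \<gamma> (\<lambda>r. E (I r)) * (if \<forall>r<k. js ! r = I (\<sigma> r) then of_int (sign \<sigma>) else 0))"
    by (rule sum.swap)
  also have "\<dots> = (\<Sum>\<sigma> | \<sigma> permutes {..<k}. \<gamma> (\<lambda>r. E (js ! r)))"
  proof (rule sum.cong)
    fix \<sigma> assume "\<sigma> \<in> {\<sigma>. \<sigma> permutes {..<k}}"
    then have \<sigma>: "\<sigma> permutes {..<k}" by simp
    then have inv: "inv \<sigma> permutes {..<k}" by (rule permutes_inv)
    define I0 where "I0 = restrict (\<lambda>r. js ! inv \<sigma> r) {..<k}"
    have I0: "I0 \<in> ?I"
      using js permutes_in_image[OF inv] by (auto simp: I0_def subset_iff)
    have iff: "(\<forall>r<k. js ! r = I (\<sigma> r)) \<longleftrightarrow> I = I0" if I: "I \<in> ?I" for I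
    proof
      assume *: "\<forall>r<k. js ! r = I (\<sigma> r)"
      show "I = I0"
      proof
        fix r show "I r = I0 r"
        proof (cases "r < k")
          case True
          then have "inv \<sigma> r < k" using permutes_in_image[OF inv, of r] by simp
          then show ?thesis using * True permutes_inverses(1)[OF \<sigma>, of r] by (simp add: I0_def)
        next
          case False
          then show ?thesis using PiE_arb[OF I, of r] by (simp add: I0_def)
        qed
      qed
    next
      assume "I = I0"
      then show "\<forall>r<k. js ! r = I (\<sigma> r)"
        using permutes_in_image[OF \<sigma>] permutes_inverses(2)[OF \<sigma>] by (simp add: I0_def)
    qed
    have "(\<Sum>I\<in>?I. \<gamma> (\<lambda>r. E (I r)) * (if \<forall>r<k. js ! r = I (\<sigma> r) then of_int (sign \<sigma>) else 0)) =
      (\<Sum>I\<in>?I. if I = I0 then \<gamma> (\<lambda>r. E (I0 r)) * of_int (sign \<sigma>) else 0)"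
      by (intro sum.cong refl) (simp add: iff)
    also have "\<dots> = \<gamma> (\<lambda>r. E (I0 r)) * of_int (sign \<sigma>)"
      using I0 by (simp add: finite_PiE)
    also have "\<gamma> (\<lambda>r. E (I0 r)) = \<gamma> (\<lambda>r. E (js ! inv \<sigma> r))"
      by (rule alt_form_cong[OF alt]) (simp add: I0_def)
    also have "\<dots> = of_int (sign \<sigma>) * \<gamma> (\<lambda>r. E (js ! r))"
      using alt_form_permute[OF alt inv, of "\<lambda>r. E (js ! r)"] \<sigma> by (simp add: sign_inverse)
    finally show "(\<Sum>I\<in>?I. \<gamma> (\<lambda>r. E (I r)) * (if \<forall>r<k. js ! r = I (\<sigma> r) then of_int (sign \<sigma>) else 0)) =
      \<gamma> (\<lambda>r. E (js ! r))"
      by (cases \<sigma> rule: sign_cases) auto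
  qed simp
  finally show ?thesis by (simp add: card_permutations[OF refl])
qed

text \<open>The inner product of forms is defined through some orthonormal basis \<open>e\<close>. It can be computed in \<open>E\<close>, because
the expansion of \<open>e\<close> in terms of \<open>E\<close> has an orthogonal coefficient matrix, and so have its tensor powers.\<close>

lemma form_inner_eq:
  assumes \<alpha>: "alt_form k \<alpha>" and \<beta>: "alt_form k \<beta>"
  shows "form_inner G k \<alpha> \<beta> =
    (\<Sum>I\<in>{..<k} \<rightarrow>\<^sub>E {..<DIM('v)}. \<alpha> (\<lambda>r. E (I r)) * \<beta> (\<lambda>r. E (I r))) / fact k"
proof -
  define e where "e = (SOME e. orthonormal_basis G e)"
  have "orthonormal_basis G e" unfolding e_def using onb by (rule someI[of "orthonormal_basis G"])
  then interpret e: ortho_frame G e by unfold_locales (rule inner)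
  let ?I = "{..<k} \<rightarrow>\<^sub>E {..<DIM('v)}"
  have key: "(\<Sum>I\<in>?I. \<Prod>r<k. G (E (A r)) (e (I r)) * G (E (B r)) (e (I r))) = (if A = B then 1 else 0)"
    if A: "A \<in> ?I" and B: "B \<in> ?I" for A B
  proof -
    have "(\<Sum>I\<in>?I. \<Prod>r<k. G (E (A r)) (e (I r)) * G (E (B r)) (e (I r))) =
      (\<Prod>r<k. \<Sum>i<DIM('v). G (E (A r)) (e i) * G (E (B r)) (e i))"
      by (rule prod_sum_PiE[symmetric]) auto
    also have "\<dots> = (\<Prod>r<k. G (E (A r)) (E (B r)))"
      by (simp add: e.parseval[of "E _" "E _"] G_sym[of "E _" "e _"])
    also have "\<dots> = (\<Prod>r<k. if A r = B r then 1 else 0)"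
      using A B by (intro prod.cong refl G_E) auto
    also have "\<dots> = (if \<forall>r<k. A r = B r then 1 else 0)" by (auto intro!: prod.neutral prod_zero)
    also have "(\<forall>r<k. A r = B r) \<longleftrightarrow> A = B"
      using PiE_ext[OF A B] by auto
    finally show ?thesis .
  qed
  have "(\<Sum>I\<in>?I. \<alpha> (\<lambda>r. e (I r)) * \<beta> (\<lambda>r. e (I r))) =
    (\<Sum>I\<in>?I. \<Sum>A\<in>?I. \<Sum>B\<in>?I. \<alpha> (\<lambda>r. E (A r)) * \<beta> (\<lambda>r. E (B r)) *
       (\<Prod>r<k. G (E (A r)) (e (I r)) * G (E (B r)) (e (I r))))"
    by (subst alt_form_expansion[OF \<alpha>], subst alt_form_expansion[OF \<beta>])
      (simp add: sum_product prod.distrib mult.assoc mult.left_commute)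
  also have "\<dots> = (\<Sum>A\<in>?I. \<Sum>B\<in>?I. \<Sum>I\<in>?I. \<alpha> (\<lambda>r. E (A r)) * \<beta> (\<lambda>r. E (B r)) *
       (\<Prod>r<k. G (E (A r)) (e (I r)) * G (E (B r)) (e (I r))))"
    by (subst sum.swap, intro sum.cong refl sum.swap)
  also have "\<dots> = (\<Sum>A\<in>?I. \<Sum>B\<in>?I. if A = B then \<alpha> (\<lambda>r. E (A r)) * \<beta> (\<lambda>r. E (B r)) else 0)"
    by (intro sum.cong refl) (simp add: sum_distrib_left[symmetric] key)
  also have "\<dots> = (\<Sum>A\<in>?I. \<alpha> (\<lambda>r. E (A r)) * \<beta> (\<lambda>r. E (A r)))"
    by (intro sum.cong refl) (simp add: finite_PiE)
  finally show ?thesis by (simp add: form_inner_def e_def[symmetric])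
qed

text \<open>Both sides vanish unless \<open>js\<close> is a rearrangement of \<open>xs\<close>, and then both are the value at \<open>js = xs\<close> times the
sign of the rearrangement. This evaluates wedge products with a complementary product of dual vectors.\<close>

lemma basis_form_append_eval:
  assumes xy: "distinct (xs @ ys)" "set (xs @ ys) = {..<DIM('v)}"
    and js: "length js = length xs" "set js \<subseteq> {..<DIM('v)}"
  shows "basis_form (js @ ys) v = basis_form xs (\<lambda>r. E (js ! r)) * basis_form (xs @ ys) v"
proof (cases "mset js = mset xs")
  case True
  then obtain \<sigma> where \<sigma>: "\<sigma> permutes {..<length xs}" "permute_list \<sigma> xs = js"
    by (rule mset_eq_permutation)
  have "basis_form xs (\<lambda>r. E (js ! r)) = basis_form xs (\<lambda>r. E (xs ! \<sigma> r))"
    by (rule alt_form_cong[OF alt_form_basis_form[OF refl]]) (use \<sigma> in \<open>auto simp: permute_list_nth\<close>)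
  also have "\<dots> = of_int (sign \<sigma>) * basis_form xs (\<lambda>r. E (xs ! r))"
    by (rule alt_form_permute[OF alt_form_basis_form[OF refl] \<sigma>(1)])
  also have "\<dots> = of_int (sign \<sigma>)" using xy by (subst basis_form_self) auto
  finally have 1: "basis_form xs (\<lambda>r. E (js ! r)) = of_int (sign \<sigma>)" .
  let ?f = "\<lambda>r. G (E (xs ! r))"
  have js': "map (\<lambda>j. G (E j)) js = map (\<lambda>r. ?f (\<sigma> r)) [0..<length xs]"
    using \<sigma> by (auto simp: permute_list_def)
  have xs': "map (\<lambda>j. G (E j)) xs = map ?f [0..<length xs]"
    by (intro nth_equalityI) auto
  have "basis_form (js @ ys) v = of_int (sign \<sigma>) * basis_form (xs @ ys) v"
    unfolding basis_form_def map_append js' xs' by (rule ext_prod_permute_block[OF \<sigma>(1)])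
  then show ?thesis by (simp add: 1)
next
  case False
  have "basis_form xs (\<lambda>r. E (js ! r)) = 0" if nz: "basis_form (js @ ys) v \<noteq> 0 \<or> distinct js"
  proof (rule ccontr)
    assume nz2: "basis_form xs (\<lambda>r. E (js ! r)) \<noteq> 0"
    have dj: "distinct js" using nz basis_form_not_distinct[of "js @ ys" v] by auto
    have "\<exists>\<sigma>. \<sigma> permutes {..<length xs} \<and> (\<forall>r<length xs. xs ! r = js ! \<sigma> r)"
    proof (rule ccontr)
      assume "\<not> ?thesis"
      then have "basis_form xs (\<lambda>r. E (js ! r)) = 0"
        using xy js by (subst basis_form_eval) (auto simp: subset_iff intro!: sum.neutral) 
      then show False using nz2 by simp
    qed
    then obtain \<sigma> where \<sigma>: "\<sigma> permutes {..<length xs}" "\<forall>r<length xs. xs ! r = js ! \<sigma> r" by blast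
    moreover have "permute_list \<sigma> js = xs"
      using \<sigma> js by (intro nth_equalityI) (simp_all add: permute_list_nth)
    ultimately have "mset xs = mset js" using mset_permute_list[of \<sigma> js] js by simp
    then show False using False by simp
  qed
  moreover have "basis_form xs (\<lambda>r. E (js ! r)) = 0" if nd: "\<not> distinct js"
  proof -
    obtain i j where "i < length js" "j < length js" "i \<noteq> j" "js ! i = js ! j"
      using nd by (auto simp: distinct_conv_nth)
    then show ?thesis by (intro alt_form_zero[OF alt_form_basis_form[OF refl], of i _ j]) (use js in auto)
  qed
  moreover have "basis_form (js @ ys) v = 0"
  proof (rule basis_form_not_distinct, rule notI)
    assume d: "distinct (js @ ys)"
    then have "set js \<subseteq> set xs" using js xy by auto
    moreover have "card (set js) = card (set xs)" using d xy js by (simp add: distinct_card)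
    ultimately have "set js = set xs" by (simp add: card_subset_eq)
    then show False using False d xy by (simp add: set_eq_iff_mset_eq_distinct)
  qed
  ultimately show ?thesis by auto
qed

lemma top_form:
  assumes "alt_form DIM('v) \<omega>"
  shows "\<omega> = (\<lambda>v. \<omega> E * basis_form [0..<DIM('v)] v)"
proof
  fix v
  let ?N = "DIM('v)"
  have "\<omega> v = (\<Sum>I\<in>{..<?N} \<rightarrow>\<^sub>E {..<?N}. \<omega> (\<lambda>r. E (I r)) * basis_form (map I [0..<?N]) v) / fact ?N"
    using alt_form_basis_expansion[OF assms] by metis
  also have "\<dots> = (\<Sum>I\<in>{..<?N} \<rightarrow>\<^sub>E {..<?N}.
      \<omega> (\<lambda>r. E (I r)) * (basis_form [0..<?N] (\<lambda>r. E (I r)) * basis_form [0..<?N] v)) / fact ?N"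
  proof (intro arg_cong2[where f="(/)"] refl sum.cong arg_cong2[where f="(*)"])
    fix I assume I: "I \<in> {..<?N} \<rightarrow>\<^sub>E {..<?N}"
    have "basis_form [0..<?N] (\<lambda>r. E (map I [0..<?N] ! r)) = basis_form [0..<?N] (\<lambda>r. E (I r))"
      by (rule alt_form_cong[OF alt_form_basis_form[OF refl]]) simp
    then show "basis_form (map I [0..<?N]) v =
        basis_form [0..<?N] (\<lambda>r. E (I r)) * basis_form [0..<?N] v"
      using basis_form_append_eval[of "[0..<?N]" "[]" "map I [0..<?N]" v] I
      by (simp add: PiE_iff image_subset_iff atLeast0LessThan)
  qed
  also have "\<dots> = (\<Sum>I\<in>{..<?N} \<rightarrow>\<^sub>E {..<?N}.
      \<omega> (\<lambda>r. E (I r)) * basis_form [0..<?N] (\<lambda>r. E (I r))) * basis_form [0..<?N] v / fact ?N"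
    by (simp add: sum_distrib_right mult.assoc)
  also have "\<dots> = \<omega> (\<lambda>r. E ([0..<?N] ! r)) * basis_form [0..<?N] v"
    using sum_alt_form_basis_form[OF assms, of "[0..<?N]"] by (simp add: atLeast0LessThan)
  also have "\<omega> (\<lambda>r. E ([0..<?N] ! r)) = \<omega> E" by (rule alt_form_cong[OF assms]) simp
  finally show "\<omega> v = \<omega> E * basis_form [0..<?N] v" .
qed

lemma basis_form_top_self: "basis_form [0..<DIM('v)] E = 1"
proof -
  have "basis_form [0..<DIM('v)] E = basis_form [0..<DIM('v)] (\<lambda>r. E ([0..<DIM('v)] ! r))"
    by (rule alt_form_cong[OF alt_form_basis_form[OF refl]]) simp
  then show ?thesis by (simp add: basis_form_self atLeast0LessThan)
qed

text \<open>An orthogonal matrix has determinant \<open>\<plusminus>1\<close>. Instead of multiplying matrices, one exchanges the roles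
of the two bases: this transposes the matrix, so the determinant and its inverse are the same number.\<close>

lemma basis_form_top_orthonormal:
  assumes "orthonormal_basis G b"
  shows "basis_form [0..<DIM('v)] b * basis_form [0..<DIM('v)] b = 1"
proof -
  interpret b: ortho_frame G b using inner assms by unfold_locales
  let ?N = "DIM('v)"
  have "b.basis_form [0..<?N] E = (\<Sum>\<sigma> | \<sigma> permutes {..<?N}. of_int (sign (inv \<sigma>)) * (\<Prod>i<?N. G (b i) (E (inv \<sigma> i))))"
    unfolding b.basis_form_def ext_prod_def by (simp, rule sum_permutations_inverse)
  also have "\<dots> = (\<Sum>\<sigma> | \<sigma> permutes {..<?N}. of_int (sign \<sigma>) * (\<Prod>i<?N. G (E i) (b (\<sigma> i))))"
  proof (intro sum.cong refl arg_cong2[where f="(*)"])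
    fix \<sigma> assume "\<sigma> \<in> {\<sigma>. \<sigma> permutes {..<?N}}"
    then have \<sigma>: "\<sigma> permutes {..<?N}" by simp
    then show "real_of_int (sign (inv \<sigma>)) = real_of_int (sign \<sigma>)" by (simp add: sign_inverse)
    have "(\<Prod>i<?N. G (b i) (E (inv \<sigma> i))) = (\<Prod>i<?N. G (b (\<sigma> i)) (E (inv \<sigma> (\<sigma> i))))"
      using prod.permute[OF \<sigma>, of "\<lambda>i. G (b i) (E (inv \<sigma> i))"] by (simp add: o_def)
    also have "\<dots> = (\<Prod>i<?N. G (E i) (b (\<sigma> i)))"
      using permutes_inverses(2)[OF \<sigma>] by (simp add: G_sym)
    finally show "(\<Prod>i<?N. G (b i) (E (inv \<sigma> i))) = (\<Prod>i<?N. G (E i) (b (\<sigma> i)))" .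
  qed
  also have "\<dots> = basis_form [0..<?N] b" by (simp add: basis_form_def ext_prod_def)
  finally have "b.basis_form [0..<?N] E = basis_form [0..<?N] b" .
  moreover have "b.basis_form [0..<?N] b = b.basis_form [0..<?N] E * basis_form [0..<?N] b"
    using top_form[OF b.alt_form_basis_form, of "[0..<?N]"] by (metis length_upt minus_nat.diff_0)
  ultimately show ?thesis by (simp add: b.basis_form_top_self)
qed

text \<open>A top form is determined by its value on \<open>E\<close>, so the volume form is known once the values of
\<open>e\<^sup>0 \<and> \<dots> \<and> e\<^sup>N\<^sup>-\<^sup>1\<close> on the positive orthonormal bases are known to agree.\<close>

lemma volume_form_eq:
  assumes P: "\<And>b. b \<in> P \<Longrightarrow> orthonormal_basis G b \<Longrightarrow> basis_form [0..<DIM('v)] b = c"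
    and ex: "b0 \<in> P" "orthonormal_basis G b0" and c: "c * c = 1"
  shows "volume_form G P = (\<lambda>v. c * basis_form [0..<DIM('v)] v)"
  unfolding volume_form_def
proof (rule the_equality)
  show "alt_form DIM('v) (\<lambda>v. c * basis_form [0..<DIM('v)] v) \<and>
    (\<forall>b\<in>P. orthonormal_basis G b \<longrightarrow> c * basis_form [0..<DIM('v)] b = 1)"
    using P c by (simp add: alt_form_scale alt_form_basis_form)
next
  fix \<omega> assume \<omega>: "alt_form DIM('v) \<omega> \<and> (\<forall>b\<in>P. orthonormal_basis G b \<longrightarrow> \<omega> b = 1)"
  then have top: "\<omega> = (\<lambda>v. \<omega> E * basis_form [0..<DIM('v)] v)" using top_form by blast
  then have "\<omega> E * c = 1" using \<omega> ex P by metis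
  then have "\<omega> E = c" using c by (metis mult.assoc mult.right_neutral mult.commute)
  then show "\<omega> = (\<lambda>v. c * basis_form [0..<DIM('v)] v)" using top by simp
qed

text \<open>The property that characterizes the Hodge dual, for the orientation in which \<open>E\<close> is positive. As a relation it
passes to linear combinations at once, and uniqueness then carries this over to the operator.\<close>

definition is_star :: "nat \<Rightarrow> 'v form \<Rightarrow> 'v form \<Rightarrow> bool" where
  "is_star k \<beta> \<gamma> \<longleftrightarrow> alt_form (DIM('v) - k) \<gamma> \<and>
     (\<forall>\<omega>. alt_form k \<omega> \<longrightarrow>
        wedge k (DIM('v) - k) \<omega> \<gamma> = (\<lambda>v. form_inner G k \<omega> \<beta> * basis_form [0..<DIM('v)] v))"

lemma is_star_sum:
  "(\<And>x. x \<in> X \<Longrightarrow> is_star k (\<beta> x) (\<gamma> x)) \<Longrightarrow> is_star k (\<lambda>v. \<Sum>x\<in>X. \<beta> x v) (\<lambda>v. \<Sum>x\<in>X. \<gamma> x v)"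
  unfolding is_star_def
  by (auto simp: wedge_sum_right form_inner_sum_right sum_distrib_right fun_eq_iff intro!: alt_form_sum sum.cong)

lemma is_star_scale: "is_star k \<beta> \<gamma> \<Longrightarrow> is_star k (\<lambda>v. c * \<beta> v) (\<lambda>v. c * \<gamma> v)"
  unfolding is_star_def by (auto simp: wedge_scale_right form_inner_scale_right intro!: alt_form_scale)

text \<open>By expansion of the test form \<open>\<omega>\<close>, both sides of the defining equation become sums over multi-indices,
and \<open>basis_form_append_eval\<close> identifies the summands.\<close>

lemma is_star_basis_form:
  assumes xy: "distinct (xs @ ys)" "set (xs @ ys) = {..<DIM('v)}"
    and c: "\<And>v. basis_form (xs @ ys) v = c * basis_form [0..<DIM('v)] v"
  shows "is_star (length xs) (basis_form xs) (\<lambda>v. c * basis_form ys v)"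
proof -
  have len: "length xs + length ys = DIM('v)"
    using xy distinct_card[of "xs @ ys"] by simp
  then have l: "DIM('v) - length xs = length ys" by simp
  let ?k = "length xs" and ?N = "DIM('v)"
  have "mset (xs @ ys) = mset [0..<?N]"
    using xy by (subst set_eq_iff_mset_eq_distinct[symmetric]) (auto simp: atLeast0LessThan)
  then obtain \<sigma> where \<sigma>: "\<sigma> permutes {..<length [0..<?N]}" "permute_list \<sigma> [0..<?N] = xs @ ys"
    by (rule mset_eq_permutation)
  \<comment> \<open>The constant is a sign, so it equals its inverse.\<close>
  have "c = of_int (sign \<sigma>)"
    using c[of E] basis_form_permute[OF \<sigma>(1), of E] \<sigma>(2) by (simp add: basis_form_top_self)
  then have cc: "c * c = 1" by (cases \<sigma> rule: sign_cases) auto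
  have "wedge ?k (length ys) \<omega> (\<lambda>v. c * basis_form ys v) v = form_inner G ?k \<omega> (basis_form xs) * basis_form [0..<?N] v"
    if \<omega>: "alt_form ?k \<omega>" for \<omega> v
  proof -
    have "wedge ?k (length ys) \<omega> (\<lambda>v. c * basis_form ys v) v = c * wedge ?k (length ys) \<omega> (basis_form ys) v"
      by (simp add: wedge_scale_right)
    also have "wedge ?k (length ys) \<omega> (basis_form ys) v =
      wedge ?k (length ys) (\<lambda>v. \<Sum>I\<in>{..<?k} \<rightarrow>\<^sub>E {..<?N}. (\<omega> (\<lambda>r. E (I r)) / fact ?k) * basis_form (map I [0..<?k]) v) (basis_form ys) v"
      by (subst alt_form_basis_expansion[OF \<omega>]) (simp add: sum_divide_distrib)
    also have "\<dots> = (\<Sum>I\<in>{..<?k} \<rightarrow>\<^sub>E {..<?N}. (\<omega> (\<lambda>r. E (I r)) / fact ?k) * basis_form (map I [0..<?k] @ ys) v)"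
      by (simp only: wedge_sum_left wedge_scale_left wedge_basis_form length_map length_upt minus_nat.diff_0)
    also have "\<dots> = (\<Sum>I\<in>{..<?k} \<rightarrow>\<^sub>E {..<?N}. (\<omega> (\<lambda>r. E (I r)) / fact ?k) *
        (basis_form xs (\<lambda>r. E (I r)) * (c * basis_form [0..<?N] v)))"
    proof (intro refl sum.cong arg_cong2[where f="(*)"])
      fix I assume I: "I \<in> {..<?k} \<rightarrow>\<^sub>E {..<?N}"
      have "basis_form xs (\<lambda>r. E (map I [0..<?k] ! r)) = basis_form xs (\<lambda>r. E (I r))"
        by (rule alt_form_cong[OF alt_form_basis_form[OF refl]]) simp
      then show "basis_form (map I [0..<?k] @ ys) v = basis_form xs (\<lambda>r. E (I r)) * (c * basis_form [0..<?N] v)"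
        using basis_form_append_eval[OF xy, of "map I [0..<?k]" v] I c[of v]
        by (simp add: PiE_iff image_subset_iff atLeast0LessThan)
    qed
    also have "\<dots> = (\<Sum>I\<in>{..<?k} \<rightarrow>\<^sub>E {..<?N}. \<omega> (\<lambda>r. E (I r)) * basis_form xs (\<lambda>r. E (I r))) / fact ?k *
        (c * basis_form [0..<?N] v)"
      by (simp add: sum_distrib_right sum_divide_distrib mult.assoc)
    also have "\<dots> = form_inner G ?k \<omega> (basis_form xs) * (c * basis_form [0..<?N] v)"
      using form_inner_eq[OF \<omega> alt_form_basis_form[of xs ?k]] by simp
    finally show ?thesis using cc by (simp add: mult.left_commute mult.assoc[symmetric])
  qed
  then show ?thesis unfolding is_star_def l by (auto simp: alt_form_basis_form alt_form_scale)
qed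

text \<open>Wedging with the product of the dual vectors complementary to a multi-index \<open>J\<close> isolates the coefficient
of \<open>\<delta>\<close> at \<open>J\<close>. Hence the Hodge dual is unique.\<close>

lemma wedge_nondegenerate:
  fixes \<delta> :: "'v form"
  assumes \<delta>: "alt_form l \<delta>" and kl: "k + l = DIM('v)"
    and 0: "\<And>\<omega>. alt_form k \<omega> \<Longrightarrow> wedge k l \<omega> \<delta> = (\<lambda>v. 0)"
  shows "\<delta> = (\<lambda>v. 0)"
proof -
  let ?N = "DIM('v)"
  have "\<delta> (\<lambda>r. E (J r)) = 0" if J: "J \<in> {..<l} \<rightarrow>\<^sub>E {..<?N}" for J
  proof (cases "distinct (map J [0..<l])")
    case False
    then obtain i j where "i < l" "j < l" "i \<noteq> j" "J i = J j" by (auto simp: distinct_conv_nth)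
    then show ?thesis by (intro alt_form_zero[OF \<delta>, of i j]) auto
  next
    case True
    define js where "js = map J [0..<l]"
    have js: "length js = l" "set js \<subseteq> {..<?N}" "distinct js" using J True by (auto simp: js_def PiE_iff)
    define xs where "xs = sorted_list_of_set ({..<?N} - set js)"
    have xs: "distinct (js @ xs)" "set (js @ xs) = {..<?N}" using js by (auto simp: xs_def)
    then have k: "length xs = k" using kl js distinct_card[of "js @ xs"] by simp
    have one: "basis_form (js @ xs) (\<lambda>r. E ((js @ xs) ! r)) = 1"
      using xs by (intro basis_form_self) (simp_all only: order_refl)
    have sgn: "basis_form (xs @ is) v = (-1) ^ (k * l) * basis_form (is @ xs) v" if "length is = l" for "is" v
      using ext_prod_move_block[of "[]" "map (\<lambda>j. G (E j)) xs" "map (\<lambda>j. G (E j)) is" "[]" v] that k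
      by (simp add: basis_form_def)
    have "0 = wedge k l (basis_form xs) \<delta> (\<lambda>r. E ((js @ xs) ! r))"
      using 0[OF alt_form_basis_form[OF k]] by simp
    also have "\<dots> = wedge k l (basis_form xs)
        (\<lambda>v. \<Sum>I\<in>{..<l} \<rightarrow>\<^sub>E {..<?N}. (\<delta> (\<lambda>r. E (I r)) / fact l) * basis_form (map I [0..<l]) v) (\<lambda>r. E ((js @ xs) ! r))"
      by (subst alt_form_basis_expansion[OF \<delta>]) (simp add: sum_divide_distrib)
    also have "\<dots> = (\<Sum>I\<in>{..<l} \<rightarrow>\<^sub>E {..<?N}. (\<delta> (\<lambda>r. E (I r)) / fact l) *
        basis_form (xs @ map I [0..<l]) (\<lambda>r. E ((js @ xs) ! r)))"
      by (simp only: wedge_sum_right wedge_scale_right) (simp add: wedge_basis_form k)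
    also have "\<dots> = (\<Sum>I\<in>{..<l} \<rightarrow>\<^sub>E {..<?N}. (\<delta> (\<lambda>r. E (I r)) / fact l) *
        ((-1) ^ (k * l) * basis_form js (\<lambda>r. E (I r))))"
    proof (intro refl sum.cong arg_cong2[where f="(*)"])
      fix I assume I: "I \<in> {..<l} \<rightarrow>\<^sub>E {..<?N}"
      have "basis_form js (\<lambda>r. E (map I [0..<l] ! r)) = basis_form js (\<lambda>r. E (I r))"
        by (rule alt_form_cong[OF alt_form_basis_form[OF js(1)]]) simp
      then show "basis_form (xs @ map I [0..<l]) (\<lambda>r. E ((js @ xs) ! r)) = (-1) ^ (k * l) * basis_form js (\<lambda>r. E (I r))"
        using basis_form_append_eval[OF xs, of "map I [0..<l]" "\<lambda>r. E ((js @ xs) ! r)"] I js sgn[of "map I [0..<l]"]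
        by (simp add: PiE_iff image_subset_iff atLeast0LessThan one)
    qed
    also have "\<dots> = (-1) ^ (k * l) * ((\<Sum>I\<in>{..<l} \<rightarrow>\<^sub>E {..<?N}. \<delta> (\<lambda>r. E (I r)) * basis_form js (\<lambda>r. E (I r))) / fact l)"
      by (simp add: sum_distrib_left sum_divide_distrib mult_ac)
    also have "\<dots> = (-1) ^ (k * l) * \<delta> (\<lambda>r. E (js ! r))"
      using sum_alt_form_basis_form[OF \<delta> js(1,2)] by simp
    also have "\<delta> (\<lambda>r. E (js ! r)) = \<delta> (\<lambda>r. E (J r))"
      by (rule alt_form_cong[OF \<delta>]) (simp add: js_def)
    finally show ?thesis by simp
  qed
  then show ?thesis by (subst alt_form_expansion[OF \<delta>, abs_def]) simp
qed

lemma hodge_star_eqI: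
  assumes vol: "volume_form G P = basis_form [0..<DIM('v)]" and k: "k \<le> DIM('v)" and star: "is_star k \<beta> \<gamma>"
  shows "hodge_star G P k \<beta> = \<gamma>"
  unfolding hodge_star_def vol
proof (rule the_equality)
  show "alt_form (DIM('v) - k) \<gamma> \<and> (\<forall>\<omega>. alt_form k \<omega> \<longrightarrow>
      wedge k (DIM('v) - k) \<omega> \<gamma> = (\<lambda>v. form_inner G k \<omega> \<beta> * basis_form [0..<DIM('v)] v))"
    using star by (simp add: is_star_def)
  fix \<gamma>' assume *: "alt_form (DIM('v) - k) \<gamma>' \<and> (\<forall>\<omega>. alt_form k \<omega> \<longrightarrow>
      wedge k (DIM('v) - k) \<omega> \<gamma>' = (\<lambda>v. form_inner G k \<omega> \<beta> * basis_form [0..<DIM('v)] v))"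
  have "(\<lambda>v. \<gamma>' v - \<gamma> v) = (\<lambda>v. 0)"
    by (rule wedge_nondegenerate[of "DIM('v) - k" _ k])
      (use k star * in \<open>auto simp: is_star_def alt_form_diff wedge_diff_right\<close>)
  then show "\<gamma>' = \<gamma>" by (auto simp: fun_eq_iff)
qed

end

section \<open>The model: a contact coframe\<close>

text \<open>Reversal and rotation serve to reindex sums over the symmetric group: the first exchanges an initial segment
of \<open>{..<n}\<close> with a final one, the second in addition preserves the order of each segment.\<close>

definition reversal :: "nat \<Rightarrow> nat \<Rightarrow> nat" where
  "reversal n j = (if j < n then n - Suc j else j)"

definition rotation :: "nat \<Rightarrow> nat \<Rightarrow> nat \<Rightarrow> nat" where
  "rotation i n j = (if j < i then j + (n - i) else if j < n then j - i else j)"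

lemma reversal_permutes: "reversal n permutes {..<n}"
  by (rule inj_imp_permutes) (auto simp: reversal_def inj_on_def)

lemma rotation_permutes: "i \<le> n \<Longrightarrow> rotation i n permutes {..<n}"
  by (rule inj_imp_permutes) (auto simp: rotation_def inj_on_def split: if_splits)

lemma triangular_number_eq: "n * (n + 1) div 2 = n + n * (n - 1) div (2::nat)"
proof -
  have "even (n * (n - 1))" by (cases n) auto
  then obtain k where "n * (n - 1) = 2 * k" by blast
  moreover have "n * (n + 1) = n * (n - 1) + 2 * n" by (cases n) (auto simp: algebra_simps)
  ultimately show ?thesis by simp
qed

text \<open>The tangent space of \<open>\<S>\<close> with an adapted frame: \<open>E 0\<close> is the horizontal lift of \<open>u/s\<close>, and for \<open>1 \<le> j \<le> n\<close> the vector
\<open>E j\<close> is horizontal and \<open>E (n + j)\<close> is its vertical companion. The number \<open>\<epsilon>\<close> is the sign of the underlying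
basis of the tangent space of \<open>M\<close>.\<close>

locale contact_frame = ortho_frame G E for G :: "'v::euclidean_space \<Rightarrow> 'v \<Rightarrow> real" and E +
  fixes n :: nat and s \<epsilon> :: real and P :: "(nat \<Rightarrow> 'v) set"
  assumes dim: "DIM('v) = 2 * n + 1" and s_pos: "s > 0" and \<epsilon>: "\<epsilon> * \<epsilon> = 1"
    and vol_P: "volume_form G P = basis_form [0..<DIM('v)]"
begin

text \<open>The forms \<open>contact_form\<close>, \<open>symplectic_form\<close> and \<open>mixed_form i\<close> are the expressions of \<open>\<theta>\<close>, \<open>d\<theta>\<close> and
\<open>\<alpha>\<^sub>i\<close> in the frame. Indices of the sums start at \<open>0\<close>, hence the shifts by \<open>1\<close>.\<close>

definition contact_form :: "'v form" where
  "contact_form = (\<lambda>v. s * basis_form [0] v)"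

definition symplectic_form :: "'v form" where
  "symplectic_form = (\<lambda>v. \<Sum>j<n. basis_form [n + 1 + j, 1 + j] v)"

text \<open>The last \<open>i\<close> positions are vertical, as in the definition of \<open>\<alpha>\<^sub>i\<close>.\<close>

definition mixed_indices :: "(nat \<Rightarrow> nat) \<Rightarrow> nat \<Rightarrow> nat list" where
  "mixed_indices \<tau> i = map (\<lambda>j. 1 + \<tau> j + (if j < n - i then 0 else n)) [0..<n]"

definition mixed_form :: "nat \<Rightarrow> 'v form" where
  "mixed_form i = (\<lambda>v. \<epsilon> / (fact i * fact (n - i)) *
     (\<Sum>\<tau> | \<tau> permutes {..<n}. of_int (sign \<tau>) * basis_form (mixed_indices \<tau> i) v))"

text \<open>The indices of \<open>\<Prod>\<^sub>j e\<^sup>n\<^sup>+\<^sup>\<tau>\<^sup>j \<and> e\<^sup>\<tau>\<^sup>j\<close>, the products that occur in the powers of \<open>d\<theta>\<close>.\<close>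

definition pairs :: "(nat \<Rightarrow> nat) \<Rightarrow> nat list \<Rightarrow> nat list" where
  "pairs \<tau> js = concat (map (\<lambda>j. [n + 1 + \<tau> j, 1 + \<tau> j]) js)"

lemma pairs_simps [simp]: "pairs \<tau> [] = []" "pairs \<tau> (j # js) = [n + 1 + \<tau> j, 1 + \<tau> j] @ pairs \<tau> js"
  "pairs \<tau> (xs @ ys) = pairs \<tau> xs @ pairs \<tau> ys" "length (pairs \<tau> js) = 2 * length js"
  by (auto simp: pairs_def length_concat comp_def sum_list_triv)

lemma set_pairs: "set (pairs \<tau> js) = (\<Union>j\<in>set js. {n + 1 + \<tau> j, 1 + \<tau> j})"
  by (auto simp: pairs_def)

lemma permutes_less: "\<tau> permutes {..<n} \<Longrightarrow> j < n \<Longrightarrow> \<tau> j < n"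
  using permutes_in_image[of \<tau> "{..<n}" j] by simp

lemma pairs_subset: "\<tau> permutes {..<n} \<Longrightarrow> set js \<subseteq> {..<n} \<Longrightarrow> set (pairs \<tau> js) \<subseteq> {1..<2 * n + 1}"
  by (fastforce simp: set_pairs dest: permutes_less)

lemma upt_halves: "map Suc [0..<n] @ map (\<lambda>j. n + 1 + j) [0..<n] = [1..<2 * n + 1]"
  by (rule nth_equalityI) (auto simp: nth_append)

lemma upt_Cons_zero: "[0..<2 * n + 1] = 0 # [1..<2 * n + 1]"
  by (subst upt_rec) simp

text \<open>The permutation \<open>\<tau>\<close> acts on the horizontal and on the vertical factors alike, so its sign drops out.\<close>

lemma basis_form_interleave:
  assumes \<tau>: "\<tau> permutes {..<n}"
  shows "basis_form (xs @ concat (map (\<lambda>j. [1 + \<tau> j, n + 1 + \<tau> j]) [0..<n])) v =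
    (-1) ^ (n * (n - 1) div 2) * basis_form (xs @ [1..<2 * n + 1]) v"
proof -
  let ?e = "\<lambda>j. G (E j)"
  have "basis_form (xs @ [1..<2 * n + 1]) v =
     ext_prod (map ?e xs @ map (\<lambda>j. ?e (1 + j)) [0..<n] @ map (\<lambda>j. ?e (n + 1 + j)) [0..<n]) v"
    unfolding basis_form_def upt_halves[symmetric] by (simp add: o_def)
  also have "\<dots> = of_int (sign \<tau>) * (of_int (sign \<tau>) * ext_prod (map ?e xs @ map (\<lambda>j. ?e (1 + j)) [0..<n] @
      map (\<lambda>j. ?e (n + 1 + j)) [0..<n] @ []) v)"
    by (cases \<tau> rule: sign_cases) auto
  also have "\<dots> = ext_prod (map ?e xs @ map (\<lambda>j. ?e (1 + \<tau> j)) [0..<n] @ map (\<lambda>j. ?e (n + 1 + \<tau> j)) [0..<n] @ []) v"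
    using ext_prod_permute_middle[OF \<tau>, of "map ?e xs" "\<lambda>j. ?e (1 + j)" "map (\<lambda>j. ?e (n + 1 + \<tau> j)) [0..<n] @ []" v]
      ext_prod_permute_middle[OF \<tau>, of "map ?e xs @ map (\<lambda>j. ?e (1 + j)) [0..<n]" "\<lambda>j. ?e (n + 1 + j)" "[]" v]
    by simp
  also have "\<dots> = (-1) ^ (n * (n - 1) div 2) *
      ext_prod (map ?e xs @ concat (map (\<lambda>j. [?e (1 + \<tau> j), ?e (n + 1 + \<tau> j)]) [0..<n]) @ []) v"
    by (rule ext_prod_interleave)
  also have "\<dots> = (-1) ^ (n * (n - 1) div 2) * basis_form (xs @ concat (map (\<lambda>j. [1 + \<tau> j, n + 1 + \<tau> j]) [0..<n])) v"
    by (simp add: basis_form_def map_concat o_def)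
  finally show ?thesis by (simp add: left_minus_one_mult_self)
qed

lemma basis_form_pairs:
  assumes \<tau>: "\<tau> permutes {..<n}"
  shows "basis_form (xs @ pairs \<tau> [0..<n]) v = (-1) ^ (n * (n + 1) div 2) * basis_form (xs @ [1..<2 * n + 1]) v"
proof -
  let ?e = "\<lambda>j. G (E j)"
  have "basis_form (xs @ pairs \<tau> [0..<n]) v =
     (-1) ^ n * basis_form (xs @ concat (map (\<lambda>j. [1 + \<tau> j, n + 1 + \<tau> j]) [0..<n])) v"
    using ext_prod_swap_pairs[of "map ?e xs" "\<lambda>j. ?e (n + 1 + \<tau> j)" "\<lambda>j. ?e (1 + \<tau> j)" "[0..<n]" "[]" v]
    by (simp add: basis_form_def pairs_def map_concat o_def)
  then show ?thesis unfolding basis_form_interleave[OF \<tau>] triangular_number_eq by (simp add: power_add)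
qed

lemma basis_form_move_zero:
  "basis_form (js @ 0 # is) v = (-1) ^ length js * basis_form (0 # js @ is) v"
  using ext_prod_move[of "[]" "map (\<lambda>j. G (E j)) js"] by (simp add: basis_form_def)

text \<open>A multiple of the volume form other than \<open>0\<close> cannot have a repeated factor, so distinctness comes for free.\<close>

lemma is_star_basis_formI:
  assumes xy: "length (xs @ ys) = 2 * n + 1" "set (xs @ ys) \<subseteq> {..<2 * n + 1}"
    and c: "\<And>v. basis_form (xs @ ys) v = c * basis_form [0..<2 * n + 1] v" "c \<noteq> 0"
    and k: "length xs = k"
  shows "is_star k (basis_form xs) (\<lambda>v. c * basis_form ys v)"
proof -
  have "basis_form (xs @ ys) E \<noteq> 0" using c basis_form_top_self by (simp add: dim)
  then have d: "distinct (xs @ ys)" using basis_form_not_distinct by blast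
  moreover have "set (xs @ ys) = {..<2 * n + 1}"
    using d xy by (intro card_subset_eq) (auto simp: distinct_card simp del: set_append length_append distinct_append)
  ultimately show ?thesis
    using is_star_basis_form[of xs ys c] c k by (simp add: dim)
qed

lemma sum_reindex_pairs:
  fixes \<tau> :: "nat \<Rightarrow> nat"
  assumes \<tau>: "\<tau> permutes {..<n}"
  shows "(\<Sum>j<n. basis_form ([n + 1 + j, 1 + j] @ js) v) = (\<Sum>m<n. basis_form ([n + 1 + \<tau> m, 1 + \<tau> m] @ js) v)"
  using sum.permute[OF \<tau>, of "\<lambda>j. basis_form ([n + 1 + j, 1 + j] @ js) v"] by (simp add: o_def)

text \<open>The \<open>i\<close>-th power is the sum over all injective choices of \<open>i\<close> pairs. Writing an injection as the
restriction of a permutation to \<open>{..<i}\<close> counts it \<open>(n - i)!\<close> times. In the induction step, a new pair that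
repeats a chosen one contributes \<open>0\<close>, and each of the \<open>n - i\<close> others gives the same sum, as a
transposition of the permutation shows.\<close>

lemma wedge_power_symplectic:
  "i \<le> n \<Longrightarrow> wedge_power 2 symplectic_form i =
     (\<lambda>v. (\<Sum>\<tau> | \<tau> permutes {..<n}. basis_form (pairs \<tau> [0..<i]) v) / fact (n - i))"
proof (induction i)
  case 0
  have "basis_form [] v = 1" for v by (simp add: basis_form_def ext_prod_def)
  then show ?case by (simp add: card_permutations[OF refl])
next
  case (Suc i)
  let ?S = "{\<tau>. \<tau> permutes {..<n}}"
  have "wedge_power 2 symplectic_form (Suc i) =
    wedge 2 (2 * i) symplectic_form (\<lambda>v. (1 / fact (n - i)) * (\<Sum>\<tau>\<in>?S. basis_form (pairs \<tau> [0..<i]) v))"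
    using Suc by simp
  also have "\<dots> = (\<lambda>v. (1 / fact (n - i)) * (\<Sum>\<tau>\<in>?S. \<Sum>j<n. basis_form ([n + 1 + j, 1 + j] @ pairs \<tau> [0..<i]) v))"
    unfolding symplectic_form_def wedge_scale_right wedge_sum_right wedge_sum_left
    by (simp add: wedge_basis_form)
  also have "\<dots> = (\<lambda>v. (\<Sum>\<tau>\<in>?S. basis_form (pairs \<tau> [0..<Suc i]) v) / fact (n - Suc i))"
  proof
    fix v
    let ?F = "\<lambda>m \<tau>. basis_form ([n + 1 + \<tau> m, 1 + \<tau> m] @ pairs \<tau> [0..<i]) v"
    \<comment> \<open>The new pair is taken at position \<open>m\<close> of the permutation.\<close>
    have small: "?F m \<tau> = 0" if "m < i" for m \<tau>
      by (rule basis_form_not_distinct) (use that in \<open>auto simp: set_pairs\<close>)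
    have large: "(\<Sum>\<tau>\<in>?S. ?F m \<tau>) = (\<Sum>\<tau>\<in>?S. ?F i \<tau>)" if m: "m \<in> {i..<n}" for m
    proof -
      have tr: "Transposition.transpose i m permutes {..<n}" using m Suc.prems by (intro permutes_swap_id) auto
      have "?F i (\<tau> \<circ> Transposition.transpose i m) = ?F m \<tau>" for \<tau>
      proof -
        have "pairs (\<tau> \<circ> Transposition.transpose i m) [0..<i] = pairs \<tau> [0..<i]"
          unfolding pairs_def using m
          by (intro arg_cong[where f=concat] map_cong refl) (auto simp: Transposition.transpose_def)
        then show ?thesis by simp
      qed
      then show ?thesis using sum_permutes_compose_right[OF tr, of "?F i"] by simp
    qed
    have block: "?F i \<tau> = basis_form (pairs \<tau> [0..<Suc i]) v" for \<tau>
      using ext_prod_move_block[of "[]" "map (\<lambda>j. G (E j)) [n + 1 + \<tau> i, 1 + \<tau> i]"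
        "map (\<lambda>j. G (E j)) (pairs \<tau> [0..<i])" "[]" v]
      by (simp add: basis_form_def power_mult)
    have "(\<Sum>\<tau>\<in>?S. \<Sum>j<n. basis_form ([n + 1 + j, 1 + j] @ pairs \<tau> [0..<i]) v) = (\<Sum>\<tau>\<in>?S. \<Sum>m<n. ?F m \<tau>)"
      by (intro sum.cong refl sum_reindex_pairs) simp
    also have "\<dots> = (\<Sum>m<n. \<Sum>\<tau>\<in>?S. ?F m \<tau>)" by (rule sum.swap)
    also have "\<dots> = (\<Sum>m\<in>{i..<n}. \<Sum>\<tau>\<in>?S. ?F m \<tau>)"
      using small by (intro sum.mono_neutral_right) auto
    also have "\<dots> = real (n - i) * (\<Sum>\<tau>\<in>?S. basis_form (pairs \<tau> [0..<Suc i]) v)"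
      using large block by simp
    finally have "(\<Sum>\<tau>\<in>?S. \<Sum>j<n. basis_form ([n + 1 + j, 1 + j] @ pairs \<tau> [0..<i]) v) =
       real (n - i) * (\<Sum>\<tau>\<in>?S. basis_form (pairs \<tau> [0..<Suc i]) v)" .
    moreover have "fact (n - i) = real (n - i) * fact (n - Suc i)"
      using Suc.prems by (simp add: fact_reduce)
    ultimately show "(1 / fact (n - i)) * (\<Sum>\<tau>\<in>?S. \<Sum>j<n. basis_form ([n + 1 + j, 1 + j] @ pairs \<tau> [0..<i]) v) =
       (\<Sum>\<tau>\<in>?S. basis_form (pairs \<tau> [0..<Suc i]) v) / fact (n - Suc i)"
      using Suc.prems by simp
  qed
  finally show ?case .
qed

lemma wedge_power_symplectic_top:
  "wedge_power 2 symplectic_form n = (\<lambda>v. (-1) ^ (n * (n + 1) div 2) * fact n * basis_form [1..<2 * n + 1] v)"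
proof -
  have "(\<Sum>\<tau> | \<tau> permutes {..<n}. basis_form (pairs \<tau> [0..<n]) v) =
     (\<Sum>\<tau> | \<tau> permutes {..<n}. (-1) ^ (n * (n + 1) div 2) * basis_form [1..<2 * n + 1] v)" for v
    using basis_form_pairs[of _ "[]" v] by (intro sum.cong) auto
  then show ?thesis
    unfolding wedge_power_symplectic[OF order_refl] by (simp add: card_permutations[OF refl] mult_ac)
qed

text \<open>Summed over all permutations, the pairs at the last \<open>n - i\<close> positions may be replaced by those at the
first ones.\<close>

lemma sum_pairs_rotate:
  assumes i: "i \<le> n"
  shows "(\<Sum>\<tau> | \<tau> permutes {..<n}. basis_form (xs @ pairs \<tau> [i..<n]) v) =
    (\<Sum>\<tau> | \<tau> permutes {..<n}. basis_form (xs @ pairs \<tau> [0..<n - i]) v)"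
proof -
  have "pairs (\<tau> \<circ> rotation i n) [i..<n] = pairs \<tau> [0..<n - i]" for \<tau>
  proof -
    have "map (rotation i n) [i..<n] = [0..<n - i]"
      using i by (intro nth_equalityI) (auto simp: rotation_def)
    moreover have "pairs (\<tau> \<circ> rotation i n) [i..<n] = pairs \<tau> (map (rotation i n) [i..<n])"
      by (simp add: pairs_def o_def)
    ultimately show ?thesis by simp
  qed
  then show ?thesis
    using sum_permutes_compose_right[OF rotation_permutes[OF i], of "\<lambda>\<tau>. basis_form (xs @ pairs \<tau> [i..<n]) v"]
    by simp
qed

lemma wedge_contact_symplectic:
  assumes i: "i \<le> n"
  shows "wedge 1 (2 * i) contact_form (wedge_power 2 symplectic_form i) =
    (\<lambda>v. s / fact (n - i) * (\<Sum>\<tau> | \<tau> permutes {..<n}. basis_form (0 # pairs \<tau> [0..<i]) v))"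
proof -
  have "wedge 1 (2 * i) contact_form (wedge_power 2 symplectic_form i) =
     wedge 1 (2 * i) (\<lambda>v. s * basis_form [0] v)
       (\<lambda>v. (1 / fact (n - i)) * (\<Sum>\<tau> | \<tau> permutes {..<n}. basis_form (pairs \<tau> [0..<i]) v))"
    by (simp add: contact_form_def wedge_power_symplectic[OF i])
  also have "\<dots> = (\<lambda>v. s / fact (n - i) * (\<Sum>\<tau> | \<tau> permutes {..<n}. basis_form (0 # pairs \<tau> [0..<i]) v))"
    unfolding wedge_scale_left wedge_scale_right wedge_sum_right
    by (simp add: wedge_basis_form)
  finally show ?thesis .
qed

text \<open>The product of \<open>i\<close> pairs is complementary to \<open>e\<^sup>0\<close> times the remaining \<open>n - i\<close> pairs. The factor \<open>e\<^sup>0\<close> passes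
the pairs without a sign, and what is left is the sign of the product of all \<open>n\<close> pairs. The constants
come from the different multiplicities \<open>1/(n - i)!\<close> and \<open>1/i!\<close> of the two powers.\<close>

lemma star_wedge_power_symplectic:
  assumes i: "i \<le> n"
  shows "hodge_star G P (2 * i) (wedge_power 2 symplectic_form i) =
    (\<lambda>v. (-1) ^ (n * (n + 1) div 2) * (fact i / (fact (n - i) * s)) *
       wedge 1 (2 * (n - i)) contact_form (wedge_power 2 symplectic_form (n - i)) v)"
proof (rule hodge_star_eqI[OF vol_P])
  show "2 * i \<le> DIM('v)" using i by (simp add: dim)
  let ?c = "(-1) ^ (n * (n + 1) div 2) :: real"
  have "is_star (2 * i) (basis_form (pairs \<tau> [0..<i])) (\<lambda>v. ?c * basis_form (0 # pairs \<tau> [i..<n]) v)"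
    if \<tau>: "\<tau> permutes {..<n}" for \<tau>
  proof (rule is_star_basis_formI)
    show "length (pairs \<tau> [0..<i] @ 0 # pairs \<tau> [i..<n]) = 2 * n + 1" using i by simp
    show "set (pairs \<tau> [0..<i] @ 0 # pairs \<tau> [i..<n]) \<subseteq> {..<2 * n + 1}"
    proof -
      have "set (pairs \<tau> [0..<i]) \<subseteq> {1..<2 * n + 1}" "set (pairs \<tau> [i..<n]) \<subseteq> {1..<2 * n + 1}"
        using i by (intro pairs_subset[OF \<tau>]; auto)+
      then show ?thesis by auto
    qed
    show "basis_form (pairs \<tau> [0..<i] @ 0 # pairs \<tau> [i..<n]) v = ?c * basis_form [0..<2 * n + 1] v" for v
    proof -
      have "pairs \<tau> [0..<i] @ pairs \<tau> [i..<n] = pairs \<tau> [0..<n]"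
        using i by (metis pairs_simps(3) upt_add_eq_append le0 le_add_diff_inverse)
      then show ?thesis
        using basis_form_pairs[OF \<tau>, of "[0]" v]
        by (simp only: basis_form_move_zero upt_Cons_zero) (simp add: power_mult)
    qed
  qed auto
  then have "is_star (2 * i) (\<lambda>v. (1 / fact (n - i)) * (\<Sum>\<tau> | \<tau> permutes {..<n}. basis_form (pairs \<tau> [0..<i]) v))
     (\<lambda>v. (1 / fact (n - i)) * (\<Sum>\<tau> | \<tau> permutes {..<n}. ?c * basis_form (0 # pairs \<tau> [i..<n]) v))"
    by (intro is_star_scale is_star_sum) simp
  also have "(\<lambda>v. (1 / fact (n - i)) * (\<Sum>\<tau> | \<tau> permutes {..<n}. ?c * basis_form (0 # pairs \<tau> [i..<n]) v)) =
    (\<lambda>v. ?c * (fact i / (fact (n - i) * s)) *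
       wedge 1 (2 * (n - i)) contact_form (wedge_power 2 symplectic_form (n - i)) v)"
  proof
    fix v
    define c where "c = (-1 :: real) ^ (n * (n + 1) div 2)"
    have "(\<Sum>\<tau> | \<tau> permutes {..<n}. c * basis_form (0 # pairs \<tau> [i..<n]) v) =
       c * (\<Sum>\<tau> | \<tau> permutes {..<n}. basis_form (0 # pairs \<tau> [0..<n - i]) v)"
      using sum_pairs_rotate[OF i, of "[0]" v] by (simp add: sum_distrib_left[symmetric])
    moreover have "wedge 1 (2 * (n - i)) contact_form (wedge_power 2 symplectic_form (n - i)) v =
       s / fact i * (\<Sum>\<tau> | \<tau> permutes {..<n}. basis_form (0 # pairs \<tau> [0..<n - i]) v)"
      using i by (subst wedge_contact_symplectic) auto
    ultimately show "(1 / fact (n - i)) * (\<Sum>\<tau> | \<tau> permutes {..<n}. ?c * basis_form (0 # pairs \<tau> [i..<n]) v) =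
       ?c * (fact i / (fact (n - i) * s)) *
         wedge 1 (2 * (n - i)) contact_form (wedge_power 2 symplectic_form (n - i)) v"
      using s_pos unfolding c_def[symmetric] by simp
  qed
  finally show "is_star (2 * i) (wedge_power 2 symplectic_form i) (\<lambda>v. ?c * (fact i / (fact (n - i) * s)) *
       wedge 1 (2 * (n - i)) contact_form (wedge_power 2 symplectic_form (n - i)) v)"
    by (simp add: wedge_power_symplectic[OF i])
qed

lemma star_contact: "hodge_star G P 1 contact_form = (\<lambda>v. s * basis_form [1..<2 * n + 1] v)"
proof (rule hodge_star_eqI[OF vol_P])
  show "1 \<le> DIM('v)" by (simp add: dim)
  have "is_star 1 (basis_form [0]) (\<lambda>v. 1 * basis_form [1..<2 * n + 1] v)"
  proof (rule is_star_basis_formI)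
    show "basis_form ([0] @ [1..<2 * n + 1]) v = 1 * basis_form [0..<2 * n + 1] v" for v
      unfolding upt_Cons_zero by simp
  qed auto
  then show "is_star 1 contact_form (\<lambda>v. s * basis_form [1..<2 * n + 1] v)"
    unfolding contact_form_def by (intro is_star_scale) simp
qed

lemma star_contact_symplectic:
  "hodge_star G P 1 contact_form =
     (\<lambda>v. s * (-1) ^ (n * (n + 1) div 2) / fact n * wedge_power 2 symplectic_form n v)"
proof -
  define c where "c = (-1 :: real) ^ (n * (n + 1) div 2)"
  have "c * c = 1" by (simp add: c_def)
  moreover have "s * c / fact n * (c * fact n * x) = s * ((c * c) * x)" for x :: real
    by (simp add: field_simps)
  ultimately show ?thesis
    unfolding star_contact wedge_power_symplectic_top c_def[symmetric] by (simp only: mult_1_left)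
qed

lemma length_mixed_indices [simp]: "length (mixed_indices \<tau> i) = n"
  by (simp add: mixed_indices_def)

lemma mixed_indices_subset: "\<tau> permutes {..<n} \<Longrightarrow> set (mixed_indices \<tau> i) \<subseteq> {1..<2 * n + 1}"
  by (fastforce simp: mixed_indices_def dest: permutes_less)

text \<open>For \<open>i = 0\<close> and \<open>i = n\<close> no position is distinguished, and all \<open>n!\<close> summands agree.\<close>

lemma mixed_form_const:
  assumes "\<And>\<tau>. mixed_indices \<tau> i = map (\<lambda>j. a (\<tau> j)) [0..<n]" and "fact i * fact (n - i) = (fact n :: real)"
  shows "mixed_form i = (\<lambda>v. \<epsilon> * basis_form (map a [0..<n]) v)"
proof -
  have "(\<Sum>\<tau> | \<tau> permutes {..<n}. of_int (sign \<tau>) * basis_form (mixed_indices \<tau> i) v) =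
    (\<Sum>\<tau> | \<tau> permutes {..<n}. basis_form (map a [0..<n]) v)" for v
  proof (rule sum.cong)
    fix \<tau> assume "\<tau> \<in> {\<tau>. \<tau> permutes {..<n}}"
    then show "of_int (sign \<tau>) * basis_form (mixed_indices \<tau> i) v = basis_form (map a [0..<n]) v"
      using ext_prod_permute_block[of \<tau> n "\<lambda>j. G (E (a j))" "[]" v] assms(1)[of \<tau>]
      by (cases \<tau> rule: sign_cases) (auto simp: basis_form_def o_def)
  qed simp
  then show ?thesis by (simp add: mixed_form_def assms(2) card_permutations[OF refl])
qed

lemma mixed_form_zero: "mixed_form 0 = (\<lambda>v. \<epsilon> * basis_form (map Suc [0..<n]) v)"
  by (rule mixed_form_const) (auto simp: mixed_indices_def)

lemma mixed_form_top: "mixed_form n = (\<lambda>v. \<epsilon> * basis_form (map (\<lambda>j. n + 1 + j) [0..<n]) v)"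
  by (rule mixed_form_const) (auto simp: mixed_indices_def)

lemma star_contact_mixed: "hodge_star G P 1 contact_form = (\<lambda>v. s * wedge n n (mixed_form 0) (mixed_form n) v)"
proof -
  have "wedge n n (mixed_form 0) (mixed_form n) = (\<lambda>v. \<epsilon> * (\<epsilon> * basis_form [1..<2 * n + 1] v))"
    unfolding mixed_form_zero mixed_form_top wedge_scale_left wedge_scale_right upt_halves[symmetric]
    by (simp add: wedge_basis_form)
  then show ?thesis unfolding star_contact by (simp add: mult.assoc[symmetric] \<epsilon>)
qed

text \<open>The complement of \<open>mixed_indices\<close> within \<open>{1..2 * n}\<close>: horizontal and vertical positions are exchanged.\<close>

definition opposite_indices :: "(nat \<Rightarrow> nat) \<Rightarrow> nat \<Rightarrow> nat list" where
  "opposite_indices \<tau> i = map (\<lambda>j. 1 + \<tau> j + (if j < n - i then n else 0)) [0..<n]"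

text \<open>The factor \<open>e\<^sup>0\<close> moves past \<open>n\<close> others. The remaining factors are shuffled into \<open>n\<close> pairs, the \<open>i\<close> pairs with the
vertical factor first are turned round, and undoing the shuffle costs the same sign as before. So the
total sign is \<open>(-1)\<^sup>n\<^sup>+\<^sup>i = (-1)\<^sup>n\<^sup>-\<^sup>i\<close>.\<close>

lemma basis_form_mixed_opposite:
  assumes i: "i \<le> n" and \<tau>: "\<tau> permutes {..<n}"
  shows "basis_form (mixed_indices \<tau> i @ 0 # opposite_indices \<tau> i) v = (-1) ^ (n - i) * basis_form [0..<2 * n + 1] v"
proof -
  let ?e = "\<lambda>j. G (E j)"
  let ?a = "\<lambda>j. 1 + \<tau> j + (if j < n - i then 0 else n)" and ?b = "\<lambda>j. 1 + \<tau> j + (if j < n - i then n else 0)"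
  let ?m = "n * (n - 1) div 2"
  have split: "[0..<n] = [0..<n - i] @ [n - i..<n]"
    by (metis upt_add_eq_append le0 le_add_diff_inverse diff_le_self)
  have "basis_form (mixed_indices \<tau> i @ 0 # opposite_indices \<tau> i) v =
     (-1) ^ n * basis_form ([0] @ map ?a [0..<n] @ map ?b [0..<n]) v"
    by (simp add: basis_form_move_zero) (simp add: mixed_indices_def opposite_indices_def)
  also have "basis_form ([0] @ map ?a [0..<n] @ map ?b [0..<n]) v =
     (-1) ^ ?m * basis_form (0 # concat (map (\<lambda>j. [?a j, ?b j]) [0..<n])) v"
    using ext_prod_interleave[of "[?e 0]" "\<lambda>j. ?e (?a j)" n "\<lambda>j. ?e (?b j)" "[]" v]
    by (simp add: basis_form_def map_concat o_def)
  also have "concat (map (\<lambda>j. [?a j, ?b j]) [0..<n]) =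
     concat (map (\<lambda>j. [1 + \<tau> j, n + 1 + \<tau> j]) [0..<n - i]) @ concat (map (\<lambda>j. [n + 1 + \<tau> j, 1 + \<tau> j]) [n - i..<n])"
    unfolding split map_append concat_append
    by (intro arg_cong2[where f=append] arg_cong[where f=concat] map_cong) auto
  also have "basis_form (0 # \<dots>) v = (-1) ^ i * basis_form (0 #
     concat (map (\<lambda>j. [1 + \<tau> j, n + 1 + \<tau> j]) [0..<n - i]) @ concat (map (\<lambda>j. [1 + \<tau> j, n + 1 + \<tau> j]) [n - i..<n])) v"
    using ext_prod_swap_pairs[of "?e 0 # concat (map (\<lambda>j. [?e (1 + \<tau> j), ?e (n + 1 + \<tau> j)]) [0..<n - i])"
      "\<lambda>j. ?e (n + 1 + \<tau> j)" "\<lambda>j. ?e (1 + \<tau> j)" "[n - i..<n]" "[]" v] i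
    by (simp add: basis_form_def map_concat o_def)
  also have "concat (map (\<lambda>j. [1 + \<tau> j, n + 1 + \<tau> j]) [0..<n - i]) @ concat (map (\<lambda>j. [1 + \<tau> j, n + 1 + \<tau> j]) [n - i..<n]) =
     concat (map (\<lambda>j. [1 + \<tau> j, n + 1 + \<tau> j]) [0..<n])"
    unfolding split by simp
  also have "basis_form (0 # \<dots>) v = (-1) ^ ?m * basis_form [0..<2 * n + 1] v"
    using basis_form_interleave[OF \<tau>, of "[0]" v] unfolding upt_Cons_zero by simp
  also have "(-1) ^ n * ((-1) ^ ?m * ((-1) ^ i * ((-1) ^ ?m * basis_form [0..<2 * n + 1] v))) =
     (-1) ^ (n - i) * basis_form [0..<2 * n + 1] v"
  proof -
    obtain d where d: "n = d + i" using i by (metis le_add_diff_inverse2)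
    define m where "m = (-1 :: real) ^ ?m"
    have "m * m = 1" by (simp add: m_def)
    moreover have "(-1 :: real) ^ n * (-1) ^ i = (-1) ^ d" by (simp add: d power_add)
    moreover have "(-1) ^ n * (m * ((-1) ^ i * (m * x))) = ((-1) ^ n * (-1) ^ i) * (m * m) * x" for x :: real
      by (simp only: mult_ac)
    ultimately show ?thesis unfolding m_def[symmetric] using d by simp
  qed
  finally show ?thesis .
qed

text \<open>The opposite indices have their \<open>n - i\<close> vertical positions in front rather than at the end.
Reversing the order of the factors costs a sign, which the reindexing of the sum by the same reversal
pays back.\<close>

lemma sum_opposite_indices:
  assumes i: "i \<le> n"
  shows "(\<Sum>\<tau> | \<tau> permutes {..<n}. of_int (sign \<tau>) * basis_form (xs @ opposite_indices \<tau> i) v) =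
    (\<Sum>\<tau> | \<tau> permutes {..<n}. of_int (sign \<tau>) * basis_form (xs @ mixed_indices \<tau> (n - i)) v)"
proof -
  let ?\<rho> = "reversal n"
  have "(\<Sum>\<tau> | \<tau> permutes {..<n}. of_int (sign \<tau>) * basis_form (xs @ opposite_indices \<tau> i) v) =
    (\<Sum>\<tau> | \<tau> permutes {..<n}. of_int (sign (\<tau> \<circ> ?\<rho>)) * basis_form (xs @ opposite_indices (\<tau> \<circ> ?\<rho>) i) v)"
    using sum_permutes_compose_right[OF reversal_permutes,
      of "\<lambda>\<tau>. of_int (sign \<tau>) * basis_form (xs @ opposite_indices \<tau> i) v"] by simp
  also have "\<dots> = (\<Sum>\<tau> | \<tau> permutes {..<n}. of_int (sign \<tau>) * basis_form (xs @ mixed_indices \<tau> (n - i)) v)"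
  proof (rule sum.cong)
    fix \<tau> assume "\<tau> \<in> {\<tau>. \<tau> permutes {..<n}}"
    then have \<tau>: "permutation \<tau>" by simp
    let ?h = "\<lambda>k. 1 + \<tau> k + (if k < i then 0 else n)"
    have opp: "opposite_indices (\<tau> \<circ> ?\<rho>) i = map (\<lambda>j. ?h (?\<rho> j)) [0..<n]"
      using i by (auto simp: opposite_indices_def reversal_def)
    have mix: "mixed_indices \<tau> (n - i) = map ?h [0..<n]"
      using i by (auto simp: mixed_indices_def)
    have "basis_form (xs @ opposite_indices (\<tau> \<circ> ?\<rho>) i) v = of_int (sign ?\<rho>) * basis_form (xs @ mixed_indices \<tau> (n - i)) v"
      using ext_prod_permute_middle[OF reversal_permutes, of "map (\<lambda>j. G (E j)) xs" "\<lambda>k. G (E (?h k))" n "[]" v]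
      unfolding opp mix by (simp add: basis_form_def o_def)
    then show "of_int (sign (\<tau> \<circ> ?\<rho>)) * basis_form (xs @ opposite_indices (\<tau> \<circ> ?\<rho>) i) v =
        of_int (sign \<tau>) * basis_form (xs @ mixed_indices \<tau> (n - i)) v"
      using \<tau> reversal_permutes[of n] by (cases ?\<rho> rule: sign_cases) (auto simp: sign_compose)
  qed simp
  finally show ?thesis .
qed

lemma wedge_contact_mixed:
  "wedge 1 n contact_form (mixed_form i) = (\<lambda>v. s * (\<epsilon> / (fact i * fact (n - i)) *
     (\<Sum>\<tau> | \<tau> permutes {..<n}. of_int (sign \<tau>) * basis_form ([0] @ mixed_indices \<tau> i) v)))"
  unfolding contact_form_def mixed_form_def wedge_scale_left wedge_scale_right wedge_sum_right
  by (simp add: wedge_basis_form)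

lemma star_mixed:
  assumes i: "i \<le> n"
  shows "hodge_star G P n (mixed_form i) = (\<lambda>v. (-1) ^ (n - i) / s * wedge 1 n contact_form (mixed_form (n - i)) v)"
proof (rule hodge_star_eqI[OF vol_P])
  show "n \<le> DIM('v)" by (simp add: dim)
  have "is_star n (basis_form (mixed_indices \<tau> i)) (\<lambda>v. (-1) ^ (n - i) * basis_form (0 # opposite_indices \<tau> i) v)"
    if \<tau>: "\<tau> permutes {..<n}" for \<tau>
  proof (rule is_star_basis_formI)
    show "length (mixed_indices \<tau> i @ 0 # opposite_indices \<tau> i) = 2 * n + 1" by (simp add: opposite_indices_def)
    have "set (opposite_indices \<tau> i) \<subseteq> {..<2 * n + 1}"
      by (fastforce simp: opposite_indices_def dest: permutes_less[OF \<tau>])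
    then show "set (mixed_indices \<tau> i @ 0 # opposite_indices \<tau> i) \<subseteq> {..<2 * n + 1}"
      using mixed_indices_subset[OF \<tau>, of i] by auto
  qed (auto simp: basis_form_mixed_opposite[OF i \<tau>])
  then have "is_star n (mixed_form i) (\<lambda>v. \<epsilon> / (fact i * fact (n - i)) *
     (\<Sum>\<tau> | \<tau> permutes {..<n}. of_int (sign \<tau>) * ((-1) ^ (n - i) * basis_form (0 # opposite_indices \<tau> i) v)))"
    unfolding mixed_form_def by (intro is_star_scale is_star_sum) simp
  also have "(\<lambda>v. \<epsilon> / (fact i * fact (n - i)) *
     (\<Sum>\<tau> | \<tau> permutes {..<n}. of_int (sign \<tau>) * ((-1) ^ (n - i) * basis_form (0 # opposite_indices \<tau> i) v))) =
     (\<lambda>v. (-1) ^ (n - i) / s * wedge 1 n contact_form (mixed_form (n - i)) v)"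
  proof
    fix v
    have "(\<Sum>\<tau> | \<tau> permutes {..<n}. of_int (sign \<tau>) * ((-1) ^ (n - i) * basis_form (0 # opposite_indices \<tau> i) v)) =
      (-1) ^ (n - i) * (\<Sum>\<tau> | \<tau> permutes {..<n}. of_int (sign \<tau>) * basis_form (0 # opposite_indices \<tau> i) v)"
      by (simp add: sum_distrib_left mult.left_commute)
    then show "\<epsilon> / (fact i * fact (n - i)) *
       (\<Sum>\<tau> | \<tau> permutes {..<n}. of_int (sign \<tau>) * ((-1) ^ (n - i) * basis_form (0 # opposite_indices \<tau> i) v)) =
       (-1) ^ (n - i) / s * wedge 1 n contact_form (mixed_form (n - i)) v"
      using s_pos i sum_opposite_indices[OF i, of "[0]" v]
      by (simp add: wedge_contact_mixed[unfolded One_nat_def] mult_ac)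
  qed
  finally show "is_star n (mixed_form i) (\<lambda>v. (-1) ^ (n - i) / s * wedge 1 n contact_form (mixed_form (n - i)) v)" .
qed

text \<open>Each product in \<open>\<alpha>\<^sub>i\<close> contains one of \<open>e\<^sup>j\<close> and \<open>e\<^sup>n\<^sup>+\<^sup>j\<close>, for every \<open>j\<close>.\<close>

lemma wedge_mixed_symplectic: "wedge n 2 (mixed_form i) symplectic_form = (\<lambda>v. 0)"
proof -
  have "basis_form (mixed_indices \<tau> i @ [n + 1 + j, 1 + j]) v = 0"
    if \<tau>: "\<tau> permutes {..<n}" and j: "j < n" for \<tau> j v
  proof (rule basis_form_not_distinct)
    have "inv \<tau> j < n" "\<tau> (inv \<tau> j) = j"
      using permutes_less[OF permutes_inv[OF \<tau>] j] permutes_inverses[OF \<tau>] by auto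
    then have "mixed_indices \<tau> i ! inv \<tau> j \<in> {n + 1 + j, 1 + j}"
      by (simp add: mixed_indices_def)
    moreover have "mixed_indices \<tau> i ! inv \<tau> j \<in> set (mixed_indices \<tau> i)"
      using \<open>inv \<tau> j < n\<close> by (intro nth_mem) simp
    ultimately show "\<not> distinct (mixed_indices \<tau> i @ [n + 1 + j, 1 + j])" by auto
  qed
  then show ?thesis
    unfolding mixed_form_def symplectic_form_def wedge_scale_left wedge_sum_left wedge_sum_right
    by (simp add: wedge_basis_form sum.neutral)
qed

text \<open>A product of \<open>2 n\<close> distinct factors among \<open>e\<^sup>1, \<dots>, e\<^sup>2\<^sup>n\<close> contains exactly \<open>n\<close> vertical ones, while here
there are \<open>i + j\<close>.\<close>

lemma wedge_mixed_mixed: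
  assumes ij: "i \<le> n" "j \<le> n" "j \<noteq> n - i"
  shows "wedge n n (mixed_form i) (mixed_form j) = (\<lambda>v. 0)"
proof -
  have vert: "length (filter (\<lambda>x. x > n) (mixed_indices \<tau> i)) = i" if "i \<le> n" "\<tau> permutes {..<n}" for \<tau> i
  proof -
    have "filter (\<lambda>x. x > n) (mixed_indices \<tau> i) = map (\<lambda>j. 1 + \<tau> j + n) [n - i..<n]"
    proof -
      have split: "[0..<n] = [0..<n - i] @ [n - i..<n]"
        by (metis upt_add_eq_append le0 le_add_diff_inverse diff_le_self)
      have "filter (\<lambda>x. x > n) (map (\<lambda>j. 1 + \<tau> j + (if j < n - i then 0 else n)) [0..<n - i]) = []"
        using permutes_less[OF that(2)] by (auto simp: filter_empty_conv Suc_le_eq not_less)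
      moreover have "filter (\<lambda>x. x > n) (map (\<lambda>j. 1 + \<tau> j + (if j < n - i then 0 else n)) [n - i..<n]) =
          map (\<lambda>j. 1 + \<tau> j + n) [n - i..<n]"
        by (subst filter_True) auto
      ultimately show ?thesis unfolding mixed_indices_def split by simp
    qed
    then show ?thesis using that by simp
  qed
  have "basis_form (mixed_indices \<tau> i @ mixed_indices \<tau>' j) v = 0"
    if \<tau>: "\<tau> permutes {..<n}" and \<tau>': "\<tau>' permutes {..<n}" for \<tau> \<tau>' v
  proof (rule basis_form_not_distinct, rule notI)
    let ?l = "mixed_indices \<tau> i @ mixed_indices \<tau>' j"
    assume d: "distinct ?l"
    have "set ?l \<subseteq> {1..<2 * n + 1}"
      using mixed_indices_subset[OF \<tau>, of i] mixed_indices_subset[OF \<tau>', of j] by simp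
    then have "set ?l = {1..<2 * n + 1}"
      using distinct_card[OF d] by (intro card_subset_eq) simp_all
    then have "set (filter (\<lambda>x. x > n) ?l) = {n + 1..<2 * n + 1}" unfolding set_filter by auto
    moreover have "card (set (filter (\<lambda>x. x > n) ?l)) = length (filter (\<lambda>x. x > n) ?l)"
      using d by (intro distinct_card distinct_filter)
    ultimately have "i + j = n" using vert ij \<tau> \<tau>' by simp
    then show False using ij by simp
  qed
  then show ?thesis
    unfolding mixed_form_def wedge_scale_left wedge_scale_right wedge_sum_left wedge_sum_right
    by (simp add: wedge_basis_form sum.neutral)
qed

end

section \<open>Calculus of smooth maps\<close>

lemma Ck_on_cong_open:
  assumes "open S" "\<And>x. x \<in> S \<Longrightarrow> f x = g x" "Ck_on k S f"
  shows "Ck_on k S g"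
  using assms(2,3)
proof (induction k arbitrary: f g)
  case 0
  then show ?case by (auto cong: continuous_on_cong)
next
  case (Suc k)
  have der: "frechet_derivative f (at x) = frechet_derivative g (at x)" if "x \<in> S" for x
    using Suc.prems that by (intro frechet_derivative_transform_within_open[OF _ \<open>open S\<close>]) auto
  have "g differentiable at x" if x: "x \<in> S" for x
  proof -
    have "(f has_derivative frechet_derivative f (at x)) (at x)"
      using Suc.prems x by (simp add: frechet_derivative_works)
    then have "(g has_derivative frechet_derivative f (at x)) (at x)"
      by (rule has_derivative_transform_within_open[OF _ \<open>open S\<close> x]) (rule Suc.prems(1))
    then show ?thesis unfolding differentiable_def by blast
  qed
  moreover have "Ck_on k S (\<lambda>x. frechet_derivative g (at x) v)" for v
    by (rule Suc.IH[of "\<lambda>x. frechet_derivative f (at x) v"]) (use Suc.prems der in auto)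
  ultimately show ?case by simp
qed

lemma Ck_on_subset: "Ck_on k S f \<Longrightarrow> T \<subseteq> S \<Longrightarrow> Ck_on k T f"
  by (induction k arbitrary: f) (auto intro: continuous_on_subset)

lemma Ck_on_SucD: "Ck_on (Suc k) S f \<Longrightarrow> Ck_on k S f"
proof (induction k arbitrary: f)
  case 0
  then show ?case
    by (auto intro!: differentiable_imp_continuous_on differentiable_at_imp_differentiable_on)
qed auto

lemma Ck_on_const [simp]: "Ck_on k S (\<lambda>x. c)"
  by (induction k arbitrary: c) auto

lemma Ck_on_bounded_linear: "bounded_linear L \<Longrightarrow> Ck_on k S L"
proof (cases k)
  case (Suc j)
  assume L: "bounded_linear L"
  then have "frechet_derivative L (at x) = L" for x
    using frechet_derivative_at[OF bounded_linear_imp_has_derivative] by metis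
  then show ?thesis using L Suc
    by (auto intro: bounded_linear_imp_differentiable)
qed (auto intro: linear_continuous_on)

lemma Ck_on_add:
  assumes "open S" "Ck_on k S f" "Ck_on k S g"
  shows "Ck_on k S (\<lambda>x. f x + g x)"
  using assms(2,3)
proof (induction k arbitrary: f g)
  case (Suc k)
  have der: "frechet_derivative (\<lambda>x. f x + g x) (at x) v = frechet_derivative f (at x) v + frechet_derivative g (at x) v"
    if "x \<in> S" for x v
  proof -
    have "((\<lambda>x. f x + g x) has_derivative (\<lambda>v. frechet_derivative f (at x) v + frechet_derivative g (at x) v)) (at x)"
      using Suc.prems that by (intro has_derivative_add) (auto simp: frechet_derivative_works)
    then show ?thesis using frechet_derivative_at by metis
  qed
  have "Ck_on k S (\<lambda>x. frechet_derivative (\<lambda>x. f x + g x) (at x) v)" for v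
    by (rule Ck_on_cong_open[OF \<open>open S\<close> der[symmetric]]) (use Suc in auto)
  then show ?case using Suc.prems by (auto intro: differentiable_add)
qed (auto intro: continuous_on_add)

lemma Ck_on_bilinear:
  assumes "open S" and B: "bounded_bilinear B" and "Ck_on k S f" "Ck_on k S g"
  shows "Ck_on k S (\<lambda>x. B (f x) (g x))"
  using assms(3,4)
proof (induction k arbitrary: f g)
  case 0
  then show ?case using bounded_bilinear.continuous_on[OF B] by auto
next
  case (Suc k)
  have has: "((\<lambda>x. B (f x) (g x)) has_derivative
      (\<lambda>v. B (f x) (frechet_derivative g (at x) v) + B (frechet_derivative f (at x) v) (g x))) (at x)"
    if "x \<in> S" for x
    using Suc.prems that by (intro bounded_bilinear.FDERIV[OF B]) (auto simp: frechet_derivative_works)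
  have der: "frechet_derivative (\<lambda>x. B (f x) (g x)) (at x) v =
      B (f x) (frechet_derivative g (at x) v) + B (frechet_derivative f (at x) v) (g x)" if "x \<in> S" for x v
    using frechet_derivative_at[OF has[OF that]] by metis
  have "Ck_on k S (\<lambda>x. frechet_derivative (\<lambda>x. B (f x) (g x)) (at x) v)" for v
    by (rule Ck_on_cong_open[OF \<open>open S\<close> der[symmetric]])
      (use Suc.prems in \<open>auto intro!: Ck_on_add[OF \<open>open S\<close>] Suc.IH dest: Ck_on_SucD simp del: Ck_on.simps, auto\<close>)
  then show ?case using has by (auto simp: differentiable_def)
qed

lemma Ck_on_sum:
  assumes "open S" "\<And>i. i \<in> I \<Longrightarrow> Ck_on k S (f i)"
  shows "Ck_on k S (\<lambda>x. \<Sum>i\<in>I. f i x)"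
  using assms(2)
  by (induction I rule: infinite_finite_induct) (auto intro: Ck_on_add[OF \<open>open S\<close>])

lemma linear_expand_Basis:
  fixes L :: "'a::euclidean_space \<Rightarrow> 'b::real_vector"
  assumes "linear L"
  shows "L x = (\<Sum>b\<in>Basis. (x \<bullet> b) *\<^sub>R L b)"
proof -
  have "L x = L (\<Sum>b\<in>Basis. (x \<bullet> b) *\<^sub>R b)" by (simp add: euclidean_representation)
  then show ?thesis by (simp add: linear_sum[OF assms] linear_cmul[OF assms])
qed

text \<open>The partial derivatives of the composite involve those of \<open>g\<close> along the basis vectors, composed with the same \<open>f\<close>. Hence the
induction has to be uniform in \<open>g\<close>.\<close>

lemma Ck_on_compose:
  fixes f :: "'a::real_normed_vector \<Rightarrow> 'b::euclidean_space"
  assumes S: "open S" and T: "open T" and "Ck_on k T g" "Ck_on k S f" "f ` S \<subseteq> T"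
  shows "Ck_on k S (\<lambda>x. g (f x))"
  using assms(3,4)
proof (induction k arbitrary: g)
  case 0
  then show ?case using continuous_on_compose2[of T g S f] assms(5) by auto
next
  case (Suc k)
  have has: "((\<lambda>x. g (f x)) has_derivative (\<lambda>v. frechet_derivative g (at (f x)) (frechet_derivative f (at x) v))) (at x)"
    if "x \<in> S" for x
    using Suc.prems that assms(5)
    by (intro has_derivative_compose[of f _ x UNIV g, simplified]) (auto simp: frechet_derivative_works image_subset_iff)
  have der: "frechet_derivative (\<lambda>x. g (f x)) (at x) v =
      (\<Sum>b\<in>Basis. (frechet_derivative f (at x) v \<bullet> b) *\<^sub>R frechet_derivative g (at (f x)) b)"
    if x: "x \<in> S" for x v
  proof -
    have "linear (frechet_derivative g (at (f x)))"
      using Suc.prems x assms(5) by (intro linear_frechet_derivative) auto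
    then show ?thesis
      using linear_expand_Basis frechet_derivative_at[OF has[OF x]] by metis
  qed
  have f: "Ck_on k S f" by (rule Ck_on_SucD) (rule Suc.prems)
  have "Ck_on k S (\<lambda>x. frechet_derivative (\<lambda>x. g (f x)) (at x) v)" for v
  proof (rule Ck_on_cong_open[OF S der[symmetric]])
    show "Ck_on k S (\<lambda>x. \<Sum>b\<in>Basis. (frechet_derivative f (at x) v \<bullet> b) *\<^sub>R frechet_derivative g (at (f x)) b)"
    proof (intro Ck_on_sum[OF S] Ck_on_bilinear[OF S bounded_bilinear_scaleR])
      fix b :: 'b
      show "Ck_on k S (\<lambda>x. frechet_derivative f (at x) v \<bullet> b)"
        using Suc.prems by (intro Ck_on_bilinear[OF S bounded_bilinear_inner]) auto
      show "Ck_on k S (\<lambda>x. frechet_derivative g (at (f x)) b)"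
        using Suc.prems f by (intro Suc.IH) auto
    qed
  qed
  then show ?case using has by (auto simp: differentiable_def)
qed

lemma smooth_on_cong_open: "open S \<Longrightarrow> (\<And>x. x \<in> S \<Longrightarrow> f x = g x) \<Longrightarrow> smooth_on S f \<Longrightarrow> smooth_on S g"
  unfolding smooth_on_def using Ck_on_cong_open by blast

lemma smooth_on_subset: "smooth_on S f \<Longrightarrow> T \<subseteq> S \<Longrightarrow> smooth_on T f"
  unfolding smooth_on_def using Ck_on_subset by blast

lemma smooth_on_const: "smooth_on S (\<lambda>x. c)"
  unfolding smooth_on_def by simp

lemma smooth_on_bounded_linear: "bounded_linear L \<Longrightarrow> smooth_on S L"
  unfolding smooth_on_def using Ck_on_bounded_linear by blast

lemma smooth_on_add: "open S \<Longrightarrow> smooth_on S f \<Longrightarrow> smooth_on S g \<Longrightarrow> smooth_on S (\<lambda>x. f x + g x)"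
  unfolding smooth_on_def using Ck_on_add by blast

lemma smooth_on_sum: "open S \<Longrightarrow> (\<And>i. i \<in> I \<Longrightarrow> smooth_on S (f i)) \<Longrightarrow> smooth_on S (\<lambda>x. \<Sum>i\<in>I. f i x)"
  unfolding smooth_on_def by (intro allI Ck_on_sum) auto

lemma smooth_on_bilinear:
  "open S \<Longrightarrow> bounded_bilinear B \<Longrightarrow> smooth_on S f \<Longrightarrow> smooth_on S g \<Longrightarrow> smooth_on S (\<lambda>x. B (f x) (g x))"
  unfolding smooth_on_def using Ck_on_bilinear by blast

lemma smooth_on_compose:
  fixes f :: "'a::real_normed_vector \<Rightarrow> 'b::euclidean_space"
  shows "open S \<Longrightarrow> open T \<Longrightarrow> smooth_on T g \<Longrightarrow> smooth_on S f \<Longrightarrow> f ` S \<subseteq> T \<Longrightarrow> smooth_on S (\<lambda>x. g (f x))"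
  unfolding smooth_on_def using Ck_on_compose by blast

lemma smooth_on_linear_compose:
  fixes f :: "'a::real_normed_vector \<Rightarrow> 'b::euclidean_space"
  shows "open S \<Longrightarrow> bounded_linear L \<Longrightarrow> smooth_on S f \<Longrightarrow> smooth_on S (\<lambda>x. L (f x))"
  using smooth_on_compose[of S UNIV L f] smooth_on_bounded_linear[of L UNIV] by auto

lemma smooth_on_Pair:
  fixes f :: "'a::real_normed_vector \<Rightarrow> 'b::euclidean_space" and g :: "'a \<Rightarrow> 'c::euclidean_space"
  assumes "open S" "smooth_on S f" "smooth_on S g"
  shows "smooth_on S (\<lambda>x. (f x, g x))"
proof -
  have "bounded_linear (\<lambda>y::'b. (y, 0::'c))" "bounded_linear (\<lambda>z::'c. (0::'b, z))"
    by (auto intro!: bounded_linear_intros)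
  then have "smooth_on S (\<lambda>x. (f x, 0) + (0, g x))"
    using assms by (intro smooth_on_add smooth_on_linear_compose[of S "\<lambda>y. (y, 0)"] smooth_on_linear_compose[of S "\<lambda>z. (0, z)"])
  then show ?thesis by simp
qed

lemma smooth_on_differentiable: "smooth_on S f \<Longrightarrow> x \<in> S \<Longrightarrow> f differentiable (at x)"
  unfolding smooth_on_def by (auto dest: spec[of _ "Suc 0"])

lemma smooth_on_has_derivative:
  "smooth_on S f \<Longrightarrow> x \<in> S \<Longrightarrow> (f has_derivative frechet_derivative f (at x)) (at x)"
  using smooth_on_differentiable frechet_derivative_works by blast

lemma smooth_on_continuous: "smooth_on S f \<Longrightarrow> continuous_on S f"
  unfolding smooth_on_def by (auto dest: spec[of _ 0])

lemma smooth_on_frechet: "smooth_on S f \<Longrightarrow> smooth_on S (\<lambda>x. frechet_derivative f (at x) v)"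
  unfolding smooth_on_def by (metis Ck_on.simps(2))

lemma smooth_on_frechet_apply:
  fixes f :: "'a::euclidean_space \<Rightarrow> 'b::real_normed_vector"
  assumes S: "open S" and f: "smooth_on S f" and X: "smooth_on S X"
  shows "smooth_on S (\<lambda>x. frechet_derivative f (at x) (X x))"
proof (rule smooth_on_cong_open[OF S])
  show "smooth_on S (\<lambda>x. \<Sum>b\<in>Basis. (X x \<bullet> b) *\<^sub>R frechet_derivative f (at x) b)"
    using f X by (intro smooth_on_sum[OF S] smooth_on_bilinear[OF S bounded_bilinear_scaleR]
      smooth_on_bilinear[OF S bounded_bilinear_inner] smooth_on_const smooth_on_frechet)
  show "(\<Sum>b\<in>Basis. (X x \<bullet> b) *\<^sub>R frechet_derivative f (at x) b) = frechet_derivative f (at x) (X x)"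
    if "x \<in> S" for x
    by (rule linear_expand_Basis[symmetric])
      (intro linear_frechet_derivative smooth_on_differentiable[OF f that])
qed

text \<open>By the mean value theorem in the direction \<open>v\<close>, the second difference is \<open>t\<close> times a difference of
first derivatives along \<open>v\<close> at points \<open>t w\<close> apart. Differentiability of that derivative at the
single point \<open>x\<close> suffices to estimate it.\<close>

lemma second_difference:
  fixes f :: "'a::real_normed_vector \<Rightarrow> real"
  assumes S: "open S" "x \<in> S" and f: "\<And>y. y \<in> S \<Longrightarrow> (f has_derivative f' y) (at y)"
    and A: "((\<lambda>y. f' y v) has_derivative A) (at x)" and e: "e > 0"
  shows "\<exists>d>0. \<forall>t. 0 < t \<and> t < d \<longrightarrow>
    \<bar>f (x + t *\<^sub>R v + t *\<^sub>R w) - f (x + t *\<^sub>R v) - f (x + t *\<^sub>R w) + f x - t\<^sup>2 * A w\<bar> \<le> e * t\<^sup>2"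
proof -
  \<comment> \<open>All points that occur are within \<open>t * C\<close> of \<open>x\<close>; the summand \<open>1\<close> makes \<open>C\<close> positive.\<close>
  define C where "C = norm v + norm w + 1"
  have C: "C > 0" by (simp add: C_def add_nonneg_pos)
  obtain r where r: "r > 0" "ball x r \<subseteq> S" using S openE by blast
  have "e / (2 * C) > 0" using C e by simp
  moreover have "\<forall>e>0. \<exists>d>0. \<forall>y. norm (y - x) < d \<longrightarrow> norm (f' y v - f' x v - A (y - x)) \<le> e * norm (y - x)"
    using A unfolding has_derivative_at_alt by simp
  ultimately obtain d0 where d0: "d0 > 0"
    "\<And>y. norm (y - x) < d0 \<Longrightarrow> norm (f' y v - f' x v - A (y - x)) \<le> e / (2 * C) * norm (y - x)"
    by blast
  define d where "d = min r d0 / C"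
  have "d > 0" using r d0 C by (simp add: d_def)
  moreover have "\<bar>f (x + t *\<^sub>R v + t *\<^sub>R w) - f (x + t *\<^sub>R v) - f (x + t *\<^sub>R w) + f x - t\<^sup>2 * A w\<bar> \<le> e * t\<^sup>2"
    if t: "0 < t" "t < d" for t
  proof -
    have tC: "t * C < min r d0" using t C by (simp add: d_def pos_less_divide_eq)
    have small: "norm (\<tau> *\<^sub>R v + \<tau>' *\<^sub>R w) \<le> t * C" if "0 \<le> \<tau>" "\<tau> \<le> t" "0 \<le> \<tau>'" "\<tau>' \<le> t" for \<tau> \<tau>'
    proof -
      have "norm (\<tau> *\<^sub>R v + \<tau>' *\<^sub>R w) \<le> \<tau> * norm v + \<tau>' * norm w"
        using norm_triangle_ineq[of "\<tau> *\<^sub>R v" "\<tau>' *\<^sub>R w"] that by simp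
      also have "\<dots> \<le> t * norm v + t * norm w" using that by (intro add_mono mult_right_mono) auto
      also have "\<dots> \<le> t * C" using t by (simp add: C_def algebra_simps)
      finally show ?thesis .
    qed
    have inS: "x + \<tau> *\<^sub>R v + \<tau>' *\<^sub>R w \<in> S" if "0 \<le> \<tau>" "\<tau> \<le> t" "0 \<le> \<tau>'" "\<tau>' \<le> t" for \<tau> \<tau>'
    proof -
      have "dist x (x + \<tau> *\<^sub>R v + \<tau>' *\<^sub>R w) = norm (\<tau> *\<^sub>R v + \<tau>' *\<^sub>R w)"
        by (simp only: add.assoc dist_commute[of x]) (simp only: dist_norm add_diff_cancel_left')
      then show ?thesis using small[OF that] tC r by (auto simp: subset_iff)
    qed
    define \<phi> where "\<phi> \<tau> = f (x + \<tau> *\<^sub>R v + t *\<^sub>R w) - f (x + \<tau> *\<^sub>R v)" for \<tau>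
    have der: "(\<phi> has_derivative (\<lambda>h. h * (f' (x + \<tau> *\<^sub>R v + t *\<^sub>R w) v - f' (x + \<tau> *\<^sub>R v) v))) (at \<tau>)"
      if \<tau>: "0 \<le> \<tau>" "\<tau> \<le> t" for \<tau>
    proof -
      have 1: "x + \<tau> *\<^sub>R v + t *\<^sub>R w \<in> S" "x + \<tau> *\<^sub>R v \<in> S" using inS[of \<tau> t] inS[of \<tau> 0] \<tau> t by auto
      have "((\<lambda>\<tau>. x + \<tau> *\<^sub>R v + t *\<^sub>R w) has_derivative (\<lambda>h. h *\<^sub>R v)) (at \<tau>)"
        "((\<lambda>\<tau>. x + \<tau> *\<^sub>R v) has_derivative (\<lambda>h. h *\<^sub>R v)) (at \<tau>)"
        by (auto intro!: derivative_eq_intros)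
      from has_derivative_compose[OF this(1), of f] has_derivative_compose[OF this(2), of f] f[OF 1(1)] f[OF 1(2)]
      have "(\<phi> has_derivative (\<lambda>h. f' (x + \<tau> *\<^sub>R v + t *\<^sub>R w) (h *\<^sub>R v) - f' (x + \<tau> *\<^sub>R v) (h *\<^sub>R v))) (at \<tau>)"
        unfolding \<phi>_def by (intro has_derivative_diff) auto
      moreover have "linear (f' (x + \<tau> *\<^sub>R v + t *\<^sub>R w))" "linear (f' (x + \<tau> *\<^sub>R v))"
        using f 1 has_derivative_linear by blast+
      ultimately show ?thesis by (simp add: linear_cmul right_diff_distrib)
    qed
    have "\<exists>\<tau>\<in>{0<..<t}. \<phi> t - \<phi> 0 = (t - 0) * (f' (x + \<tau> *\<^sub>R v + t *\<^sub>R w) v - f' (x + \<tau> *\<^sub>R v) v)"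
    proof (rule mvt_simple[OF t(1), of \<phi> "\<lambda>\<tau> h. h * (f' (x + \<tau> *\<^sub>R v + t *\<^sub>R w) v - f' (x + \<tau> *\<^sub>R v) v)"])
      fix \<tau> assume \<tau>: "0 \<le> \<tau>" "\<tau> \<le> t"
      show "(\<phi> has_derivative (\<lambda>h. h * (f' (x + \<tau> *\<^sub>R v + t *\<^sub>R w) v - f' (x + \<tau> *\<^sub>R v) v)))
          (at \<tau> within {0..t})"
        by (rule has_derivative_at_withinI[OF der[OF \<tau>]])
    qed
    then obtain \<tau> where \<tau>: "0 < \<tau>" "\<tau> < t"
      and mvt: "\<phi> t - \<phi> 0 = (t - 0) * (f' (x + \<tau> *\<^sub>R v + t *\<^sub>R w) v - f' (x + \<tau> *\<^sub>R v) v)"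
      by auto
    have linA: "linear A" using A has_derivative_linear by blast
    have 1: "\<bar>f' (x + \<tau> *\<^sub>R v + \<tau>' *\<^sub>R w) v - f' x v - A (\<tau> *\<^sub>R v + \<tau>' *\<^sub>R w)\<bar> \<le> e / 2 * t"
      if "0 \<le> \<tau>'" "\<tau>' \<le> t" for \<tau>'
    proof -
      have n: "norm (\<tau> *\<^sub>R v + \<tau>' *\<^sub>R w) \<le> t * C" using small \<tau> that by simp
      have "norm (f' (x + \<tau> *\<^sub>R v + \<tau>' *\<^sub>R w) v - f' x v - A (\<tau> *\<^sub>R v + \<tau>' *\<^sub>R w)) \<le> e / (2 * C) * norm (\<tau> *\<^sub>R v + \<tau>' *\<^sub>R w)"
        using d0(2)[of "x + \<tau> *\<^sub>R v + \<tau>' *\<^sub>R w"] n tC by (simp add: add.assoc)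
      also have "\<dots> \<le> e / (2 * C) * (t * C)" using n C e by (intro mult_left_mono) auto
      also have "\<dots> = e / 2 * t" using C by simp
      finally show ?thesis by simp
    qed
    have "\<bar>(f' (x + \<tau> *\<^sub>R v + t *\<^sub>R w) v - f' (x + \<tau> *\<^sub>R v) v) - t * A w\<bar> \<le> e * t"
    proof -
      define a where "a = f' (x + \<tau> *\<^sub>R v + t *\<^sub>R w) v - f' x v - (\<tau> * A v + t * A w)"
      define b where "b = f' (x + \<tau> *\<^sub>R v) v - f' x v - \<tau> * A v"
      have "\<bar>a\<bar> \<le> e / 2 * t" "\<bar>b\<bar> \<le> e / 2 * t"
        using 1[of t] 1[of 0] t unfolding a_def b_def by (simp_all add: linear_add[OF linA] linear_cmul[OF linA])
      moreover have "(f' (x + \<tau> *\<^sub>R v + t *\<^sub>R w) v - f' (x + \<tau> *\<^sub>R v) v) - t * A w = a - b"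
        by (simp add: a_def b_def)
      ultimately show ?thesis using abs_triangle_ineq4[of a b] by simp
    qed
    then have "\<bar>t\<bar> * \<bar>(f' (x + \<tau> *\<^sub>R v + t *\<^sub>R w) v - f' (x + \<tau> *\<^sub>R v) v) - t * A w\<bar> \<le> t * (e * t)"
      using t by (intro mult_mono) auto
    then have "\<bar>t * (f' (x + \<tau> *\<^sub>R v + t *\<^sub>R w) v - f' (x + \<tau> *\<^sub>R v) v) - t\<^sup>2 * A w\<bar> \<le> e * t\<^sup>2"
      unfolding abs_mult[symmetric] by (simp add: power2_eq_square right_diff_distrib mult_ac)
    moreover have "f (x + t *\<^sub>R v + t *\<^sub>R w) - f (x + t *\<^sub>R v) - f (x + t *\<^sub>R w) + f x = \<phi> t - \<phi> 0"
      by (simp add: \<phi>_def)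
    ultimately show ?thesis using mvt by simp
  qed
  ultimately show ?thesis by blast
qed

text \<open>The second difference is symmetric in \<open>v\<close> and \<open>w\<close>, and divided by \<open>t\<^sup>2\<close> it tends to both sides.\<close>

lemma second_derivative_symmetric_real:
  fixes f :: "'a::real_normed_vector \<Rightarrow> real"
  assumes S: "open S" "x \<in> S" and f: "\<And>y. y \<in> S \<Longrightarrow> (f has_derivative f' y) (at y)"
    and A: "((\<lambda>y. f' y v) has_derivative A) (at x)" and B: "((\<lambda>y. f' y w) has_derivative B) (at x)"
  shows "A w = B v"
proof (rule ccontr)
  assume ne: "A w \<noteq> B v"
  define e where "e = \<bar>A w - B v\<bar> / 4"
  have e: "e > 0" using ne by (simp add: e_def)
  obtain d1 where d1: "d1 > 0" "\<And>t. 0 < t \<and> t < d1 \<Longrightarrow>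
    \<bar>f (x + t *\<^sub>R v + t *\<^sub>R w) - f (x + t *\<^sub>R v) - f (x + t *\<^sub>R w) + f x - t\<^sup>2 * A w\<bar> \<le> e * t\<^sup>2"
    using second_difference[OF S f A e, of w] by blast
  obtain d2 where d2: "d2 > 0" "\<And>t. 0 < t \<and> t < d2 \<Longrightarrow>
    \<bar>f (x + t *\<^sub>R w + t *\<^sub>R v) - f (x + t *\<^sub>R w) - f (x + t *\<^sub>R v) + f x - t\<^sup>2 * B v\<bar> \<le> e * t\<^sup>2"
    using second_difference[OF S f B e, of v] by blast
  define t where "t = min d1 d2 / 2"
  have t: "0 < t" "t < d1" "t < d2" using d1 d2 by (auto simp: t_def)
  have eq: "x + t *\<^sub>R w + t *\<^sub>R v = x + t *\<^sub>R v + t *\<^sub>R w" by (simp add: algebra_simps)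
  have "\<bar>t\<^sup>2 * A w - t\<^sup>2 * B v\<bar> \<le> 2 * (e * t\<^sup>2)"
    using d1(2)[of t] d2(2)[of t, unfolded eq] t by linarith
  also have "\<bar>t\<^sup>2 * A w - t\<^sup>2 * B v\<bar> = t\<^sup>2 * (4 * e)"
    by (simp add: e_def right_diff_distrib[symmetric] abs_mult)
  finally show False using t e by simp
qed

lemma second_derivative_symmetric:
  fixes f :: "'a::real_normed_vector \<Rightarrow> 'b::euclidean_space"
  assumes S: "open S" "x \<in> S" and f: "smooth_on S f"
  shows "frechet_derivative (\<lambda>y. frechet_derivative f (at y) v) (at x) w =
    frechet_derivative (\<lambda>y. frechet_derivative f (at y) w) (at x) v"
proof (rule euclidean_eqI)
  fix b :: 'b
  show "frechet_derivative (\<lambda>y. frechet_derivative f (at y) v) (at x) w \<bullet> b =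
    frechet_derivative (\<lambda>y. frechet_derivative f (at y) w) (at x) v \<bullet> b"
    by (rule second_derivative_symmetric_real[OF S, of "\<lambda>y. f y \<bullet> b" "\<lambda>y v. frechet_derivative f (at y) v \<bullet> b"])
      (use f S in \<open>auto intro!: has_derivative_inner_left smooth_on_has_derivative[of S] smooth_on_frechet\<close>)
qed

section \<open>Charts and tangent maps\<close>

locale atlas =
  fixes A :: "('a, 'e::euclidean_space) chart set"
  assumes smooth: "smooth_atlas A"
begin

lemma inj_chart: "c \<in> A \<Longrightarrow> inj_on (snd c) (fst c)"
  using smooth unfolding smooth_atlas_def by (auto simp: case_prod_beta)

lemma open_chart_image: "c \<in> A \<Longrightarrow> open (snd c ` fst c)"
  using smooth unfolding smooth_atlas_def by (auto simp: case_prod_beta)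

lemma open_overlap: "c \<in> A \<Longrightarrow> c' \<in> A \<Longrightarrow> open (snd c ` (fst c \<inter> fst c'))"
  using smooth unfolding smooth_atlas_def by (auto simp: case_prod_beta)

lemma smooth_transition:
  "c \<in> A \<Longrightarrow> c' \<in> A \<Longrightarrow> smooth_on (snd c ` (fst c \<inter> fst c')) (snd c' \<circ> inv_into (fst c) (snd c))"
  using smooth unfolding smooth_atlas_def by (auto simp: case_prod_beta)

lemma inv_chart [simp]: "c \<in> A \<Longrightarrow> p \<in> fst c \<Longrightarrow> inv_into (fst c) (snd c) (snd c p) = p"
  by (rule inv_into_f_f[OF inj_chart])

lemma image_chart_Int:
  "c \<in> A \<Longrightarrow> X \<subseteq> fst c \<Longrightarrow> Y \<subseteq> fst c \<Longrightarrow> snd c ` (X \<inter> Y) = snd c ` X \<inter> snd c ` Y"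
  using inj_on_image_Int[OF inj_chart] by blast

text \<open>On these sets the composition of two changes of coordinates is again a change of coordinates.\<close>

lemma open_triple_overlap:
  assumes "c \<in> A" "c' \<in> A" "c'' \<in> A"
  shows "open (snd c ` (fst c \<inter> fst c' \<inter> fst c''))"
proof -
  have "fst c \<inter> fst c' \<inter> fst c'' = (fst c \<inter> fst c') \<inter> (fst c \<inter> fst c'')" by blast
  then have "snd c ` (fst c \<inter> fst c' \<inter> fst c'') = snd c ` (fst c \<inter> fst c') \<inter> snd c ` (fst c \<inter> fst c'')"
    using image_chart_Int[OF assms(1), of "fst c \<inter> fst c'" "fst c \<inter> fst c''"] by simp
  then show ?thesis using open_Int[OF open_overlap[OF assms(1,2)] open_overlap[OF assms(1,3)]] by simp
qed

lemma chart_at: "p \<in> carrier_of A \<Longrightarrow> chart_at A p \<in> A \<and> p \<in> fst (chart_at A p)"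
  unfolding chart_at_def carrier_of_def by (rule someI_ex) auto

lemma carrierI: "c \<in> A \<Longrightarrow> p \<in> fst c \<Longrightarrow> p \<in> carrier_of A"
  unfolding carrier_of_def by blast

lemma coord_change_has_derivative:
  assumes "c \<in> A" "c' \<in> A" "p \<in> fst c" "p \<in> fst c'"
  shows "(snd c' \<circ> inv_into (fst c) (snd c) has_derivative coord_change c c' p) (at (snd c p))"
  unfolding coord_change_def using assms
  by (intro smooth_on_has_derivative[OF smooth_transition]) auto

lemma linear_coord_change:
  "c \<in> A \<Longrightarrow> c' \<in> A \<Longrightarrow> p \<in> fst c \<Longrightarrow> p \<in> fst c' \<Longrightarrow> linear (coord_change c c' p)"
  using coord_change_has_derivative has_derivative_linear by blast

lemma coord_change_trans:
  assumes c: "c \<in> A" "c' \<in> A" "c'' \<in> A" and p: "p \<in> fst c" "p \<in> fst c'" "p \<in> fst c''"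
  shows "coord_change c' c'' p (coord_change c c' p a) = coord_change c c'' p a"
proof -
  let ?t = "\<lambda>c c'. snd c' \<circ> inv_into (fst c) (snd c)"
  have "?t c c' (snd c p) = snd c' p" using c p by simp
  then have "((\<lambda>x. ?t c' c'' (?t c c' x)) has_derivative (\<lambda>a. coord_change c' c'' p (coord_change c c' p a))) (at (snd c p))"
    using has_derivative_compose[OF coord_change_has_derivative[of c c' p], of "?t c' c''" "coord_change c' c'' p"]
      coord_change_has_derivative[of c' c'' p] c p by simp
  then have "(?t c c'' has_derivative (\<lambda>a. coord_change c' c'' p (coord_change c c' p a))) (at (snd c p))"
    by (rule has_derivative_transform_within_open[OF _ open_triple_overlap[of c c' c'']]) (use c p in auto)
  then show ?thesis
    using has_derivative_unique[OF coord_change_has_derivative[of c c'' p]] c p by (metis)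
qed

lemma coord_change_self:
  assumes c: "c \<in> A" and p: "p \<in> fst c"
  shows "coord_change c c p a = a"
proof -
  have "((\<lambda>x. x) has_derivative coord_change c c p) (at (snd c p))"
    by (rule has_derivative_transform_within_open[OF coord_change_has_derivative[OF c c p p] open_chart_image[OF c]])
      (use c p in auto)
  then show ?thesis using has_derivative_unique[OF has_derivative_ident] by (metis)
qed

lemma coord_change_inverse:
  "c \<in> A \<Longrightarrow> c' \<in> A \<Longrightarrow> p \<in> fst c \<Longrightarrow> p \<in> fst c' \<Longrightarrow> coord_change c' c p (coord_change c c' p a) = a"
  by (simp add: coord_change_trans coord_change_self)

lemma openin_iff: "openin (manifold_topology A) W \<longleftrightarrow> W \<subseteq> carrier_of A \<and> (\<forall>c\<in>A. open (snd c ` (W \<inter> fst c)))"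
  using openin_manifold_topology[OF smooth] by (auto simp: case_prod_beta)

lemma openin_chart: "c \<in> A \<Longrightarrow> openin (manifold_topology A) (fst c)"
  unfolding openin_iff using open_overlap by (auto simp: carrierI Int_commute)

end

lemma smooth_map_iff:
  "smooth_map A B W F \<longleftrightarrow> openin (manifold_topology A) W \<and> F ` W \<subseteq> carrier_of B \<and>
     (\<forall>c\<in>A. \<forall>c'\<in>B. open (snd c ` (W \<inter> fst c \<inter> F -` fst c')) \<and>
        smooth_on (snd c ` (W \<inter> fst c \<inter> F -` fst c')) (snd c' \<circ> F \<circ> inv_into (fst c) (snd c)))"
  unfolding smooth_map_def by (auto simp: case_prod_beta)

lemma (in atlas) smooth_map_restrict:
  assumes F: "smooth_map A B W F" and c0: "c0 \<in> A"
  shows "smooth_map A B (W \<inter> fst c0) F"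
proof -
  have eq: "snd c ` (W \<inter> fst c0 \<inter> fst c \<inter> F -` V) = snd c ` (W \<inter> fst c \<inter> F -` V) \<inter> snd c ` (fst c \<inter> fst c0)"
    if "c \<in> A" for c V
    using image_chart_Int[OF that, of "W \<inter> fst c \<inter> F -` V" "fst c \<inter> fst c0"] by (auto simp: Int_ac)
  have "openin (manifold_topology A) (W \<inter> fst c0)"
    using F openin_chart[OF c0] unfolding smooth_map_iff by blast
  moreover have "open (snd c ` (W \<inter> fst c0 \<inter> fst c \<inter> F -` fst c')) \<and>
      smooth_on (snd c ` (W \<inter> fst c0 \<inter> fst c \<inter> F -` fst c')) (snd c' \<circ> F \<circ> inv_into (fst c) (snd c))"
    if c: "c \<in> A" "c' \<in> B" for c c'
  proof -
    have *: "open (snd c ` (W \<inter> fst c \<inter> F -` fst c'))"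
      "smooth_on (snd c ` (W \<inter> fst c \<inter> F -` fst c')) (snd c' \<circ> F \<circ> inv_into (fst c) (snd c))"
      using F c unfolding smooth_map_iff by blast+
    show ?thesis
      unfolding eq[OF c(1)] using open_Int[OF *(1) open_overlap[OF c(1) c0]] smooth_on_subset[OF *(2)] by blast
  qed
  ultimately show ?thesis using F unfolding smooth_map_iff by blast
qed

text \<open>The tangent map is defined in the preferred charts at the two points, which vary uncontrollably
with the point. By the chain rule it can be computed in any charts \<open>c\<close> and \<open>c'\<close>, at the price of the
two changes of coordinates.\<close>

lemma tangent_map_in_charts:
  assumes "smooth_atlas A" "smooth_atlas B"
    and c: "c \<in> A" "p \<in> fst c" and c': "c' \<in> B"
    and U: "open U" "snd c p \<in> U" "U \<subseteq> snd c ` fst c" "\<And>q. q \<in> fst c \<Longrightarrow> snd c q \<in> U \<Longrightarrow> F q \<in> fst c'"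
    and der: "(snd c' \<circ> F \<circ> inv_into (fst c) (snd c) has_derivative L) (at (snd c p))"
  shows "tangent_map A B F p (coord_change c (chart_at A p) p v) =
    coord_change c' (chart_at B (F p)) (F p) (L v)"
proof -
  interpret A: atlas A by unfold_locales fact
  interpret B: atlas B by unfold_locales fact
  define c0 where "c0 = chart_at A p"
  define c1 where "c1 = chart_at B (F p)"
  have c0: "c0 \<in> A" "p \<in> fst c0" using A.chart_at[OF A.carrierI[OF c]] by (auto simp: c0_def)
  have Fp: "F p \<in> fst c'" using U c by auto
  have c1: "c1 \<in> B" "F p \<in> fst c1" using B.chart_at[OF B.carrierI[OF c' Fp]] by (auto simp: c1_def)
  let ?t = "\<lambda>c c'. snd c' \<circ> inv_into (fst c) (snd c)"
  let ?O = "snd c0 ` (fst c0 \<inter> fst c)"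
  have O: "open ?O" "snd c0 p \<in> ?O" using A.open_overlap c c0 by auto
  have t_in: "inv_into (fst c0) (snd c0) (snd c0 p) = p" using c0 by simp
  have "continuous_on ?O (snd c \<circ> inv_into (fst c0) (snd c0))"
    using smooth_on_continuous[OF A.smooth_transition[OF c0(1) c(1)]] .
  then have W: "open (?O \<inter> (snd c \<circ> inv_into (fst c0) (snd c0)) -` U)"
    using O U continuous_open_preimage by blast
  have h1: "((\<lambda>x. (snd c' \<circ> F \<circ> inv_into (fst c) (snd c)) ((snd c \<circ> inv_into (fst c0) (snd c0)) x)) has_derivative
     (\<lambda>a. L (coord_change c0 c p a))) (at (snd c0 p))"
    by (rule has_derivative_compose[OF A.coord_change_has_derivative]) (use c c0 der in \<open>auto simp: o_def\<close>)
  have h2: "(snd c1 \<circ> inv_into (fst c') (snd c') has_derivative coord_change c' c1 (F p))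
    (at ((snd c' \<circ> F \<circ> inv_into (fst c) (snd c)) ((snd c \<circ> inv_into (fst c0) (snd c0)) (snd c0 p))))"
    using B.coord_change_has_derivative[OF c' c1(1) Fp c1(2)] c c0 by simp
  have "((\<lambda>x. (snd c1 \<circ> inv_into (fst c') (snd c')) ((snd c' \<circ> F \<circ> inv_into (fst c) (snd c)) ((snd c \<circ> inv_into (fst c0) (snd c0)) x)))
     has_derivative (\<lambda>a. coord_change c' c1 (F p) (L (coord_change c0 c p a)))) (at (snd c0 p))"
    by (rule has_derivative_compose[OF h1 h2])
  then have "(snd c1 \<circ> F \<circ> inv_into (fst c0) (snd c0) has_derivative
     (\<lambda>a. coord_change c' c1 (F p) (L (coord_change c0 c p a)))) (at (snd c0 p))"
    by (rule has_derivative_transform_within_open[OF _ W]) (use c c0 c' U in auto)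
  then have "tangent_map A B F p = (\<lambda>a. coord_change c' c1 (F p) (L (coord_change c0 c p a)))"
    using frechet_derivative_at unfolding tangent_map_def Let_def c0_def[symmetric] c1_def[symmetric] by metis
  then show ?thesis using A.coord_change_inverse c c0 by (simp add: c0_def c1_def)
qed

section \<open>The tangent bundle\<close>

text \<open>The chart of the tangent bundle induced by \<open>c\<close>. The preferred chart at a point of \<open>TM\<close> is of this form, but
\<open>c\<close> need not be the preferred chart at the base point.\<close>

definition tchart :: "('a, 'e::euclidean_space) chart set \<Rightarrow> ('a, 'e) chart \<Rightarrow> ('a \<times> 'e, 'e \<times> 'e) chart" where
  "tchart A c = (fst c \<times> UNIV, \<lambda>(p, v). (snd c p, coord_change (chart_at A p) c p v))"

lemma tangent_atlas_tchart: "tangent_atlas A = tchart A ` A"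
  by (simp add: tangent_atlas_def tchart_def)

lemma fst_tchart [simp]: "fst (tchart A c) = fst c \<times> UNIV"
  and snd_tchart: "snd (tchart A c) = (\<lambda>(p, v). (snd c p, coord_change (chart_at A p) c p v))"
  by (simp_all add: tchart_def)

context atlas
begin

lemma carrier_tangent_atlas: "carrier_of (tangent_atlas A) = carrier_of A \<times> UNIV"
  by (auto simp: carrier_of_def tangent_atlas_tchart)

lemma chart_at_of_chart: "c \<in> A \<Longrightarrow> p \<in> fst c \<Longrightarrow> chart_at A p \<in> A \<and> p \<in> fst (chart_at A p)"
  using chart_at carrierI by blast

lemma inj_tchart:
  assumes c: "c \<in> A"
  shows "inj_on (snd (tchart A c)) (fst (tchart A c))"
proof (rule inj_onI)
  fix u u' assume u: "u \<in> fst (tchart A c)" "u' \<in> fst (tchart A c)" and eq: "snd (tchart A c) u = snd (tchart A c) u'"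
  obtain p v p' v' where uu: "u = (p, v)" "u' = (p', v')" by (cases u, cases u') auto
  have "p = p'" using inj_onD[OF inj_chart[OF c]] u eq by (auto simp: uu snd_tchart)
  moreover have "v = v'"
    using eq coord_change_inverse[of "chart_at A p" c p] chart_at_of_chart[OF c, of p] c u \<open>p = p'\<close>
    by (simp add: uu snd_tchart) metis
  ultimately show "u = u'" by (simp add: uu)
qed

lemma tchart_inv:
  assumes c: "c \<in> A" and q: "q \<in> fst c"
  shows "inv_into (fst (tchart A c)) (snd (tchart A c)) (snd c q, y) = (q, coord_change c (chart_at A q) q y)"
  by (rule inv_into_f_eq[OF inj_tchart[OF c]])
    (use c q chart_at_of_chart[OF c q] in \<open>auto simp: snd_tchart coord_change_inverse\<close>)

lemma tchart_image:
  assumes c: "c \<in> A" and W: "W \<subseteq> fst c"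
  shows "snd (tchart A c) ` (W \<times> UNIV) = (snd c ` W) \<times> UNIV"
proof (intro equalityI subsetI)
  fix x :: "'e \<times> 'e" assume "x \<in> (snd c ` W) \<times> UNIV"
  then obtain q y where q: "q \<in> W" "x = (snd c q, y)" by (cases x) auto
  then have "x = snd (tchart A c) (q, coord_change c (chart_at A q) q y)"
    using c W chart_at_of_chart[OF c, of q] by (auto simp: snd_tchart coord_change_inverse)
  then show "x \<in> snd (tchart A c) ` (W \<times> UNIV)" using q by blast
qed (auto simp: snd_tchart)

lemma tchart_transition:
  assumes c: "c \<in> A" "c' \<in> A" and q: "q \<in> fst c" "q \<in> fst c'"
  shows "(snd (tchart A c') \<circ> inv_into (fst (tchart A c)) (snd (tchart A c))) (snd c q, y) =
    (snd c' q, coord_change c c' q y)"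
  using chart_at_of_chart[OF c(1) q(1)] c q
  by (simp add: tchart_inv del: fst_tchart) (simp add: snd_tchart coord_change_trans)

text \<open>The transition maps are \<open>(x, y) \<mapsto> (t x, dt\<^sub>x y)\<close>, with \<open>t\<close> a transition map of \<open>M\<close>.\<close>

lemma smooth_atlas_tangent: "smooth_atlas (tangent_atlas A)"
  unfolding smooth_atlas_def case_prod_beta
proof (intro conjI ballI)
  fix k assume "k \<in> tangent_atlas A"
  then obtain c where c: "c \<in> A" "k = tchart A c" by (auto simp: tangent_atlas_tchart)
  show "inj_on (snd k) (fst k)" using inj_tchart c by simp
  show "open (snd k ` fst k)" using tchart_image[OF c(1) order_refl] open_chart_image[OF c(1)] c
    by (simp add: open_Times)
  fix k' assume "k' \<in> tangent_atlas A"
  then obtain c' where c': "c' \<in> A" "k' = tchart A c'" by (auto simp: tangent_atlas_tchart)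
  let ?O = "snd c ` (fst c \<inter> fst c')"
  have im: "snd k ` (fst k \<inter> fst k') = ?O \<times> UNIV"
    using tchart_image[OF c(1), of "fst c \<inter> fst c'"] c c' by (simp add: Times_Int_Times)
  have O: "open ?O" using open_overlap c c' by blast
  then show o: "open (snd k ` (fst k \<inter> fst k'))" unfolding im by (simp add: open_Times)
  let ?t = "snd c' \<circ> inv_into (fst c) (snd c)"
  have t: "smooth_on ?O ?t" using smooth_transition c c' by blast
  have o': "open (?O \<times> (UNIV :: 'e set))" using O by (simp add: open_Times)
  have 1: "smooth_on (?O \<times> UNIV) (\<lambda>z::'e \<times> 'e. frechet_derivative ?t (at (fst z)) b)" for b
    by (rule smooth_on_compose[OF o' O smooth_on_frechet[OF t] smooth_on_bounded_linear[OF bounded_linear_fst]]) auto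
  have 2: "smooth_on (?O \<times> UNIV) (\<lambda>z::'e \<times> 'e. \<Sum>b\<in>Basis. (snd z \<bullet> b) *\<^sub>R frechet_derivative ?t (at (fst z)) b)"
    by (intro smooth_on_sum[OF o'] smooth_on_bilinear[OF o' bounded_bilinear_scaleR] 1)
      (auto intro!: smooth_on_bounded_linear bounded_linear_intros)
  have 3: "smooth_on (?O \<times> UNIV) (\<lambda>z::'e \<times> 'e. (?t (fst z),
      \<Sum>b\<in>Basis. (snd z \<bullet> b) *\<^sub>R frechet_derivative ?t (at (fst z)) b))"
    by (intro smooth_on_Pair[OF o'] 2 smooth_on_compose[OF o' O t])
      (auto intro!: smooth_on_bounded_linear bounded_linear_fst)
  show "smooth_on (snd k ` (fst k \<inter> fst k')) (snd k' \<circ> inv_into (fst k) (snd k))"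
    unfolding im
  proof (rule smooth_on_cong_open[OF o' _ 3])
    fix z :: "'e \<times> 'e" assume "z \<in> ?O \<times> UNIV"
    then obtain q y where z: "z = (snd c q, y)" "q \<in> fst c" "q \<in> fst c'" by (cases z) auto
    have "coord_change c c' q y = (\<Sum>b\<in>Basis. (y \<bullet> b) *\<^sub>R coord_change c c' q b)"
      using linear_coord_change c c' z by (intro linear_expand_Basis) auto
    then show "(?t (fst z), \<Sum>b\<in>Basis. (snd z \<bullet> b) *\<^sub>R frechet_derivative ?t (at (fst z)) b) =
       (snd k' \<circ> inv_into (fst k) (snd k)) z"
      using tchart_transition[OF c(1) c'(1) z(2,3)] c c' z by (simp add: coord_change_def)
  qed
qed

lemma tchart_mem: "c \<in> A \<Longrightarrow> tchart A c \<in> tangent_atlas A"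
  by (simp add: tangent_atlas_tchart)

text \<open>The local vector field with components \<open>\<xi>\<close> in the chart \<open>c\<close>; its values are expressed in the preferred charts.
In the converse direction, \<open>field_rep\<close> reads off the components of a field.\<close>

definition chart_field :: "('a, 'e) chart \<Rightarrow> ('e \<Rightarrow> 'e) \<Rightarrow> 'a \<Rightarrow> 'e" where
  "chart_field c \<xi> q = coord_change c (chart_at A q) q (\<xi> (snd c q))"

definition field_rep :: "('a, 'e) chart \<Rightarrow> ('a \<Rightarrow> 'e) \<Rightarrow> 'e \<Rightarrow> 'e" where
  "field_rep c X x = (let q = inv_into (fst c) (snd c) x in coord_change (chart_at A q) c q (X q))"

lemma field_rep_at: "c \<in> A \<Longrightarrow> q \<in> fst c \<Longrightarrow> field_rep c X (snd c q) = coord_change (chart_at A q) c q (X q)"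
  by (simp add: field_rep_def)

lemma field_rep_chart_field: "c \<in> A \<Longrightarrow> q \<in> fst c \<Longrightarrow> field_rep c (chart_field c \<xi>) (snd c q) = \<xi> (snd c q)"
  using chart_at_of_chart[of c q] by (simp add: field_rep_at chart_field_def coord_change_inverse)

lemma chart_field_field_rep: "c \<in> A \<Longrightarrow> q \<in> fst c \<Longrightarrow> chart_field c (field_rep c X) q = X q"
  using chart_at_of_chart[of c q] by (simp add: field_rep_at chart_field_def coord_change_inverse)

lemma chart_field_at: "p \<in> carrier_of A \<Longrightarrow> chart_field (chart_at A p) \<xi> p = \<xi> (snd (chart_at A p) p)"
  using chart_at[of p] by (simp add: chart_field_def coord_change_self)

lemma open_chart_field_domain:
  assumes "openin (manifold_topology A) W" "c \<in> A" "c' \<in> A"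
  shows "open (snd c ` (W \<inter> fst c \<inter> fst c'))"
proof -
  have "snd c ` (W \<inter> fst c \<inter> fst c') = snd c ` (W \<inter> fst c) \<inter> snd c ` (fst c \<inter> fst c')"
    using image_chart_Int[of c "W \<inter> fst c" "fst c \<inter> fst c'"] assms by (auto simp: Int_ac)
  moreover have "open (snd c ` (W \<inter> fst c))" using assms openin_iff by blast
  ultimately show ?thesis using open_Int open_overlap[OF assms(2,3)] by metis
qed

lemma smooth_chart_field:
  assumes c: "c \<in> A" and W: "openin (manifold_topology A) W" "W \<subseteq> fst c" and \<xi>: "smooth_on (snd c ` W) \<xi>"
  shows "smooth_vector_field A W (chart_field c \<xi>)"
  unfolding smooth_vector_field_def smooth_map_iff
proof (intro conjI ballI)
  show "(\<lambda>p. (p, chart_field c \<xi> p)) ` W \<subseteq> carrier_of (tangent_atlas A)"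
    using W carrierI[OF c] by (auto simp: carrier_tangent_atlas simp del: split_paired_All)
  fix c1 k assume c1: "c1 \<in> A" and "k \<in> tangent_atlas A"
  then obtain c2 where c2: "c2 \<in> A" "k = tchart A c2" by (auto simp: tangent_atlas_tchart)
  let ?F = "\<lambda>p. (p, chart_field c \<xi> p)"
  let ?O = "snd c1 ` (W \<inter> fst c1 \<inter> fst c2)"
  have dom: "W \<inter> fst c1 \<inter> ?F -` fst k = W \<inter> fst c1 \<inter> fst c2" using c2 by auto
  have O: "open ?O" by (rule open_chart_field_domain[OF W(1) c1 c2(1)])
  then show "open (snd c1 ` (W \<inter> fst c1 \<inter> ?F -` fst k))" unfolding dom .
  let ?t = "\<lambda>c c'. snd c' \<circ> inv_into (fst c) (snd c)"
  let ?O2 = "snd c ` (W \<inter> fst c \<inter> fst c2)"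
  have O2: "open ?O2" by (rule open_chart_field_domain[OF W(1) c c2(1)])
  have t2: "smooth_on ?O2 (?t c c2)" "smooth_on ?O2 \<xi>"
    using smooth_transition[OF c c2(1)] \<xi> by (auto intro: smooth_on_subset)
  have t1: "smooth_on ?O (?t c1 c)" "smooth_on ?O (?t c1 c2)"
    using smooth_transition[OF c1 c] smooth_transition[OF c1 c2(1)] W(2) by (auto intro: smooth_on_subset)
  have "smooth_on ?O (\<lambda>x. (?t c1 c2 x, (\<lambda>y. frechet_derivative (?t c c2) (at y) (\<xi> y)) (?t c1 c x)))"
  proof (intro smooth_on_Pair[OF O t1(2)] smooth_on_compose[OF O O2 _ t1(1)] smooth_on_frechet_apply[OF O2] t2)
    show "?t c1 c ` ?O \<subseteq> ?O2" using c1 W(2) by auto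
  qed
  then show "smooth_on (snd c1 ` (W \<inter> fst c1 \<inter> ?F -` fst k)) (snd k \<circ> ?F \<circ> inv_into (fst c1) (snd c1))"
    unfolding dom
  proof (rule smooth_on_cong_open[OF O, rotated])
    fix x assume "x \<in> ?O"
    then obtain q where q: "q \<in> W" "q \<in> fst c1" "q \<in> fst c2" "x = snd c1 q" by auto
    have "q \<in> fst c" using q W by blast
    then show "(?t c1 c2 x, frechet_derivative (?t c c2) (at (?t c1 c x)) (\<xi> (?t c1 c x))) =
      (snd k \<circ> ?F \<circ> inv_into (fst c1) (snd c1)) x"
      using q c1 c2 c chart_at_of_chart[of c q]
        coord_change_trans[of c "chart_at A q" c2 q "\<xi> (snd c q)"]
      by (simp add: snd_tchart chart_field_def) (simp add: coord_change_def)
  qed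
qed (fact W)

lemma smooth_field_rep:
  assumes X: "smooth_vector_field A W X" and c: "c \<in> A"
  shows "smooth_on (snd c ` (W \<inter> fst c)) (field_rep c X)" and "open (snd c ` (W \<inter> fst c))"
proof -
  have dom: "W \<inter> fst c \<inter> (\<lambda>p. (p, X p)) -` fst (tchart A c) = W \<inter> fst c" by auto
  have *: "open (snd c ` (W \<inter> fst c))"
    "smooth_on (snd c ` (W \<inter> fst c)) (snd (tchart A c) \<circ> (\<lambda>p. (p, X p)) \<circ> inv_into (fst c) (snd c))"
  proof -
    have "\<forall>k\<in>tangent_atlas A. open (snd c ` (W \<inter> fst c \<inter> (\<lambda>p. (p, X p)) -` fst k)) \<and>
      smooth_on (snd c ` (W \<inter> fst c \<inter> (\<lambda>p. (p, X p)) -` fst k)) (snd k \<circ> (\<lambda>p. (p, X p)) \<circ> inv_into (fst c) (snd c))"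
      using X c unfolding smooth_vector_field_def smooth_map_iff by blast
    from bspec[OF this tchart_mem[OF c]] show "open (snd c ` (W \<inter> fst c))"
      "smooth_on (snd c ` (W \<inter> fst c)) (snd (tchart A c) \<circ> (\<lambda>p. (p, X p)) \<circ> inv_into (fst c) (snd c))"
      unfolding dom by blast+
  qed
  show "open (snd c ` (W \<inter> fst c))" by fact
  have "smooth_on (snd c ` (W \<inter> fst c)) (\<lambda>x. snd ((snd (tchart A c) \<circ> (\<lambda>p. (p, X p)) \<circ> inv_into (fst c) (snd c)) x))"
    by (rule smooth_on_linear_compose[OF *(1) bounded_linear_snd *(2)])
  then show "smooth_on (snd c ` (W \<inter> fst c)) (field_rep c X)"
    by (rule smooth_on_cong_open[OF *(1), rotated]) (use c in \<open>auto simp: snd_tchart field_rep_def\<close>)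
qed

text \<open>In coordinates, a section of the tangent bundle is the map \<open>x \<mapsto> (x, \<xi> x)\<close>.\<close>

lemma tangent_map_section:
  assumes X: "smooth_vector_field A W X" and p: "p \<in> W" and c: "c \<in> A" "p \<in> fst c"
  shows "tangent_map A (tangent_atlas A) (\<lambda>q. (q, X q)) p (coord_change c (chart_at A p) p v) =
    coord_change (tchart A c) (chart_at (tangent_atlas A) (p, X p)) (p, X p)
      (v, frechet_derivative (field_rep c X) (at (snd c p)) v)"
proof (rule tangent_map_in_charts[OF smooth smooth_atlas_tangent c tchart_mem[OF c(1)]])
  let ?U = "snd c ` (W \<inter> fst c)"
  show U: "open ?U" by (rule smooth_field_rep(2)[OF X c(1)])
  show pU: "snd c p \<in> ?U" "?U \<subseteq> snd c ` fst c" using p c by auto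
  show "(q, X q) \<in> fst (tchart A c)" if "q \<in> fst c" for q using that by simp
  have "((\<lambda>x. (x, field_rep c X x)) has_derivative (\<lambda>v. (v, frechet_derivative (field_rep c X) (at (snd c p)) v))) (at (snd c p))"
    by (intro has_derivative_Pair has_derivative_ident smooth_on_has_derivative[OF smooth_field_rep(1)[OF X c(1)] pU(1)])
  then show "(snd (tchart A c) \<circ> (\<lambda>q. (q, X q)) \<circ> inv_into (fst c) (snd c) has_derivative
     (\<lambda>v. (v, frechet_derivative (field_rep c X) (at (snd c p)) v))) (at (snd c p))"
    by (rule has_derivative_transform_within_open[OF _ U pU(1)]) (use c in \<open>auto simp: snd_tchart field_rep_def\<close>)
qed

lemma bundle_proj_tchart:
  assumes c: "c \<in> A" "fst u \<in> fst c"
  shows "bundle_proj A u (coord_change (tchart A c) (chart_at (tangent_atlas A) u) u ab) =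
    coord_change c (chart_at A (fst u)) (fst u) (fst ab)"
  unfolding bundle_proj_def
proof (rule tangent_map_in_charts[OF smooth_atlas_tangent smooth tchart_mem[OF c(1)] _ c(1)])
  let ?U = "(snd c ` fst c) \<times> (UNIV :: 'e set)"
  show U: "open ?U" using open_chart_image[OF c(1)] by (simp add: open_Times)
  show "u \<in> fst (tchart A c)" using c by (cases u) auto
  show uU: "snd (tchart A c) u \<in> ?U" using c by (cases u) (auto simp: snd_tchart)
  show "?U \<subseteq> snd (tchart A c) ` fst (tchart A c)" using tchart_image[OF c(1) order_refl] by simp
  show "fst q \<in> fst c" if "q \<in> fst (tchart A c)" for q using that by auto
  have "(fst has_derivative fst) (at (snd (tchart A c) u))"
    by (rule bounded_linear_imp_has_derivative[OF bounded_linear_fst])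
  then show "(snd c \<circ> fst \<circ> inv_into (fst (tchart A c)) (snd (tchart A c)) has_derivative fst) (at (snd (tchart A c) u))"
    by (rule has_derivative_transform_within_open[OF _ U uU])
      (use c in \<open>auto simp: tchart_inv simp del: fst_tchart\<close>)
qed

lemma smooth_atlas_eucl: "smooth_atlas (eucl_atlas :: ('f::euclidean_space, 'f) chart set)"
proof -
  have "(\<lambda>x. x) \<circ> inv_into UNIV (\<lambda>x. x) = (\<lambda>x::'f. x)" by auto
  then show ?thesis
    by (simp add: smooth_atlas_def eucl_atlas_def smooth_on_bounded_linear bounded_linear_ident)
qed

lemma chart_at_eucl [simp]: "chart_at eucl_atlas x = (UNIV, \<lambda>x. x)"
  by (simp add: chart_at_def eucl_atlas_def) (rule some_equality; auto)

lemma coord_change_eucl [simp]: "coord_change (UNIV, \<lambda>x. x) (UNIV, \<lambda>x. x) (x::'f::euclidean_space) v = v"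
proof -
  interpret e: atlas "eucl_atlas :: ('f, 'f) chart set" by unfold_locales (rule smooth_atlas_eucl)
  show ?thesis by (rule e.coord_change_self) (auto simp: eucl_atlas_def)
qed

lemma vertical_lift_tchart:
  assumes p: "fst u \<in> carrier_of A"
  shows "vertical_lift A u z =
    coord_change (tchart A (chart_at A (fst u))) (chart_at (tangent_atlas A) u) u (0, z)"
proof -
  let ?c = "chart_at A (fst u)" and ?e = "(UNIV, \<lambda>x::real. x)"
  have c: "?c \<in> A" "fst u \<in> fst ?c" using chart_at[OF p] by auto
  have cc: "coord_change ?c ?c (fst u) a = a" for a using coord_change_self[OF c] .
  have "tangent_map eucl_atlas (tangent_atlas A) (\<lambda>t::real. (fst u, snd u + t *\<^sub>R z)) 0
      (coord_change ?e (chart_at eucl_atlas (0::real)) 0 1) =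
    coord_change (tchart A ?c) (chart_at (tangent_atlas A) (fst u, snd u + 0 *\<^sub>R z)) (fst u, snd u + 0 *\<^sub>R z) ((\<lambda>t. (0, t *\<^sub>R z)) 1)"
  proof (rule tangent_map_in_charts[OF smooth_atlas_eucl smooth_atlas_tangent _ _ tchart_mem[OF c(1)], where U=UNIV])
    show "?e \<in> eucl_atlas" by (simp add: eucl_atlas_def)
    have [simp]: "inv_into UNIV (\<lambda>x::real. x) = (\<lambda>x. x)" by auto
    have "((\<lambda>t. (snd ?c (fst u), snd u + t *\<^sub>R z)) has_derivative (\<lambda>t. (0, t *\<^sub>R z))) (at 0)"
      by (auto intro!: derivative_eq_intros)
    then show "(snd (tchart A ?c) \<circ> (\<lambda>t. (fst u, snd u + t *\<^sub>R z)) \<circ> inv_into (fst ?e) (snd ?e) has_derivative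
        (\<lambda>t. (0, t *\<^sub>R z))) (at (snd ?e 0))"
      by (simp add: snd_tchart o_def cc)
  qed (use c in auto)
  then show ?thesis by (simp add: vertical_lift_def)
qed

end

section \<open>The Levi-Civita connection in a chart\<close>

locale riemannian = atlas A for A :: "('a, 'e::euclidean_space) chart set" +
  fixes g :: "'a \<Rightarrow> 'e \<Rightarrow> 'e \<Rightarrow> real" and D :: "('a, 'e) connection"
  assumes metric: "riemannian_metric A g" and levi: "levi_civita A g D"
begin

lemma conn: "affine_connection A D"
  using levi by (simp add: levi_civita_def)

lemma conn_linear: "smooth_vector_field A W X \<Longrightarrow> p \<in> W \<Longrightarrow> linear (\<lambda>v. D p v X)"
  by (rule conn[unfolded affine_connection_def, THEN conjunct1, rule_format])

lemma conn_add:
  "smooth_vector_field A W X \<Longrightarrow> smooth_vector_field A W Y \<Longrightarrow> p \<in> W \<Longrightarrow>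
     D p v (\<lambda>q. X q + Y q) = D p v X + D p v Y"
  by (rule conn[unfolded affine_connection_def, THEN conjunct2, THEN conjunct1, rule_format])

lemma conn_scale:
  "smooth_function A W f \<Longrightarrow> smooth_vector_field A W X \<Longrightarrow> p \<in> W \<Longrightarrow>
     D p v (\<lambda>q. f q *\<^sub>R X q) = differential A f p v *\<^sub>R X p + f p *\<^sub>R D p v X"
  by (rule conn[unfolded affine_connection_def, THEN conjunct2, THEN conjunct2, THEN conjunct1, rule_format])

lemma conn_local:
  "smooth_vector_field A W X \<Longrightarrow> (\<And>q. q \<in> W \<Longrightarrow> X q = Y q) \<Longrightarrow> p \<in> W \<Longrightarrow> D p v X = D p v Y"
  by (rule conn[unfolded affine_connection_def, THEN conjunct2, THEN conjunct2, THEN conjunct2, THEN conjunct1, rule_format])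

lemma inner_g: "p \<in> carrier_of A \<Longrightarrow> inner_product (g p)"
  using metric by (simp add: riemannian_metric_def)

lemma linear_g: "p \<in> carrier_of A \<Longrightarrow> linear (g p x)" and linear_g_left: "p \<in> carrier_of A \<Longrightarrow> linear (\<lambda>x. g p x y)"
  and g_sym: "p \<in> carrier_of A \<Longrightarrow> g p x y = g p y x"
  using inner_g[of p] by (auto simp: inner_product_def bilinear_def)

lemma chart_field_linear_coord:
  "c \<in> A \<Longrightarrow> q \<in> fst c \<Longrightarrow> linear (coord_change c (chart_at A q) q)"
  using linear_coord_change chart_at_of_chart by blast

lemma smooth_function_chart:
  assumes c: "c \<in> A" and W: "openin (manifold_topology A) W" "W \<subseteq> fst c" and h: "smooth_on (snd c ` W) h"
  shows "smooth_function A W (\<lambda>q. h (snd c q))"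
  unfolding smooth_function_def smooth_map_iff
proof (intro conjI ballI)
  fix c1 and k :: "(real, real) chart" assume c1: "c1 \<in> A" and "k \<in> eucl_atlas"
  then have k: "k = (UNIV, \<lambda>x. x)" by (simp add: eucl_atlas_def)
  have dom: "W \<inter> fst c1 \<inter> (\<lambda>q. h (snd c q)) -` fst k = W \<inter> fst c1" by (simp add: k)
  let ?O = "snd c1 ` (W \<inter> fst c1)"
  have O: "open ?O" using W c1 by (simp add: openin_iff)
  then show "open (snd c1 ` (W \<inter> fst c1 \<inter> (\<lambda>q. h (snd c q)) -` fst k))" unfolding dom .
  have "W \<inter> fst c = W" using W by blast
  then have OW: "open (snd c ` W)" using W c unfolding openin_iff by metis
  have t: "smooth_on ?O (snd c \<circ> inv_into (fst c1) (snd c1))"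
    by (rule smooth_on_subset[OF smooth_transition[OF c1 c]]) (use W in auto)
  have "smooth_on ?O (\<lambda>x. h ((snd c \<circ> inv_into (fst c1) (snd c1)) x))"
    by (rule smooth_on_compose[OF O OW h t]) (use c1 in auto)
  then show "smooth_on (snd c1 ` (W \<inter> fst c1 \<inter> (\<lambda>q. h (snd c q)) -` fst k))
      (snd k \<circ> (\<lambda>q. h (snd c q)) \<circ> inv_into (fst c1) (snd c1))"
    unfolding dom by (simp add: k o_def)
qed (use W in \<open>auto simp: carrier_of_def eucl_atlas_def\<close>)

lemma open_chart_image_subset:
  assumes "c \<in> A" "openin (manifold_topology A) W" "W \<subseteq> fst c"
  shows "open (snd c ` W)"
proof -
  have "W \<inter> fst c = W" using assms by blast
  then show ?thesis using assms unfolding openin_iff by metis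
qed

lemma differential_chart:
  assumes p: "p \<in> carrier_of A" and c: "c = chart_at A p" and W: "open (snd c ` W)" "p \<in> W" "W \<subseteq> fst c"
    and f: "\<And>q. q \<in> W \<Longrightarrow> f q = h (snd c q)" and h: "h differentiable (at (snd c p))"
  shows "differential A f p v = frechet_derivative h (at (snd c p)) v"
proof -
  have cA: "c \<in> A" using chart_at[OF p] c by simp
  have "(h has_derivative frechet_derivative h (at (snd c p))) (at (snd c p))"
    using h by (simp add: frechet_derivative_works)
  then have "((\<lambda>x. x) \<circ> f \<circ> inv_into (fst c) (snd c) has_derivative frechet_derivative h (at (snd c p))) (at (snd c p))"
  proof (rule has_derivative_transform_within_open[OF _ W(1)])
    fix x assume "x \<in> snd c ` W"
    then obtain q where "q \<in> W" "x = snd c q" by blast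
    moreover have "q \<in> fst c" using \<open>q \<in> W\<close> W by blast
    ultimately show "h x = ((\<lambda>x. x) \<circ> f \<circ> inv_into (fst c) (snd c)) x" using cA f by simp
  qed (use W in auto)
  then show ?thesis
    unfolding differential_def tangent_map_def Let_def c[symmetric]
    by (simp add: frechet_derivative_at[symmetric])
qed

text \<open>The Christoffel symbols at \<open>p\<close>, in the preferred chart there, in which tangent vectors at \<open>p\<close> are their own
coordinates.\<close>

definition christoffel :: "'a \<Rightarrow> 'e \<Rightarrow> 'e \<Rightarrow> 'e" where
  "christoffel p a b = (\<Sum>k\<in>Basis. (b \<bullet> k) *\<^sub>R D p a (chart_field (chart_at A p) (\<lambda>_. k)))"

lemma smooth_const_field: "c \<in> A \<Longrightarrow> smooth_vector_field A (fst c) (chart_field c (\<lambda>_. k))"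
  by (rule smooth_chart_field) (auto simp: openin_chart smooth_on_const)

lemma linear_christoffel_right: "linear (christoffel p a)"
  unfolding christoffel_def
  by (intro linear_compose_sum ballI linearI) (auto simp: inner_add_left scaleR_add_left)

lemma linear_christoffel_left: "p \<in> carrier_of A \<Longrightarrow> linear (\<lambda>a. christoffel p a b)"
  unfolding christoffel_def using chart_at[of p]
  by (intro linear_compose_sum ballI linear_compose_scale_right conn_linear[OF smooth_const_field]) auto

context
  fixes p W c
  assumes p: "p \<in> W" and W: "openin (manifold_topology A) W" and c_def: "c = chart_at A p" and Wc: "W \<subseteq> fst c"
begin

private lemma pA: "p \<in> carrier_of A" using W p openin_iff by blast
private lemma cA: "c \<in> A" and pc: "p \<in> fst c" using chart_at[OF pA] c_def by auto

lemma conn_chart_field_add: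
  assumes "smooth_on (snd c ` W) \<xi>" "smooth_on (snd c ` W) \<eta>"
  shows "D p v (chart_field c (\<lambda>x. \<xi> x + \<eta> x)) = D p v (chart_field c \<xi>) + D p v (chart_field c \<eta>)"
proof -
  have "smooth_on (snd c ` W) (\<lambda>x. \<xi> x + \<eta> x)"
    using assms by (intro smooth_on_add open_chart_image_subset cA W Wc)
  from smooth_chart_field[OF cA W Wc this]
  have "D p v (chart_field c (\<lambda>x. \<xi> x + \<eta> x)) = D p v (\<lambda>q. chart_field c \<xi> q + chart_field c \<eta> q)"
    by (rule conn_local[OF _ _ p])
      (use Wc in \<open>auto simp: chart_field_def linear_add[OF chart_field_linear_coord[OF cA]]\<close>)
  then show ?thesis
    using conn_add[OF smooth_chart_field[OF cA W Wc assms(1)] smooth_chart_field[OF cA W Wc assms(2)] p] by simp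
qed

lemma conn_chart_field_scale:
  assumes h: "smooth_on (snd c ` W) h" and \<xi>: "smooth_on (snd c ` W) \<xi>"
  shows "D p v (chart_field c (\<lambda>x. h x *\<^sub>R \<xi> x)) =
    frechet_derivative h (at (snd c p)) v *\<^sub>R \<xi> (snd c p) + h (snd c p) *\<^sub>R D p v (chart_field c \<xi>)"
proof -
  have O: "open (snd c ` W)" by (rule open_chart_image_subset[OF cA W Wc])
  have "smooth_on (snd c ` W) (\<lambda>x. h x *\<^sub>R \<xi> x)"
    using h \<xi> by (intro smooth_on_bilinear[OF O bounded_bilinear_scaleR])
  from smooth_chart_field[OF cA W Wc this]
  have "D p v (chart_field c (\<lambda>x. h x *\<^sub>R \<xi> x)) = D p v (\<lambda>q. h (snd c q) *\<^sub>R chart_field c \<xi> q)"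
    by (rule conn_local[OF _ _ p])
      (use Wc in \<open>auto simp: chart_field_def linear_cmul[OF chart_field_linear_coord[OF cA]]\<close>)
  also have "\<dots> = differential A (\<lambda>q. h (snd c q)) p v *\<^sub>R chart_field c \<xi> p + h (snd c p) *\<^sub>R D p v (chart_field c \<xi>)"
    by (rule conn_scale[OF smooth_function_chart[OF cA W Wc h] smooth_chart_field[OF cA W Wc \<xi>] p])
  also have "differential A (\<lambda>q. h (snd c q)) p v = frechet_derivative h (at (snd c p)) v"
    by (rule differential_chart[OF pA c_def O p Wc])
      (use p in \<open>auto intro: smooth_on_differentiable[OF h]\<close>)
  also have "chart_field c \<xi> p = \<xi> (snd c p)" unfolding c_def by (rule chart_field_at[OF pA])
  finally show ?thesis .
qed

text \<open>Apply the Leibniz rule to \<open>\<Sum>\<^sub>k \<xi>\<^sub>k \<partial>\<^sub>k\<close>. The partial sums are again fields given by their components, so each step of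
the induction stays within smooth fields on \<open>W\<close>.\<close>

lemma conn_chart_field:
  assumes \<xi>: "smooth_on (snd c ` W) \<xi>"
  shows "D p v (chart_field c \<xi>) = frechet_derivative \<xi> (at (snd c p)) v + christoffel p v (\<xi> (snd c p))"
proof -
  have O: "open (snd c ` W)" by (rule open_chart_image_subset[OF cA W Wc])
  have \<xi>k: "smooth_on (snd c ` W) (\<lambda>x. \<xi> x \<bullet> k)" for k
    by (intro smooth_on_bilinear[OF O bounded_bilinear_inner] \<xi> smooth_on_const)
  have dk: "frechet_derivative (\<lambda>x. \<xi> x \<bullet> k) (at (snd c p)) v = frechet_derivative \<xi> (at (snd c p)) v \<bullet> k" for k
  proof -
    have "((\<lambda>x. \<xi> x \<bullet> k) has_derivative (\<lambda>v. frechet_derivative \<xi> (at (snd c p)) v \<bullet> k)) (at (snd c p))"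
      using p by (intro has_derivative_inner_left smooth_on_has_derivative[OF \<xi>]) auto
    then show ?thesis using frechet_derivative_at by metis
  qed
  have "D p v (chart_field c (\<lambda>x. \<Sum>k\<in>B. (\<xi> x \<bullet> k) *\<^sub>R k)) =
      (\<Sum>k\<in>B. (frechet_derivative \<xi> (at (snd c p)) v \<bullet> k) *\<^sub>R k + (\<xi> (snd c p) \<bullet> k) *\<^sub>R D p v (chart_field c (\<lambda>_. k)))"
    if "finite B" for B
    using that
  proof (induction B)
    case empty
    have "D p v (chart_field c (\<lambda>x. 0 *\<^sub>R (0::'e))) = 0"
      by (subst conn_chart_field_scale[of "\<lambda>_. 0" "\<lambda>_. 0"]) (simp_all add: smooth_on_const)
    then show ?case by simp
  next
    case (insert k B)
    have "D p v (chart_field c (\<lambda>x. (\<xi> x \<bullet> k) *\<^sub>R k + (\<Sum>k\<in>B. (\<xi> x \<bullet> k) *\<^sub>R k))) =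
       D p v (chart_field c (\<lambda>x. (\<xi> x \<bullet> k) *\<^sub>R k)) + D p v (chart_field c (\<lambda>x. \<Sum>k\<in>B. (\<xi> x \<bullet> k) *\<^sub>R k))"
      by (intro conn_chart_field_add smooth_on_sum[OF O] smooth_on_bilinear[OF O bounded_bilinear_scaleR] \<xi>k smooth_on_const)
    also have "D p v (chart_field c (\<lambda>x. (\<xi> x \<bullet> k) *\<^sub>R k)) =
       (frechet_derivative \<xi> (at (snd c p)) v \<bullet> k) *\<^sub>R k + (\<xi> (snd c p) \<bullet> k) *\<^sub>R D p v (chart_field c (\<lambda>_. k))"
      by (subst conn_chart_field_scale[OF \<xi>k smooth_on_const]) (simp add: dk)
    finally show ?case using insert by simp
  qed
  from this[OF finite_Basis] show ?thesis
    by (simp add: euclidean_representation sum.distrib christoffel_def c_def)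
qed

end

lemma conn_formula:
  assumes X: "smooth_vector_field A W X" and p: "p \<in> W" and c: "c = chart_at A p"
  shows "D p v X = frechet_derivative (field_rep c X) (at (snd c p)) v + christoffel p v (X p)"
proof -
  have W: "openin (manifold_topology A) W" using X by (simp add: smooth_vector_field_def smooth_map_iff)
  have pA: "p \<in> carrier_of A" using W p openin_iff by blast
  have cA: "c \<in> A" and pc: "p \<in> fst c" using chart_at[OF pA] c by auto
  let ?W = "W \<inter> fst c"
  have X': "smooth_vector_field A ?W X"
    using X unfolding smooth_vector_field_def by (rule smooth_map_restrict[OF _ cA])
  have W': "openin (manifold_topology A) ?W" using W openin_chart[OF cA] by blast
  have "D p v X = D p v (chart_field c (field_rep c X))"
    by (rule conn_local[OF X']) (use p pc cA in \<open>auto simp: chart_field_field_rep\<close>)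
  also have "\<dots> = frechet_derivative (field_rep c X) (at (snd c p)) v + christoffel p v (field_rep c X (snd c p))"
    by (rule conn_chart_field[OF _ W' c]) (use p pc smooth_field_rep[OF X cA] in auto)
  also have "field_rep c X (snd c p) = X p"
    using field_rep_at[OF cA pc] coord_change_self[OF cA pc] by (simp add: c)
  finally show ?thesis .
qed

lemma conn_const_field:
  assumes p: "p \<in> carrier_of A"
  shows "D p v (chart_field (chart_at A p) (\<lambda>_. b)) = christoffel p v b"
  using conn_chart_field[of p "fst (chart_at A p)" "chart_at A p" "\<lambda>_. b" v] chart_at[OF p]
  by (simp add: openin_chart smooth_on_const)

text \<open>The bracket of fields with constant components vanishes, and there is no torsion.\<close>

lemma christoffel_sym:
  assumes p: "p \<in> carrier_of A"
  shows "christoffel p a b = christoffel p b a"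
proof -
  let ?c = "chart_at A p" and ?X = "\<lambda>b. chart_field (chart_at A p) (\<lambda>_. b)"
  have c: "?c \<in> A" "p \<in> fst ?c" using chart_at[OF p] by auto
  have Xp: "?X b p = b" for b using chart_field_at[OF p] by simp
  have "frechet_derivative (field_rep ?c (?X b)) (at (snd ?c p)) v = 0" for b v
  proof -
    have "((\<lambda>x. b) has_derivative (\<lambda>v. 0)) (at (snd ?c p))" by simp
    then have "(field_rep ?c (?X b) has_derivative (\<lambda>v. 0)) (at (snd ?c p))"
      by (rule has_derivative_transform_within_open[OF _ open_chart_image[OF c(1)]])
        (use c in \<open>auto simp: field_rep_chart_field\<close>)
    then show ?thesis using frechet_derivative_at by metis
  qed
  then have "lie_bracket A (?X a) (?X b) p = 0"
    unfolding lie_bracket_def Let_def using field_rep_def[abs_def, unfolded Let_def] by simp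
  moreover have "D p (?X a p) (?X b) - D p (?X b p) (?X a) = lie_bracket A (?X a) (?X b) p"
    using levi smooth_const_field[OF c(1)] c(2) unfolding levi_civita_def by blast
  ultimately show ?thesis using conn_const_field[OF p] by (simp add: Xp)
qed

text \<open>The metric in the chart \<open>c\<close>, as a bilinear form depending on the coordinates \<open>y\<close>.\<close>

definition metric_rep :: "('a, 'e) chart \<Rightarrow> 'e \<Rightarrow> 'e \<Rightarrow> 'e \<Rightarrow> real" where
  "metric_rep c y a b = (let q = inv_into (fst c) (snd c) y in g q (chart_field c (\<lambda>_. a) q) (chart_field c (\<lambda>_. b) q))"

lemma metric_rep_at:
  "c \<in> A \<Longrightarrow> q \<in> fst c \<Longrightarrow> metric_rep c (snd c q) a b = g q (coord_change c (chart_at A q) q a) (coord_change c (chart_at A q) q b)"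
  by (simp add: metric_rep_def chart_field_def)

lemma metric_rep_center:
  assumes p: "p \<in> carrier_of A"
  shows "metric_rep (chart_at A p) (snd (chart_at A p) p) a b = g p a b"
  using chart_at[OF p] by (simp add: metric_rep_at coord_change_self)

lemma bilinear_metric_rep:
  assumes c: "c \<in> A" and y: "y \<in> snd c ` fst c"
  shows "bilinear (metric_rep c y)"
proof -
  obtain q where q: "q \<in> fst c" "y = snd c q" using y by blast
  have gq: "linear (g q x)" "linear (\<lambda>x. g q x y)" for x y
    using linear_g linear_g_left carrierI[OF c q(1)] by blast+
  have "linear (coord_change c (chart_at A q) q)" by (rule chart_field_linear_coord[OF c q(1)])
  from linear_compose[OF this gq(1)] linear_compose[OF this gq(2)] show ?thesis
    unfolding bilinear_def q(2) metric_rep_at[OF c q(1), abs_def] by (simp add: o_def)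
qed

lemma smooth_metric_rep:
  assumes c: "c \<in> A"
  shows "smooth_on (snd c ` fst c) (\<lambda>y. metric_rep c y a b)"
proof -
  let ?f = "\<lambda>q. g q (chart_field c (\<lambda>_. a) q) (chart_field c (\<lambda>_. b) q)"
  have "smooth_function A (fst c) ?f"
    using metric smooth_const_field[OF c] unfolding riemannian_metric_def by blast
  then have "\<forall>k\<in>eucl_atlas. smooth_on (snd c ` (fst c \<inter> fst c \<inter> ?f -` fst k)) (snd k \<circ> ?f \<circ> inv_into (fst c) (snd c))"
    using c unfolding smooth_function_def smooth_map_iff by blast
  then have "smooth_on (snd c ` fst c) ((\<lambda>x. x) \<circ> ?f \<circ> inv_into (fst c) (snd c))"
    by (simp add: eucl_atlas_def)
  then show ?thesis
    by (rule smooth_on_cong_open[OF open_chart_image[OF c], rotated]) (use c in \<open>auto simp: metric_rep_def\<close>)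
qed

lemma metric_compatible:
  assumes p: "p \<in> carrier_of A" and c: "c = chart_at A p"
  shows "frechet_derivative (\<lambda>y. metric_rep c y b b') (at (snd c p)) a =
    g p (christoffel p a b) b' + g p b (christoffel p a b')"
proof -
  have cA: "c \<in> A" "p \<in> fst c" using chart_at[OF p] c by auto
  let ?X = "\<lambda>b. chart_field c (\<lambda>_. b)"
  have Xp: "?X b p = b" for b using chart_field_at[OF p] by (simp add: c)
  have "differential A (\<lambda>q. g q (?X b q) (?X b' q)) p a = g p (D p a (?X b)) (?X b' p) + g p (?X b p) (D p a (?X b'))"
    using levi smooth_const_field[OF cA(1)] cA(2) unfolding levi_civita_def by blast
  moreover have "differential A (\<lambda>q. g q (?X b q) (?X b' q)) p a = frechet_derivative (\<lambda>y. metric_rep c y b b') (at (snd c p)) a"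
  proof (rule differential_chart[OF p c open_chart_image[OF cA(1)] cA(2) order_refl])
    show "(\<lambda>y. metric_rep c y b b') differentiable (at (snd c p))"
      by (rule smooth_on_differentiable[OF smooth_metric_rep[OF cA(1)]]) (use cA in auto)
  qed (use cA in \<open>simp add: metric_rep_def\<close>)
  ultimately show ?thesis using conn_const_field[OF p] by (simp add: Xp[unfolded c] c)
qed

section \<open>Horizontal and vertical vectors\<close>

text \<open>From the coordinates induced by the preferred chart at the base point of \<open>u\<close>, in which the splitting takes a
simple form, to the preferred coordinates at \<open>u\<close>, in which tangent vectors of \<open>TM\<close> are represented.\<close>

definition tcoord :: "'a \<times> 'e \<Rightarrow> 'e \<times> 'e \<Rightarrow> 'e \<times> 'e" where
  "tcoord u = coord_change (tchart A (chart_at A (fst u))) (chart_at (tangent_atlas A) u) u"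

context
  fixes u :: "'a \<times> 'e"
  assumes u: "fst u \<in> carrier_of A"
begin

lemma tcoord_charts:
  "tchart A (chart_at A (fst u)) \<in> tangent_atlas A" "u \<in> fst (tchart A (chart_at A (fst u)))"
  "chart_at (tangent_atlas A) u \<in> tangent_atlas A" "u \<in> fst (chart_at (tangent_atlas A) u)"
proof -
  interpret tangent: atlas "tangent_atlas A" by unfold_locales (rule smooth_atlas_tangent)
  show 1: "tchart A (chart_at A (fst u)) \<in> tangent_atlas A" "u \<in> fst (tchart A (chart_at A (fst u)))"
    using chart_at[OF u] by (auto simp: tangent_atlas_tchart mem_Times_iff)
  show "chart_at (tangent_atlas A) u \<in> tangent_atlas A" "u \<in> fst (chart_at (tangent_atlas A) u)"
    using tangent.chart_at_of_chart[OF 1] by auto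
qed

lemma linear_tcoord: "linear (tcoord u)" and inj_tcoord: "inj (tcoord u)" and surj_tcoord: "surj (tcoord u)"
proof -
  interpret tangent: atlas "tangent_atlas A" by unfold_locales (rule smooth_atlas_tangent)
  show "linear (tcoord u)" unfolding tcoord_def using tcoord_charts by (intro tangent.linear_coord_change)
  show "inj (tcoord u)"
    unfolding tcoord_def using tangent.coord_change_inverse[OF tcoord_charts(1,3,2,4)] by (rule inj_on_inverseI)
  show "surj (tcoord u)"
    unfolding tcoord_def using tangent.coord_change_inverse[OF tcoord_charts(3,1,4,2)] by (rule surjI)
qed

lemma bundle_proj_tcoord: "bundle_proj A u (tcoord u (a, b)) = a"
  unfolding tcoord_def using chart_at[OF u] by (simp add: bundle_proj_tchart coord_change_self)

lemma vertical_lift_tcoord: "vertical_lift A u z = tcoord u (0, z)"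
  unfolding tcoord_def by (rule vertical_lift_tchart[OF u])

text \<open>The condition \<open>\<nabla>\<^sub>vX = 0\<close> prescribes the derivative of the components of \<open>X\<close> in the direction \<open>v\<close> as \<open>-\<Gamma>(v, X)\<close>.
Conversely, every vector of this graph is attained, already by a field with affine components.\<close>

lemma horizontal_tcoord: "horizontal A D u = {tcoord u (a, - christoffel (fst u) a (snd u)) | a. True}"
proof -
  obtain p w where pw: "u = (p, w)" by (cases u)
  define c where "c = chart_at A p"
  have p: "p \<in> carrier_of A" using u by (simp add: pw)
  have c: "c \<in> A" "p \<in> fst c" using chart_at[OF p] by (auto simp: c_def)
  have tm: "tangent_map A (tangent_atlas A) (\<lambda>q. (q, X q)) p v =
      tcoord u (v, frechet_derivative (field_rep c X) (at (snd c p)) v)"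
    if "smooth_vector_field A W X" "p \<in> W" "X p = w" for X W v
    using tangent_map_section[OF that(1,2) c, of v] coord_change_self[OF c]
    by (simp add: tcoord_def pw that(3) c_def)
  show ?thesis
  proof (intro equalityI subsetI)
    fix z assume "z \<in> horizontal A D u"
    then obtain X v W where X: "smooth_vector_field A W X" "p \<in> W" "X p = w" "D p v X = 0"
      and z: "z = tangent_map A (tangent_atlas A) (\<lambda>q. (q, X q)) p v"
      unfolding horizontal_def pw by auto
    have "frechet_derivative (field_rep c X) (at (snd c p)) v = - christoffel p v w"
      using conn_formula[OF X(1,2) c_def, of v] X by (simp add: eq_neg_iff_add_eq_0)
    then show "z \<in> {tcoord u (a, - christoffel (fst u) a (snd u)) | a. True}"
      using tm[OF X(1-3)] z pw by auto
  next
    fix z assume "z \<in> {tcoord u (a, - christoffel (fst u) a (snd u)) | a. True}"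
    then obtain a where z: "z = tcoord u (a, - christoffel p a w)" by (auto simp: pw)
    \<comment> \<open>The components of the field are \<open>w - \<Gamma>(x - x\<^sub>0, w)\<close>, where \<open>x\<^sub>0\<close> are the coordinates of \<open>p\<close>.\<close>
    define L where "L = (\<lambda>x. - christoffel p x w)"
    have "linear L" unfolding L_def by (intro linear_compose_neg linear_christoffel_left p)
    then have L: "bounded_linear L" by (simp add: linear_conv_bounded_linear)
    define \<xi> where "\<xi> x = (w - L (snd c p)) + L x" for x
    have \<xi>s: "smooth_on S \<xi>" if "open S" for S
      unfolding \<xi>_def using that L by (intro smooth_on_add smooth_on_const smooth_on_bounded_linear)
    have d\<xi>: "(\<xi> has_derivative L) (at x)" for x
      unfolding \<xi>_def using bounded_linear_imp_has_derivative[OF L] by (auto intro!: derivative_eq_intros)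
    let ?X = "chart_field c \<xi>"
    have X: "smooth_vector_field A (fst c) ?X"
      by (intro smooth_chart_field c openin_chart order_refl \<xi>s open_chart_image)
    have Xp: "?X p = w" using chart_field_at[OF p] by (simp add: c_def \<xi>_def)
    have "(field_rep c ?X has_derivative L) (at (snd c p))"
      by (rule has_derivative_transform_within_open[OF d\<xi> open_chart_image[OF c(1)]])
        (use c in \<open>auto simp: field_rep_chart_field\<close>)
    then have fd: "frechet_derivative (field_rep c ?X) (at (snd c p)) = L" using frechet_derivative_at by metis
    have "D p a ?X = 0" using conn_formula[OF X c(2) c_def, of a] by (simp add: fd Xp L_def)
    moreover have "z = tangent_map A (tangent_atlas A) (\<lambda>q. (q, ?X q)) p a"
      using tm[OF X c(2) Xp, of a] by (simp add: z fd L_def)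
    ultimately show "z \<in> horizontal A D u"
      unfolding horizontal_def pw using X c(2) Xp by (auto intro!: exI[of _ ?X])
  qed
qed

lemma vertical_part_tcoord: "vertical_part A D u (tcoord u (a, b)) = b + christoffel (fst u) a (snd u)"
proof -
  have "tcoord u (a, b) - vertical_lift A u z \<in> horizontal A D u \<longleftrightarrow> z = b + christoffel (fst u) a (snd u)" for z
  proof -
    have "tcoord u (a, b) - vertical_lift A u z = tcoord u (a, b - z)"
      using linear_diff[OF linear_tcoord, of "(a, b)" "(0, z)"] by (simp add: vertical_lift_tcoord)
    then have "tcoord u (a, b) - vertical_lift A u z \<in> horizontal A D u \<longleftrightarrow> b - z = - christoffel (fst u) a (snd u)"
      using inj_tcoord by (auto simp: horizontal_tcoord inj_eq)
    then show ?thesis by (auto simp: algebra_simps)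
  qed
  then show ?thesis unfolding vertical_part_def by simp
qed

lemma christoffel_zero [simp]: "christoffel (fst u) 0 b = 0"
  using linear_0[OF linear_christoffel_left[OF u]] .

lemma bundle_proj_mirror: "bundle_proj A u (mirror A u w) = 0"
  and vertical_part_mirror: "vertical_part A D u (mirror A u w) = bundle_proj A u w"
  and vertical_part_canonical: "vertical_part A D u (canonical_field A u) = snd u"
  and bundle_proj_canonical: "bundle_proj A u (canonical_field A u) = 0"
  by (simp_all add: mirror_def canonical_field_def vertical_lift_tcoord bundle_proj_tcoord vertical_part_tcoord)

lemma linear_vertical_part: "linear (vertical_part A D u)"
proof -
  have inv: "linear (inv (tcoord u))" by (intro inj_linear_imp_inv_linear linear_tcoord inj_tcoord)
  have w: "tcoord u (inv (tcoord u) w) = w" for w using surj_tcoord by (simp add: surj_f_inv_f)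
  have "vertical_part A D u w = snd (inv (tcoord u) w) + christoffel (fst u) (fst (inv (tcoord u) w)) (snd u)" for w
    using vertical_part_tcoord[of "fst (inv (tcoord u) w)" "snd (inv (tcoord u) w)"] by (simp add: w)
  then have "vertical_part A D u = (\<lambda>w. snd (inv (tcoord u) w) + christoffel (fst u) (fst (inv (tcoord u) w)) (snd u))"
    by (rule ext)
  moreover have "linear (\<lambda>w. snd (inv (tcoord u) w) + christoffel (fst u) (fst (inv (tcoord u) w)) (snd u))"
    using linear_compose[OF inv bounded_linear.linear[OF bounded_linear_snd]]
      linear_compose[OF linear_compose[OF inv bounded_linear.linear[OF bounded_linear_fst]] linear_christoffel_left[OF u, of "snd u"]]
    by (intro linear_compose_add) (simp_all add: o_def)
  ultimately show ?thesis by simp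
qed

lemma theta_eq: "theta A g D u v = g (fst u) (snd u) (bundle_proj A u (v 0))"
  using linear_0[OF linear_g[OF u]] linear_0[OF linear_g_left[OF u]]
  by (simp add: theta_def sasaki_def bundle_proj_canonical bundle_proj_mirror vertical_part_canonical vertical_part_mirror)

end

end

text \<open>Metric compatibility along a map \<open>\<zeta>\<close> into \<open>M\<close>, for vector fields \<open>\<eta>\<close> and \<open>\<kappa>\<close> along it: each of them is
differentiated covariantly.\<close>

lemma (in riemannian) metric_rep_has_derivative:
  fixes \<zeta> \<eta> \<kappa> :: "'k::euclidean_space \<Rightarrow> 'e"
  assumes p: "p \<in> carrier_of A" and c: "c = chart_at A p"
    and U: "open U" "x \<in> U" "\<zeta> ` U \<subseteq> snd c ` fst c" and \<zeta>x: "\<zeta> x = snd c p"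
    and \<zeta>: "(\<zeta> has_derivative \<zeta>') (at x)" and \<eta>: "(\<eta> has_derivative \<eta>') (at x)" and \<kappa>: "(\<kappa> has_derivative \<kappa>') (at x)"
  shows "((\<lambda>y. metric_rep c (\<zeta> y) (\<eta> y) (\<kappa> y)) has_derivative
    (\<lambda>h. g p (\<eta>' h + christoffel p (\<zeta>' h) (\<eta> x)) (\<kappa> x) + g p (\<eta> x) (\<kappa>' h + christoffel p (\<zeta>' h) (\<kappa> x)))) (at x)"
proof -
  have cA: "c \<in> A" "p \<in> fst c" using chart_at[OF p] c by auto
  have bil: "bilinear (g p)" using inner_g[OF p] by (simp add: inner_product_def)
  have expand: "B a b = (\<Sum>i\<in>Basis. \<Sum>j\<in>Basis. (a \<bullet> i) * (b \<bullet> j) * B i j)"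
    if B: "bilinear B" for B :: "'e \<Rightarrow> 'e \<Rightarrow> real" and a b
  proof -
    have "B a b = (\<Sum>i\<in>Basis. (a \<bullet> i) *\<^sub>R B i b)"
      using B unfolding bilinear_def by (intro linear_expand_Basis[of "\<lambda>a. B a b"]) auto
    also have "\<dots> = (\<Sum>i\<in>Basis. (a \<bullet> i) *\<^sub>R (\<Sum>j\<in>Basis. (b \<bullet> j) *\<^sub>R B i j))"
      using B unfolding bilinear_def by (intro sum.cong refl arg_cong2[where f=scaleR] linear_expand_Basis) auto
    finally show ?thesis by (simp add: sum_distrib_left mult.assoc)
  qed
  let ?DG = "\<lambda>i j h. g p (christoffel p h i) j + g p i (christoffel p h j)"
  have G: "((\<lambda>y. metric_rep c (\<zeta> y) i j) has_derivative (\<lambda>h. ?DG i j (\<zeta>' h))) (at x)" for i j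
  proof (rule has_derivative_compose[OF \<zeta>])
    have "((\<lambda>y. metric_rep c y i j) has_derivative frechet_derivative (\<lambda>y. metric_rep c y i j) (at (snd c p))) (at (snd c p))"
      by (rule smooth_on_has_derivative[OF smooth_metric_rep[OF cA(1)]]) (use cA in auto)
    then show "((\<lambda>y. metric_rep c y i j) has_derivative (\<lambda>h. ?DG i j h)) (at (\<zeta> x))"
      unfolding \<zeta>x using metric_compatible[OF p c] by (metis (no_types, lifting) ext)
  qed
  have "((\<lambda>y. \<Sum>i\<in>Basis. \<Sum>j\<in>Basis. (\<eta> y \<bullet> i) * (\<kappa> y \<bullet> j) * metric_rep c (\<zeta> y) i j) has_derivative
    (\<lambda>h. \<Sum>i\<in>Basis. \<Sum>j\<in>Basis. (\<eta> x \<bullet> i) * (\<kappa> x \<bullet> j) * ?DG i j (\<zeta>' h) +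
       ((\<eta> x \<bullet> i) * (\<kappa>' h \<bullet> j) + (\<eta>' h \<bullet> i) * (\<kappa> x \<bullet> j)) * metric_rep c (\<zeta> x) i j)) (at x)"
    by (intro has_derivative_sum has_derivative_mult has_derivative_inner_left \<eta> \<kappa> G)
  moreover have "(\<Sum>i\<in>Basis. \<Sum>j\<in>Basis. (\<eta> x \<bullet> i) * (\<kappa> x \<bullet> j) * ?DG i j (\<zeta>' h) +
       ((\<eta> x \<bullet> i) * (\<kappa>' h \<bullet> j) + (\<eta>' h \<bullet> i) * (\<kappa> x \<bullet> j)) * metric_rep c (\<zeta> x) i j) =
    g p (\<eta>' h + christoffel p (\<zeta>' h) (\<eta> x)) (\<kappa> x) + g p (\<eta> x) (\<kappa>' h + christoffel p (\<zeta>' h) (\<kappa> x))" for h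
  proof -
    have "bilinear (\<lambda>i j. g p (christoffel p (\<zeta>' h) i) j)" "bilinear (\<lambda>i j. g p i (christoffel p (\<zeta>' h) j))"
      using linear_compose[OF linear_christoffel_right linear_g_left[OF p]] linear_g[OF p] linear_g_left[OF p]
        linear_compose[OF linear_christoffel_right linear_g[OF p]]
      by (simp_all add: bilinear_def o_def)
    note e = expand[OF this(1)] expand[OF this(2)] expand[OF bil]
    have mc: "metric_rep c (\<zeta> x) i j = g p i j" for i j unfolding \<zeta>x c by (rule metric_rep_center[OF p])
    have add: "g p (a + b) d = g p a d + g p b d" "g p d (a + b) = g p d a + g p d b" for a b d
      using linear_add[OF linear_g[OF p]] linear_add[OF linear_g_left[OF p]] by auto
    show ?thesis
      unfolding add mc
      by (subst e(1)[of "\<eta> x" "\<kappa> x"], subst e(2)[of "\<eta> x" "\<kappa> x"], subst e(3)[of "\<eta>' h"], subst e(3)[of "\<eta> x"])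
        (simp add: sum.distrib[symmetric] algebra_simps)
  qed
  ultimately have "((\<lambda>y. \<Sum>i\<in>Basis. \<Sum>j\<in>Basis. (\<eta> y \<bullet> i) * (\<kappa> y \<bullet> j) * metric_rep c (\<zeta> y) i j) has_derivative
    (\<lambda>h. g p (\<eta>' h + christoffel p (\<zeta>' h) (\<eta> x)) (\<kappa> x) + g p (\<eta> x) (\<kappa>' h + christoffel p (\<zeta>' h) (\<kappa> x)))) (at x)"
    by simp
  then show ?thesis
  proof (rule has_derivative_transform_within_open[OF _ U(1,2)])
    fix y assume "y \<in> U"
    then have "bilinear (metric_rep c (\<zeta> y))" using U(3) by (intro bilinear_metric_rep cA) auto
    then show "(\<Sum>i\<in>Basis. \<Sum>j\<in>Basis. (\<eta> y \<bullet> i) * (\<kappa> y \<bullet> j) * metric_rep c (\<zeta> y) i j) = metric_rep c (\<zeta> y) (\<eta> y) (\<kappa> y)"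
      by (rule expand[symmetric])
  qed
qed

section \<open>The tangent sphere bundle\<close>

locale tangent_sphere = riemannian A g D
  for A :: "('a, 'e::euclidean_space) chart set" and g D +
  fixes AS :: "('a \<times> 'e, 'k::euclidean_space) chart set" and s :: real
  assumes s_pos: "s > 0" and emb: "embedded_submanifold AS (tangent_atlas A) (sphere_bundle A g s)"
begin

lemma atlas_AS: "smooth_atlas AS" and carrier_AS: "carrier_of AS = sphere_bundle A g s"
  and inj_incl: "u \<in> sphere_bundle A g s \<Longrightarrow> inj (sphere_incl A AS u)"
  and smooth_incl: "smooth_map AS (tangent_atlas A) (sphere_bundle A g s) (\<lambda>u. u)"
  using emb unfolding embedded_submanifold_def sphere_incl_def by auto

lemma sphere_point:
  assumes "u \<in> sphere_bundle A g s"
  shows "fst u \<in> carrier_of A" "g (fst u) (snd u) (snd u) = s\<^sup>2"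
proof -
  show "fst u \<in> carrier_of A" using assms by (auto simp: sphere_bundle_def)
  have "sqrt (g (fst u) (snd u) (snd u)) = s" using assms by (auto simp: sphere_bundle_def)
  then show "g (fst u) (snd u) (snd u) = s\<^sup>2" using s_pos by (metis less_eq_real_def not_less real_sqrt_lt_0_iff real_sqrt_pow2)
qed

text \<open>A chart \<open>k\<close> of the sphere bundle and a chart \<open>c\<close> of the base express the inclusion into \<open>TM\<close> by two functions, the coordinates of
the base point and the components of the vector. They are smooth on \<open>coords_dom k c\<close>.\<close>

definition base_coords :: "('a \<times> 'e, 'k) chart \<Rightarrow> ('a, 'e) chart \<Rightarrow> 'k \<Rightarrow> 'e" where
  "base_coords k c x = fst (snd (tchart A c) (inv_into (fst k) (snd k) x))"

definition fibre_coords :: "('a \<times> 'e, 'k) chart \<Rightarrow> ('a, 'e) chart \<Rightarrow> 'k \<Rightarrow> 'e" where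
  "fibre_coords k c x = snd (snd (tchart A c) (inv_into (fst k) (snd k) x))"

definition coords_dom :: "('a \<times> 'e, 'k) chart \<Rightarrow> ('a, 'e) chart \<Rightarrow> 'k set" where
  "coords_dom k c = snd k ` (fst k \<inter> fst c \<times> UNIV)"

context
  fixes k :: "('a \<times> 'e, 'k) chart" and c :: "('a, 'e) chart"
  assumes k: "k \<in> AS" and c: "c \<in> A"
begin

interpretation AS: atlas AS by unfold_locales (rule atlas_AS)

lemma chart_in_sphere: "fst k \<subseteq> sphere_bundle A g s"
  using AS.carrierI[OF k] carrier_AS by blast

lemma open_coords_dom: "open (coords_dom k c)" and smooth_base_coords: "smooth_on (coords_dom k c) (base_coords k c)" and smooth_fibre_coords: "smooth_on (coords_dom k c) (fibre_coords k c)"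
proof -
  have d: "sphere_bundle A g s \<inter> fst k \<inter> (\<lambda>u. u) -` fst (tchart A c) = fst k \<inter> fst c \<times> UNIV"
    using chart_in_sphere by auto
  have "\<forall>t\<in>tangent_atlas A. open (snd k ` (sphere_bundle A g s \<inter> fst k \<inter> (\<lambda>u. u) -` fst t)) \<and>
     smooth_on (snd k ` (sphere_bundle A g s \<inter> fst k \<inter> (\<lambda>u. u) -` fst t)) (snd t \<circ> (\<lambda>u. u) \<circ> inv_into (fst k) (snd k))"
    using smooth_incl k unfolding smooth_map_iff by blast
  from bspec[OF this tchart_mem[OF c]]
  have o: "open (coords_dom k c)" and sm: "smooth_on (coords_dom k c) (snd (tchart A c) \<circ> (\<lambda>u. u) \<circ> inv_into (fst k) (snd k))"
    unfolding d coords_dom_def by blast+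
  show "open (coords_dom k c)" by (rule o)
  show "smooth_on (coords_dom k c) (base_coords k c)" "smooth_on (coords_dom k c) (fibre_coords k c)"
    unfolding base_coords_def[abs_def] fibre_coords_def[abs_def]
    using smooth_on_linear_compose[OF o bounded_linear_fst sm] smooth_on_linear_compose[OF o bounded_linear_snd sm]
    by (simp_all add: o_def)
qed

lemma base_coords_at: "q \<in> fst k \<Longrightarrow> base_coords k c (snd k q) = snd c (fst q)"
  and fibre_coords_at: "q \<in> fst k \<Longrightarrow> fibre_coords k c (snd k q) = coord_change (chart_at A (fst q)) c (fst q) (snd q)"
  using k by (simp_all add: base_coords_def fibre_coords_def snd_tchart case_prod_beta)

lemma in_coords_dom: "q \<in> fst k \<Longrightarrow> fst q \<in> fst c \<Longrightarrow> snd k q \<in> coords_dom k c"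
  by (cases q) (auto simp: coords_dom_def)

lemma base_coords_image: "base_coords k c ` coords_dom k c \<subseteq> snd c ` fst c"
  by (auto simp: coords_dom_def base_coords_at)

lemma sphere_incl_charts:
  assumes q: "q \<in> fst k" "fst q \<in> fst c"
  shows "sphere_incl A AS q (coord_change k (chart_at AS q) q v) =
    coord_change (tchart A c) (chart_at (tangent_atlas A) q) q
      (frechet_derivative (base_coords k c) (at (snd k q)) v, frechet_derivative (fibre_coords k c) (at (snd k q)) v)"
  unfolding sphere_incl_def
proof (rule tangent_map_in_charts[OF atlas_AS smooth_atlas_tangent k q(1) tchart_mem[OF c] open_coords_dom in_coords_dom[OF q]])
  show "coords_dom k c \<subseteq> snd k ` fst k" by (auto simp: coords_dom_def)
  show "q' \<in> fst (tchart A c)" if q': "q' \<in> fst k" "snd k q' \<in> coords_dom k c" for q'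
  proof -
    obtain z where z: "z \<in> fst k" "z \<in> fst c \<times> UNIV" "snd k q' = snd k z" using q'(2) by (auto simp: coords_dom_def)
    then have "q' = z" using inj_onD[OF AS.inj_chart[OF k] z(3) q'(1) z(1)] by simp
    then show ?thesis using z by simp
  qed
  have "((\<lambda>x. (base_coords k c x, fibre_coords k c x)) has_derivative (\<lambda>v. (frechet_derivative (base_coords k c) (at (snd k q)) v,
      frechet_derivative (fibre_coords k c) (at (snd k q)) v))) (at (snd k q))"
    by (intro has_derivative_Pair smooth_on_has_derivative[OF smooth_base_coords] smooth_on_has_derivative[OF smooth_fibre_coords] in_coords_dom q)
  then show "(snd (tchart A c) \<circ> (\<lambda>u. u) \<circ> inv_into (fst k) (snd k) has_derivative
      (\<lambda>v. (frechet_derivative (base_coords k c) (at (snd k q)) v, frechet_derivative (fibre_coords k c) (at (snd k q)) v))) (at (snd k q))"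
    by (simp add: o_def base_coords_def[abs_def] fibre_coords_def[abs_def])
qed

text \<open>This is \<open>\<theta> = \<langle>\<eta>, d\<zeta>\<rangle>\<close>, where \<open>\<zeta>\<close> stands for \<open>base_coords\<close> and \<open>\<eta>\<close> for \<open>fibre_coords\<close>.\<close>

lemma theta_charts:
  assumes q: "q \<in> fst k" "fst q \<in> fst c"
  shows "sphere_form A AS (theta A g D) q (\<lambda>i. coord_change k (chart_at AS q) q (v i)) =
    metric_rep c (base_coords k c (snd k q)) (fibre_coords k c (snd k q)) (frechet_derivative (base_coords k c) (at (snd k q)) (v 0))"
proof -
  have qA: "fst q \<in> carrier_of A" using carrierI[OF c q(2)] .
  have "coord_change c (chart_at A (fst q)) (fst q) (fibre_coords k c (snd k q)) = snd q"
    using chart_at_of_chart[OF c q(2)] c q by (simp add: fibre_coords_at coord_change_inverse)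
  then show ?thesis
    by (simp add: sphere_form_def pullback_form_def theta_eq[OF qA] sphere_incl_charts[OF q] bundle_proj_tchart[OF c q(2)]
        base_coords_at[OF q(1)] metric_rep_at[OF c q(2)])
qed

end

context
  fixes u assumes u: "u \<in> sphere_bundle A g s"
begin

interpretation AS: atlas AS by unfold_locales (rule atlas_AS)

private definition "k = chart_at AS u"
private definition "c = chart_at A (fst u)"

private lemma k: "k \<in> AS" "u \<in> fst k"
  using AS.chart_at[of u] u carrier_AS by (auto simp: k_def)

private lemma p: "fst u \<in> carrier_of A" using sphere_point u by blast

private lemma c: "c \<in> A" "fst u \<in> fst c"
  using chart_at[OF p] by (auto simp: c_def)

private abbreviation "x0 \<equiv> snd k u"
private abbreviation "\<zeta>' \<equiv> frechet_derivative (base_coords k c) (at x0)"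
private abbreviation "\<eta>' \<equiv> frechet_derivative (fibre_coords k c) (at x0)"

private lemma x0: "x0 \<in> coords_dom k c" by (rule in_coords_dom[OF k(1) c(1) k(2) c(2)])

private lemma d\<zeta>: "(base_coords k c has_derivative \<zeta>') (at x0)" and d\<eta>: "(fibre_coords k c has_derivative \<eta>') (at x0)"
  using smooth_on_has_derivative[OF smooth_base_coords[OF k(1) c(1)] x0] smooth_on_has_derivative[OF smooth_fibre_coords[OF k(1) c(1)] x0] .

private lemma \<zeta>0: "base_coords k c x0 = snd c (fst u)" and \<eta>0: "fibre_coords k c x0 = snd u"
  using base_coords_at[OF k(1) c(1) k(2)] fibre_coords_at[OF k(1) c(1) k(2)] coord_change_self[OF c] by (simp_all add: c_def)

private lemma incl: "sphere_incl A AS u v = tcoord u (\<zeta>' v, \<eta>' v)"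
  using sphere_incl_charts[OF k(1) c(1) k(2) c(2), of v] AS.coord_change_self[OF k]
  by (simp add: tcoord_def k_def c_def)

definition hor :: "'k \<Rightarrow> 'e" where "hor v = bundle_proj A u (sphere_incl A AS u v)"
definition ver :: "'k \<Rightarrow> 'e" where "ver v = vertical_part A D u (sphere_incl A AS u v)"

private lemma hor: "hor v = \<zeta>' v" and ver: "ver v = \<eta>' v + christoffel (fst u) (\<zeta>' v) (snd u)"
  by (simp_all add: hor_def ver_def incl bundle_proj_tcoord[OF p] vertical_part_tcoord[OF p])

lemma linear_hor: "linear hor"
  using has_derivative_linear[OF d\<zeta>] by (simp add: hor[abs_def])

lemma linear_ver: "linear ver"
  unfolding ver[abs_def]
  by (intro linear_compose_add has_derivative_linear[OF d\<eta>]
    linear_compose[OF has_derivative_linear[OF d\<zeta>] linear_christoffel_left[OF p], unfolded o_def])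

lemma hor_ver_inj: "hor v = 0 \<Longrightarrow> ver v = 0 \<Longrightarrow> v = 0"
proof -
  assume "hor v = 0" "ver v = 0"
  then have "\<zeta>' v = 0" "\<eta>' v = 0" by (auto simp: hor ver p)
  then have "sphere_incl A AS u v = sphere_incl A AS u 0"
    using linear_0[OF has_derivative_linear[OF d\<zeta>]] linear_0[OF has_derivative_linear[OF d\<eta>]] by (simp add: incl)
  then show "v = 0" using inj_incl[OF u] by (simp add: inj_eq)
qed

text \<open>The vertical part is the covariant derivative of the position vector, and the length of the latter is the
constant \<open>s\<close>.\<close>

lemma ver_orthogonal: "g (fst u) (ver v) (snd u) = 0"
proof -
  have "((\<lambda>y. metric_rep c (base_coords k c y) (fibre_coords k c y) (fibre_coords k c y)) has_derivative
    (\<lambda>h. g (fst u) (\<eta>' h + christoffel (fst u) (\<zeta>' h) (fibre_coords k c x0)) (fibre_coords k c x0) +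
      g (fst u) (fibre_coords k c x0) (\<eta>' h + christoffel (fst u) (\<zeta>' h) (fibre_coords k c x0)))) (at x0)"
    by (rule metric_rep_has_derivative[OF p c_def open_coords_dom[OF k(1) c(1)] x0 base_coords_image[OF k(1) c(1)] \<zeta>0 d\<zeta> d\<eta> d\<eta>])
  then have "((\<lambda>y. s\<^sup>2) has_derivative
    (\<lambda>h. g (fst u) (\<eta>' h + christoffel (fst u) (\<zeta>' h) (fibre_coords k c x0)) (fibre_coords k c x0) +
      g (fst u) (fibre_coords k c x0) (\<eta>' h + christoffel (fst u) (\<zeta>' h) (fibre_coords k c x0)))) (at x0)"
  proof (rule has_derivative_transform_within_open[OF _ open_coords_dom[OF k(1) c(1)] x0])
    fix y assume "y \<in> coords_dom k c"
    then obtain q where q: "q \<in> fst k" "fst q \<in> fst c" "y = snd k q" by (auto simp: coords_dom_def)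
    have "q \<in> sphere_bundle A g s" using q chart_in_sphere[OF k(1) c(1)] by blast
    then have "g (fst q) (snd q) (snd q) = s\<^sup>2" by (rule sphere_point)
    then show "metric_rep c (base_coords k c y) (fibre_coords k c y) (fibre_coords k c y) = s\<^sup>2"
      using chart_at_of_chart[OF c(1) q(2)] c q
      by (simp add: fibre_coords_at[OF k(1) c(1) q(1)] base_coords_at[OF k(1) c(1) q(1)] metric_rep_at coord_change_inverse)
  qed
  from has_derivative_unique[OF this has_derivative_const]
  have "g (fst u) (ver v) (snd u) + g (fst u) (snd u) (ver v) = 0"
    by (simp add: \<eta>0 ver fun_eq_iff)
  then show ?thesis using g_sym[OF p, of "snd u" "ver v"] by simp
qed

lemma sphere_metric_eq: "sphere_metric A g D AS u x y = g (fst u) (hor x) (hor y) + g (fst u) (ver x) (ver y)"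
  by (simp add: sphere_metric_def sasaki_def hor_def ver_def)

lemma sphere_theta_eq: "sphere_form A AS (theta A g D) u v = g (fst u) (snd u) (hor (v 0))"
  by (simp add: sphere_form_def pullback_form_def theta_eq[OF p] hor_def)

lemma theta_chart_has_derivative:
  "((\<lambda>x. pullback_form (coord_change k (chart_at AS (inv_into (fst k) (snd k) x)) (inv_into (fst k) (snd k) x))
      (sphere_form A AS (theta A g D) (inv_into (fst k) (snd k) x)) v) has_derivative
    (\<lambda>h. g (fst u) (ver h) (hor (v 0)) + g (fst u) (snd u)
      (frechet_derivative (\<lambda>x. frechet_derivative (base_coords k c) (at x) (v 0)) (at x0) h + christoffel (fst u) (hor h) (hor (v 0))))) (at x0)"
proof -
  let ?\<kappa> = "\<lambda>x. frechet_derivative (base_coords k c) (at x) (v 0)"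
  have d\<kappa>: "(?\<kappa> has_derivative frechet_derivative ?\<kappa> (at x0)) (at x0)"
    by (rule smooth_on_has_derivative[OF smooth_on_frechet[OF smooth_base_coords[OF k(1) c(1)]] x0])
  have "((\<lambda>y. metric_rep c (base_coords k c y) (fibre_coords k c y) (?\<kappa> y)) has_derivative
    (\<lambda>h. g (fst u) (ver h) (hor (v 0)) + g (fst u) (snd u)
      (frechet_derivative ?\<kappa> (at x0) h + christoffel (fst u) (hor h) (hor (v 0))))) (at x0)"
    using metric_rep_has_derivative[OF p c_def open_coords_dom[OF k(1) c(1)] x0 base_coords_image[OF k(1) c(1)] \<zeta>0 d\<zeta> d\<eta> d\<kappa>]
    by (simp add: \<eta>0 ver hor)
  then show ?thesis
  proof (rule has_derivative_transform_within_open[OF _ open_coords_dom[OF k(1) c(1)] x0])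
    fix y assume "y \<in> coords_dom k c"
    then obtain q where q: "q \<in> fst k" "fst q \<in> fst c" "y = snd k q" by (auto simp: coords_dom_def)
    then show "metric_rep c (base_coords k c y) (fibre_coords k c y) (?\<kappa> y) =
      pullback_form (coord_change k (chart_at AS (inv_into (fst k) (snd k) y)) (inv_into (fst k) (snd k) y))
        (sphere_form A AS (theta A g D) (inv_into (fst k) (snd k) y)) v"
      using theta_charts[OF k(1) c(1) q(1,2), of v] AS.inv_chart[OF k(1) q(1)] by (simp add: pullback_form_def)
  qed
qed

text \<open>Differentiate \<open>\<langle>\<eta>, d\<zeta>(v)\<rangle>\<close>. Two contributions are symmetric in the two arguments and cancel: the second
derivative of \<open>\<zeta>\<close> and, the connection being torsion-free, the Christoffel symbols applied to two values of
\<open>d\<zeta>\<close>.\<close>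

theorem exterior_derivative_theta:
  "exterior_derivative AS 1 (sphere_form A AS (theta A g D)) u v =
    g (fst u) (ver (v 0)) (hor (v 1)) - g (fst u) (ver (v 1)) (hor (v 0))"
proof -
  let ?R = "\<lambda>v x. pullback_form (coord_change k (chart_at AS (inv_into (fst k) (snd k) x)) (inv_into (fst k) (snd k) x))
      (sphere_form A AS (theta A g D) (inv_into (fst k) (snd k) x)) v"
  let ?D2 = "\<lambda>a b. frechet_derivative (\<lambda>x. frechet_derivative (base_coords k c) (at x) a) (at x0) b"
  have dR: "frechet_derivative (?R v) (at x0) h = g (fst u) (ver h) (hor (v 0)) + g (fst u) (snd u)
      (?D2 (v 0) h + christoffel (fst u) (hor h) (hor (v 0)))" for v h
    using frechet_derivative_at[OF theta_chart_has_derivative] by metis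
  have "exterior_derivative AS 1 (sphere_form A AS (theta A g D)) u v =
     frechet_derivative (?R (\<lambda>j. v (Suc j))) (at x0) (v 0) -
     frechet_derivative (?R (\<lambda>j. if j < 1 then v j else v (Suc j))) (at x0) (v 1)"
    by (simp add: exterior_derivative_def Let_def k_def)
  also have "\<dots> = g (fst u) (ver (v 0)) (hor (v 1)) + g (fst u) (snd u) (?D2 (v 1) (v 0) + christoffel (fst u) (hor (v 0)) (hor (v 1))) -
     (g (fst u) (ver (v 1)) (hor (v 0)) + g (fst u) (snd u) (?D2 (v 0) (v 1) + christoffel (fst u) (hor (v 1)) (hor (v 0))))"
    unfolding dR by simp
  also have "?D2 (v 1) (v 0) = ?D2 (v 0) (v 1)"
    by (rule second_derivative_symmetric[OF open_coords_dom[OF k(1) c(1)] x0 smooth_base_coords[OF k(1) c(1)]])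
  also have "christoffel (fst u) (hor (v 0)) (hor (v 1)) = christoffel (fst u) (hor (v 1)) (hor (v 0))"
    by (rule christoffel_sym[OF p])
  finally show ?thesis by simp
qed

lemma sphere_vol_eq:
  "sphere_form A AS (vol A g ori) u v = volume_form (g (fst u)) (ori (fst u)) (\<lambda>i. hor (v i))"
  by (simp add: sphere_form_def vol_def pullback_form_def hor_def)

lemma alpha_top_eq:
  "alpha_top A g ori D u w = volume_form (g (fst u)) (ori (fst u)) (case_nat (snd u /\<^sub>R s) (\<lambda>i. vertical_part A D u (w i)))"
proof -
  have "sasaki A g D u (canonical_field A u) (canonical_field A u) = s\<^sup>2"
    using sphere_point[OF u] linear_0[OF linear_g[OF p]]
    by (simp add: sasaki_def bundle_proj_canonical[OF p] vertical_part_canonical[OF p])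
  moreover have "vertical_part A D u (canonical_field A u /\<^sub>R s) = snd u /\<^sub>R s"
    by (simp add: linear_cmul[OF linear_vertical_part[OF p]] vertical_part_canonical[OF p])
  moreover have "(\<lambda>i. vertical_part A D u (case_nat a w i)) = case_nat (vertical_part A D u a) (\<lambda>i. vertical_part A D u (w i))" for a
    by (auto split: nat.splits)
  ultimately show ?thesis
    using s_pos by (simp add: alpha_top_def Let_def interior_product_def vertical_vol_def pullback_form_def)
qed

lemma sphere_alpha_top_eq:
  "sphere_form A AS (alpha_top A g ori D) u v =
    volume_form (g (fst u)) (ori (fst u)) (case_nat (snd u /\<^sub>R s) (\<lambda>i. ver (v i)))"
  by (simp add: sphere_form_def pullback_form_def alpha_top_eq ver_def)

lemma sphere_alpha_eq:
  "sphere_form A AS (alpha A g ori D n i) u v =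
    (\<Sum>\<sigma> | \<sigma> permutes {..<n}. of_int (sign \<sigma>) * volume_form (g (fst u)) (ori (fst u))
       (case_nat (snd u /\<^sub>R s) (\<lambda>j. if j < n - i then hor (v (\<sigma> j)) else ver (v (\<sigma> j))))) / (fact i * fact (n - i))"
proof -
  have "vertical_part A D u (if j < n - i then mirror A u (sphere_incl A AS u x) else sphere_incl A AS u x) =
      (if j < n - i then hor x else ver x)" for j x
    by (simp add: vertical_part_mirror[OF p] hor_def ver_def)
  then show ?thesis
    by (simp add: sphere_form_def pullback_form_def alpha_def alpha_top_eq)
qed

end

end

section \<open>Adapted frames\<close>

text \<open>Gram-Schmidt: fewer than \<open>DIM('v)\<close> orthonormal vectors do not span, and any vector outside their span supplies the
next one.\<close>

lemma orthonormal_frame_extend: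
  fixes G :: "'v::euclidean_space \<Rightarrow> 'v \<Rightarrow> real"
  assumes G: "inner_product G" and e: "G e e = 1"
  shows "\<exists>E. orthonormal_basis G E \<and> E 0 = e"
proof -
  have lin: "linear (G x)" and sym: "G x y = G y x" and pos: "x \<noteq> 0 \<Longrightarrow> 0 < G x x" for x y
    using G by (auto simp: inner_product_def bilinear_def)
  have "\<exists>E. E 0 = e \<and> (\<forall>i<Suc m. \<forall>j<Suc m. G (E i) (E j) = (if i = j then 1 else 0))" if "Suc m \<le> DIM('v)" for m
    using that
  proof (induction m)
    case 0
    then show ?case using e by (intro exI[of _ "\<lambda>_. e"]) auto
  next
    case (Suc m)
    then obtain E where E: "E 0 = e" "\<And>i j. i < Suc m \<Longrightarrow> j < Suc m \<Longrightarrow> G (E i) (E j) = (if i = j then 1 else 0)"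
      by (auto simp: Suc_le_eq)
    have "dim (span (E ` {..<Suc m})) \<le> card (E ` {..<Suc m})" by (simp add: dim_le_card')
    also have "\<dots> \<le> Suc m" using card_image_le[of "{..<Suc m}" E] by simp
    finally have "dim (span (E ` {..<Suc m})) < DIM('v)" using Suc.prems by simp
    then have "span (E ` {..<Suc m}) \<noteq> UNIV" by (metis dim_UNIV less_irrefl)
    then obtain x where x: "x \<notin> span (E ` {..<Suc m})" by blast
    define y where "y = x - (\<Sum>i<Suc m. G (E i) x *\<^sub>R E i)"
    have "(\<Sum>i<Suc m. G (E i) x *\<^sub>R E i) \<in> span (E ` {..<Suc m})"
      by (intro span_sum span_scale span_base) auto
    then have "y \<noteq> 0" using x by (auto simp: y_def)
    then have y: "0 < G y y" by (rule pos)
    have Ey: "G (E j) y = 0" if j: "j < Suc m" for j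
    proof -
      have "G (E j) (\<Sum>i<Suc m. G (E i) x *\<^sub>R E i) = (\<Sum>i<Suc m. G (E i) x * G (E j) (E i))"
        by (simp only: linear_sum[OF lin] linear_cmul[OF lin] real_scaleR_def)
      also have "\<dots> = (\<Sum>i<Suc m. if j = i then G (E i) x else 0)" using j by (intro sum.cong) (auto simp: E)
      also have "\<dots> = G (E j) x" using j by simp
      finally show ?thesis by (simp add: y_def linear_diff[OF lin])
    qed
    define z where "z = y /\<^sub>R sqrt (G y y)"
    have Ez: "G (E j) z = 0" "G z (E j) = 0" if "j < Suc m" for j
      using Ey[OF that] sym[of z] by (auto simp: z_def linear_cmul[OF lin])
    have "G z z = inverse (sqrt (G y y)) * (inverse (sqrt (G y y)) * G y y)"
      unfolding z_def linear_cmul[OF lin] by (simp add: sym[of "y /\<^sub>R sqrt (G y y)"] linear_cmul[OF lin])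
    also have "\<dots> = 1"
    proof -
      have "G y y = sqrt (G y y) * sqrt (G y y)" "sqrt (G y y) > 0" using y by auto
      then show ?thesis by (metis (no_types, opaque_lifting) left_inverse less_irrefl mult.assoc mult.left_neutral)
    qed
    finally have zz: "G z z = 1" .
    show ?case
    proof (intro exI[of _ "E(Suc m := z)"] conjI allI impI)
      show "(E(Suc m := z)) 0 = e" using E by simp
      fix i j assume "i < Suc (Suc m)" "j < Suc (Suc m)"
      then show "G ((E(Suc m := z)) i) ((E(Suc m := z)) j) = (if i = j then 1 else 0)"
        by (cases "i = Suc m"; cases "j = Suc m") (auto simp: zz Ez E less_Suc_eq)
    qed
  qed
  from this[of "DIM('v) - 1"] obtain E
    where "E 0 = e" "\<forall>i<DIM('v). \<forall>j<DIM('v). G (E i) (E j) = (if i = j then 1 else 0)" by auto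
  then show ?thesis unfolding orthonormal_basis_def by blast
qed

text \<open>Both sides are top forms in \<open>b\<close>, so it suffices to compare them on the standard basis, where the left side
is the determinant by definition. The rest is a transport of permutations from \<open>{..<CARD('m)}\<close> to the index type.\<close>

lemma alt_top_form_linear:
  fixes \<omega> :: "(real^'m) form" and L :: "real^'m \<Rightarrow> real^'m"
  assumes \<omega>: "alt_form CARD('m) \<omega>" and L: "linear L"
  shows "\<omega> (\<lambda>i. L (b i)) = det (matrix L) * \<omega> b"
proof -
  let ?N = "CARD('m)"
  obtain h :: "nat \<Rightarrow> 'm" where h: "bij_betw h {0..<?N} UNIV"
    using ex_bij_betw_nat_finite[OF finite[of "UNIV :: 'm set"]] by blast
  then have h: "bij_betw h {..<?N} UNIV" by (simp add: atLeast0LessThan)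
  define a where "a i = (axis (h i) 1 :: real^'m)" for i
  have hin: "h i = h j \<longleftrightarrow> i = j" if "i < ?N" "j < ?N" for i j
    using h that by (auto simp: bij_betw_def inj_on_eq_iff)
  interpret ortho_frame "(\<bullet>) :: real^'m \<Rightarrow> real^'m \<Rightarrow> real" a
  proof
    show "inner_product ((\<bullet>) :: real^'m \<Rightarrow> real^'m \<Rightarrow> real)"
      by (auto simp: inner_product_def bilinear_def inner_commute bounded_linear.linear bounded_linear_inner_left bounded_linear_inner_right)
    show "orthonormal_basis ((\<bullet>) :: real^'m \<Rightarrow> real^'m \<Rightarrow> real) a"
      by (auto simp: orthonormal_basis_def a_def inner_axis_axis hin)
  qed
  define \<omega>' where "\<omega>' v = \<omega> (\<lambda>i. L (v i))" for v
  have alt': "alt_form ?N \<omega>'"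
    unfolding alt_form_def
  proof (intro conjI allI impI)
    fix v w :: "nat \<Rightarrow> real^'m" assume "\<forall>i<?N. v i = w i"
    then show "\<omega>' v = \<omega>' w" unfolding \<omega>'_def by (intro alt_form_cong[OF \<omega>]) auto
  next
    fix v :: "nat \<Rightarrow> real^'m" and i assume "i < ?N"
    then have "linear (\<lambda>x. \<omega> ((\<lambda>i. L (v i))(i := x)))" by (rule alt_form_linear[OF \<omega>])
    from linear_compose[OF L this] have "linear (\<lambda>x. \<omega> ((\<lambda>i. L (v i))(i := L x)))" by (simp add: o_def)
    moreover have "(\<lambda>j. L ((v(i := x)) j)) = (\<lambda>i. L (v i))(i := L x)" for x by auto
    ultimately show "linear (\<lambda>x. \<omega>' (v(i := x)))" by (simp add: \<omega>'_def)
  next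
    fix v :: "nat \<Rightarrow> real^'m" and i j assume "i < ?N" "j < ?N" "i \<noteq> j" "v i = v j"
    then show "\<omega>' v = 0" unfolding \<omega>'_def by (intro alt_form_zero[OF \<omega>, of i j]) auto
  qed
  have top: "\<nu> v = \<nu> a * basis_form [0..<?N] v" if "alt_form ?N \<nu>" for \<nu> v
    using top_form[of \<nu>] that by (metis DIM_cart DIM_real mult.right_neutral)
  have "basis_form [0..<?N] (\<lambda>i. L (a i)) =
     (\<Sum>\<sigma> | \<sigma> permutes {..<?N}. of_int (sign \<sigma>) * (\<Prod>i<?N. L (a (\<sigma> i)) $ h i))"
    by (simp add: basis_form_def ext_prod_def a_def inner_axis' )
  also have "\<dots> = (\<Sum>\<sigma> | \<sigma> permutes {..<?N}. of_int (sign (map_permutation {..<?N} h \<sigma>)) *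
      (\<Prod>i\<in>UNIV. matrix L $ i $ map_permutation {..<?N} h \<sigma> i))"
  proof (intro sum.cong refl arg_cong2[where f="(*)"])
    fix \<sigma> assume "\<sigma> \<in> {\<sigma>. \<sigma> permutes {..<?N}}"
    then have \<sigma>: "\<sigma> permutes {..<?N}" by simp
    show "real_of_int (sign \<sigma>) = real_of_int (sign (map_permutation {..<?N} h \<sigma>))"
      using sign_map_permutation[OF bij_betw_imp_inj_on[OF h] \<sigma>] by simp
    have "(\<Prod>i\<in>UNIV. matrix L $ i $ map_permutation {..<?N} h \<sigma> i) =
       (\<Prod>i<?N. matrix L $ h i $ map_permutation {..<?N} h \<sigma> (h i))"
      by (rule prod.reindex_bij_betw[OF h, symmetric])
    also have "\<dots> = (\<Prod>i<?N. L (a (\<sigma> i)) $ h i)"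
      using map_permutation_apply[OF bij_betw_imp_inj_on[OF h]]
      by (intro prod.cong) (auto simp: matrix_def a_def)
    finally show "(\<Prod>i<?N. L (a (\<sigma> i)) $ h i) = (\<Prod>i\<in>UNIV. matrix L $ i $ map_permutation {..<?N} h \<sigma> i)" by simp
  qed
  also have "\<dots> = (\<Sum>p | p permutes (UNIV :: 'm set). of_int (sign p) * (\<Prod>i\<in>UNIV. matrix L $ i $ p i))"
    by (rule sum.reindex_bij_betw[OF bij_betw_map_permutation[OF h]])
  also have "\<dots> = det (matrix L)" by (simp add: det_def)
  finally have "\<omega>' a = \<omega> a * det (matrix L)"
    unfolding \<omega>'_def using top[OF \<omega>, of "\<lambda>i. L (a i)"] by simp
  then have "\<omega>' b = \<omega> a * det (matrix L) * basis_form [0..<?N] b" using top[OF alt', of b] by simp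
  then show ?thesis using top[OF \<omega>, of b] by (simp add: \<omega>'_def mult_ac)
qed

lemma ordered_basis_map:
  fixes b :: "nat \<Rightarrow> 'v::euclidean_space" and c :: "nat \<Rightarrow> 'v"
  assumes "ordered_basis b"
  shows "\<exists>L. linear L \<and> (\<forall>i<DIM('v). L (b i) = c i)"
proof -
  have b: "inj_on b {..<DIM('v)}" "independent (b ` {..<DIM('v)})" using assms by (auto simp: ordered_basis_def)
  obtain L where L: "linear L" "\<forall>x\<in>b ` {..<DIM('v)}. L x = c (inv_into {..<DIM('v)} b x)"
    using linear_independent_extend[OF b(2), of "\<lambda>x. c (inv_into {..<DIM('v)} b x)"] by blast
  have "L (b i) = c i" if "i < DIM('v)" for i
    using bspec[OF L(2), of "b i"] inv_into_f_f[OF b(1), of i] that by simp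
  then show ?thesis using L(1) by blast
qed

lemma (in ortho_frame) ordered_basis_E: "ordered_basis E"
  by (simp add: ordered_basis_def inj_E independent_E)

text \<open>The top form \<open>e\<^sup>0 \<and> \<dots> \<and> e\<^sup>n\<close> is \<open>\<plusminus>1\<close> on orthonormal bases, and a linear map of positive determinant preserves its sign, so it
takes the same value \<open>\<epsilon>\<close> on all positive ones. There is a positive one: either \<open>E\<close>, or \<open>E\<close> with its first
vector negated.\<close>

lemma volume_form_orientation:
  fixes G :: "real^'m \<Rightarrow> real^'m \<Rightarrow> real"
  assumes "ortho_frame G E" and b: "ordered_basis b"
  shows "\<exists>\<epsilon>. \<epsilon> * \<epsilon> = 1 \<and> volume_form G {c. ordered_basis c \<and> same_orientation b c} =
    (\<lambda>v. \<epsilon> * ortho_frame.basis_form G E [0..<CARD('m)] v)"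
proof -
  interpret ortho_frame G E by fact
  let ?N = "CARD('m)"
  let ?\<omega> = "basis_form [0..<?N]"
  have alt: "alt_form ?N ?\<omega>" by (simp add: alt_form_basis_form)
  have \<omega>E: "?\<omega> E = 1" using basis_form_top_self by simp
  have det: "?\<omega> c = det (matrix L) * ?\<omega> b" if "linear L" "\<forall>i<?N. L (b i) = c i" for L c
  proof -
    have "?\<omega> c = ?\<omega> (\<lambda>i. L (b i))" using that by (intro alt_form_cong[OF alt]) auto
    then show ?thesis using alt_top_form_linear[OF alt that(1)] by simp
  qed
  define \<epsilon> where "\<epsilon> = sgn (?\<omega> b)"
  obtain L where L: "linear L" "\<forall>i<?N. L (b i) = E i" using ordered_basis_map[OF b, of E] by auto
  have "det (matrix L) * ?\<omega> b = 1" using det[OF L] \<omega>E by simp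
  then have nz: "?\<omega> b \<noteq> 0" by auto
  have \<epsilon>: "\<epsilon> * \<epsilon> = 1" using nz by (simp add: \<epsilon>_def sgn_if)
  define E' where "E' = (if \<epsilon> = 1 then E else E(0 := - E 0))"
  have E'onb: "orthonormal_basis G E'"
    using onb linear_neg[OF linear_G] linear_neg[OF linear_G_left]
    unfolding E'_def orthonormal_basis_def by auto
  have \<omega>E': "?\<omega> E' = \<epsilon>"
  proof (cases "\<epsilon> = 1")
    case False
    then have "\<epsilon> = -1" using nz by (auto simp: \<epsilon>_def sgn_if)
    moreover have "linear (\<lambda>x. ?\<omega> (E(0 := x)))" by (rule alt_form_linear[OF alt]) simp
    from linear_neg[OF this, of "E 0"] have "?\<omega> (E(0 := - E 0)) = - 1" using \<omega>E by simp
    ultimately show ?thesis using False by (simp add: E'_def)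
  qed (simp add: E'_def \<omega>E)
  obtain L' where L': "linear L'" "\<forall>i<?N. L' (b i) = E' i" using ordered_basis_map[OF b, of E'] by auto
  have "det (matrix L') * ?\<omega> b = \<epsilon>" using det[OF L'] \<omega>E' by simp
  note det' = this
  have "\<bar>?\<omega> b\<bar> * det (matrix L') = (?\<omega> b * \<epsilon>) * det (matrix L')" by (simp add: \<epsilon>_def sgn_if)
  also have "\<dots> = (det (matrix L') * ?\<omega> b) * \<epsilon>" by (simp only: mult_ac)
  also have "\<dots> = 1" by (simp only: det' \<epsilon>)
  finally have "\<bar>?\<omega> b\<bar> * det (matrix L') = 1" .
  then have "0 < \<bar>?\<omega> b\<bar> * det (matrix L')" by simp
  from zero_less_mult_pos[OF this] have "0 < det (matrix L')" using nz by simp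
  then have "same_orientation b E'" unfolding same_orientation_def using L' by blast
  moreover have "ordered_basis E'"
  proof -
    interpret E': ortho_frame G E' using inner E'onb by unfold_locales
    show ?thesis by (rule E'.ordered_basis_E)
  qed
  ultimately have E'P: "E' \<in> {c. ordered_basis c \<and> same_orientation b c}" by blast
  have "?\<omega> c = \<epsilon>" if c: "c \<in> {c. ordered_basis c \<and> same_orientation b c}" "orthonormal_basis G c" for c
  proof -
    obtain K where K: "linear K" "\<forall>i<?N. K (b i) = c i" "0 < det (matrix K)" using c(1) by (auto simp: same_orientation_def)
    have "sgn (?\<omega> c) = \<epsilon>" using det[OF K(1,2)] K(3) by (simp add: \<epsilon>_def sgn_mult)
    moreover have "?\<omega> c * ?\<omega> c = 1" using basis_form_top_orthonormal[OF c(2)] by simp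
    then have "?\<omega> c = 1 \<or> ?\<omega> c = -1" using square_eq_1_iff by blast
    ultimately show ?thesis by auto
  qed
  then have val: "basis_form [0..<DIM(real^'m)] c = \<epsilon>"
    if "c \<in> {c. ordered_basis c \<and> same_orientation b c}" "orthonormal_basis G c" for c
    using that by simp
  have "volume_form G {c. ordered_basis c \<and> same_orientation b c} = (\<lambda>v. \<epsilon> * basis_form [0..<DIM(real^'m)] v)"
    by (rule volume_form_eq[OF val E'P E'onb \<epsilon>])
  then show ?thesis using \<epsilon> by (intro exI[of _ \<epsilon>]) simp
qed

text \<open>The tangent space of the sphere bundle at \<open>u\<close>, with \<open>E\<close> an orthonormal basis of the tangent space of the base
whose first vector is \<open>u/s\<close>.\<close>

locale adapted_frame =
  M: ortho_frame G E for G :: "'e::euclidean_space \<Rightarrow> 'e \<Rightarrow> real" and E +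
  fixes hor ver :: "'k::euclidean_space \<Rightarrow> 'e" and n :: nat
  assumes lin: "linear hor" "linear ver"
    and inj: "\<And>x. hor x = 0 \<Longrightarrow> ver x = 0 \<Longrightarrow> x = 0"
    and orth: "\<And>x. G (E 0) (ver x) = 0"
    and dim_e: "DIM('e) = n + 1" and dim_k: "DIM('k) = 2 * n + 1"
begin

definition lifted_metric :: "'k \<Rightarrow> 'k \<Rightarrow> real" where
  "lifted_metric x y = G (hor x) (hor y) + G (ver x) (ver y)"

lemma inner_product_lifted: "inner_product lifted_metric"
proof -
  have "linear (lifted_metric x)" for x
    using linear_compose_add[OF linear_compose[OF lin(1) M.linear_G] linear_compose[OF lin(2) M.linear_G]]
    by (simp add: lifted_metric_def[abs_def] o_def)
  moreover have sym: "lifted_metric x y = lifted_metric y x" for x y by (simp add: lifted_metric_def M.G_sym)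
  moreover have "0 < lifted_metric x x" if "x \<noteq> 0" for x
  proof -
    have nonneg: "0 \<le> G y y" for y using M.G_pos[of y] linear_0[OF M.linear_G] by (cases "y = 0") auto
    have "hor x \<noteq> 0 \<or> ver x \<noteq> 0" using inj that by blast
    then show ?thesis
      using M.G_pos[of "hor x"] M.G_pos[of "ver x"] nonneg[of "hor x"] nonneg[of "ver x"]
      by (auto simp: lifted_metric_def add_pos_nonneg add_nonneg_pos)
  qed
  ultimately show ?thesis by (auto simp: inner_product_def bilinear_def)
qed

text \<open>The pairs \<open>(hor x, ver x)\<close> form a subspace of dimension \<open>2 n + 1\<close> of the pairs \<open>(a, b)\<close> with \<open>b\<close> orthogonal to \<open>E 0\<close>, and the
latter form a proper subspace of a space of dimension \<open>2 n + 2\<close>.\<close>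

lemma hor_ver_surjective: "G (E 0) b = 0 \<Longrightarrow> \<exists>x. hor x = a \<and> ver x = b"
proof -
  assume b: "G (E 0) b = 0"
  define \<Phi> where "\<Phi> x = (hor x, ver x)" for x
  have lin\<Phi>: "linear \<Phi>"
    using lin by (auto intro!: linearI simp: \<Phi>_def linear_add linear_cmul)
  have inj\<Phi>: "inj \<Phi>"
    by (subst linear_injective_0[OF lin\<Phi>]) (auto simp: \<Phi>_def zero_prod_def intro: inj)
  define T where "T = {z :: 'e \<times> 'e. G (E 0) (snd z) = 0}"
  have subT: "subspace T"
    unfolding T_def subspace_def
    by (auto simp: linear_0[OF M.linear_G] linear_add[OF M.linear_G] linear_cmul[OF M.linear_G])
  have "range \<Phi> \<subseteq> T" by (auto simp: T_def \<Phi>_def orth)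
  moreover have "subspace (range \<Phi>)" using linear_subspace_image[OF lin\<Phi> subspace_UNIV] .
  moreover have "dim T \<le> dim (range \<Phi>)"
  proof -
    have "(0, E 0) \<notin> T" using M.G_E[of 0 0] by (simp add: T_def)
    then have "T \<noteq> UNIV" by blast
    then have "dim T < DIM('e \<times> 'e)"
      using subT by (metis dim_eq_full dim_subset_UNIV le_neq_implies_less span_eq_iff)
    moreover have "dim (range \<Phi>) = DIM('k)" using dim_image_eq[OF lin\<Phi>, of UNIV] inj\<Phi> by (simp add: dim_UNIV)
    ultimately show ?thesis by (simp add: dim_e dim_k)
  qed
  ultimately have "range \<Phi> = T" using subspace_dim_equal[OF _ subT] by blast
  moreover have "(a, b) \<in> T" using b by (simp add: T_def)
  ultimately obtain x where "\<Phi> x = (a, b)" by (metis imageE)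
  then show ?thesis by (auto simp: \<Phi>_def)
qed

text \<open>The conditions have a solution by \<open>hor_ver_surjective\<close>, and only one, as \<open>hor\<close> and \<open>ver\<close> are jointly injective.\<close>

definition lifted_frame :: "nat \<Rightarrow> 'k" where
  "lifted_frame j = (SOME x. if j \<le> n then hor x = E j \<and> ver x = 0 else hor x = 0 \<and> ver x = E (j - n))"

lemma lifted_frame_hor_ver:
  assumes "j < 2 * n + 1"
  shows "if j \<le> n then hor (lifted_frame j) = E j \<and> ver (lifted_frame j) = 0 else hor (lifted_frame j) = 0 \<and> ver (lifted_frame j) = E (j - n)"
  unfolding lifted_frame_def
proof (rule someI_ex, cases "j \<le> n")
  case True
  then show "\<exists>x. if j \<le> n then hor x = E j \<and> ver x = 0 else hor x = 0 \<and> ver x = E (j - n)"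
    using hor_ver_surjective[of 0 "E j"] by (simp add: linear_0[OF M.linear_G])
next
  case False
  then have "G (E 0) (E (j - n)) = 0" using assms by (subst M.G_E) (auto simp: dim_e)
  then show "\<exists>x. if j \<le> n then hor x = E j \<and> ver x = 0 else hor x = 0 \<and> ver x = E (j - n)"
    using hor_ver_surjective[of "E (j - n)" 0] False by simp
qed

lemma G_zero [simp]: "G x 0 = 0" "G 0 x = 0"
  using linear_0[OF M.linear_G] linear_0[OF M.linear_G_left] by auto

lemma lifted_metric_hor: "j \<le> n \<Longrightarrow> lifted_metric (lifted_frame j) = (\<lambda>x. G (E j) (hor x))"
  and lifted_metric_ver: "1 \<le> j \<Longrightarrow> j \<le> n \<Longrightarrow> lifted_metric (lifted_frame (n + j)) = (\<lambda>x. G (E j) (ver x))"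
  using lifted_frame_hor_ver[of j] lifted_frame_hor_ver[of "n + j"] by (auto simp: lifted_metric_def fun_eq_iff)

lemma orthonormal_lifted: "orthonormal_basis lifted_metric lifted_frame"
  unfolding orthonormal_basis_def dim_k
proof (intro allI impI)
  fix i j assume ij: "i < 2 * n + 1" "j < 2 * n + 1"
  show "lifted_metric (lifted_frame i) (lifted_frame j) = (if i = j then 1 else 0)"
    using lifted_frame_hor_ver[OF ij(1)] lifted_frame_hor_ver[OF ij(2)] ij by (auto simp: lifted_metric_def M.G_E dim_e split: if_splits)
qed

sublocale S: ortho_frame lifted_metric lifted_frame
  by unfold_locales (rule inner_product_lifted, rule orthonormal_lifted)

lemma basis_form_hor:
  assumes "set js \<subseteq> {..n}"
  shows "M.basis_form js (\<lambda>i. hor (v i)) = S.basis_form js v"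
proof -
  have "map (\<lambda>\<phi> x. \<phi> (hor x)) (map (\<lambda>j. G (E j)) js) = map (\<lambda>j. lifted_metric (lifted_frame j)) js"
    using assms by (auto simp: lifted_metric_hor)
  then show ?thesis by (simp only: M.basis_form_def S.basis_form_def ext_prod_precompose)
qed

lemma basis_form_vertical_frame:
  "M.basis_form [0..<n + 1] (case_nat (E 0) y) = M.basis_form [1..<n + 1] y"
proof -
  have "[0..<n + 1] = 0 # [1..<n + 1]" by (subst upt_rec) simp
  moreover have "ext_prod (G (E 0) # map (\<lambda>j. G (E j)) [1..<n + 1]) (case_nat (E 0) y) =
      ext_prod (map (\<lambda>j. G (E j)) [1..<n + 1]) y"
    by (rule ext_prod_Cons_eval) (auto simp: M.G_E dim_e)
  ultimately show ?thesis by (simp only: M.basis_form_def list.map)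
qed

lemma theta_frame: "G (E 0) (hor (v 0)) = S.basis_form [0] v"
  by (simp add: S.basis_form_def ext_prod_single lifted_metric_hor)

text \<open>Expand the inner products in \<open>E\<close>. The term of \<open>E 0\<close> drops out because vertical parts are orthogonal to it.\<close>

lemma symplectic_frame:
  "G (ver (v 0)) (hor (v 1)) - G (ver (v 1)) (hor (v 0)) = (\<Sum>j<n. S.basis_form [n + 1 + j, 1 + j] v)"
proof -
  have "G (ver a) (hor b) = (\<Sum>j<n. G (E (1 + j)) (ver a) * G (E (1 + j)) (hor b))" for a b
    by (subst M.parseval) (simp add: dim_e sum.lessThan_Suc_shift orth del: sum.lessThan_Suc)
  then have "G (ver (v 0)) (hor (v 1)) - G (ver (v 1)) (hor (v 0)) =
    (\<Sum>j<n. G (E (1 + j)) (ver (v 0)) * G (E (1 + j)) (hor (v 1)) - G (E (1 + j)) (ver (v 1)) * G (E (1 + j)) (hor (v 0)))"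
    by (simp only: sum_subtractf)
  also have "\<dots> = (\<Sum>j<n. S.basis_form [n + 1 + j, 1 + j] v)"
  proof (rule sum.cong)
    fix j assume "j \<in> {..<n}"
    then show "G (E (1 + j)) (ver (v 0)) * G (E (1 + j)) (hor (v 1)) - G (E (1 + j)) (ver (v 1)) * G (E (1 + j)) (hor (v 0)) =
        S.basis_form [n + 1 + j, 1 + j] v"
      using lifted_metric_ver[of "1 + j"] lifted_metric_hor[of "1 + j"]
      by (simp add: S.basis_form_def ext_prod_pair add.assoc)
  qed simp
  finally show ?thesis .
qed

text \<open>The left side sums over the antisymmetrization \<open>\<sigma>\<close> in the definition of \<open>\<alpha>\<^sub>i\<close>, and inside it over the permutations
\<open>\<tau>\<close> of a determinant. Exchanging the sums turns the inner sum into a determinant again, now in the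
arguments \<open>v\<close>.\<close>

lemma mixed_frame:
  assumes i: "i \<le> n"
  shows "(\<Sum>\<sigma> | \<sigma> permutes {..<n}. of_int (sign \<sigma>) * M.basis_form [1..<n + 1]
       (\<lambda>j. if j < n - i then hor (v (\<sigma> j)) else ver (v (\<sigma> j)))) =
    (\<Sum>\<tau> | \<tau> permutes {..<n}. of_int (sign \<tau>) *
       S.basis_form (map (\<lambda>j. 1 + \<tau> j + (if j < n - i then 0 else n)) [0..<n]) v)"
proof -
  let ?S = "{\<sigma>. \<sigma> permutes {..<n}}"
  let ?y = "\<lambda>\<sigma> j. if j < n - i then hor (v (\<sigma> j)) else ver (v (\<sigma> j))"
  let ?a = "\<lambda>\<tau> j. 1 + \<tau> j + (if j < n - i then 0 else n)"
  have M: "M.basis_form [1..<n + 1] y = (\<Sum>\<tau>\<in>?S. of_int (sign \<tau>) * (\<Prod>j<n. G (E (1 + \<tau> j)) (y j)))" for y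
  proof -
    have "M.basis_form [1..<n + 1] y = (\<Sum>\<tau>\<in>?S. of_int (sign \<tau>) * (\<Prod>r<n. G (E (1 + r)) (y (\<tau> r))))"
      by (simp add: M.basis_form_def ext_prod_def nth_append del: upt_Suc)
    also have "\<dots> = (\<Sum>\<tau>\<in>?S. of_int (sign (inv \<tau>)) * (\<Prod>r<n. G (E (1 + r)) (y (inv \<tau> r))))"
      by (rule sum_permutations_inverse)
    also have "\<dots> = (\<Sum>\<tau>\<in>?S. of_int (sign \<tau>) * (\<Prod>j<n. G (E (1 + \<tau> j)) (y j)))"
    proof (intro sum.cong refl arg_cong2[where f="(*)"])
      fix \<tau> assume "\<tau> \<in> ?S"
      then have \<tau>: "\<tau> permutes {..<n}" by simp
      then show "real_of_int (sign (inv \<tau>)) = real_of_int (sign \<tau>)" by (simp add: sign_inverse)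
      show "(\<Prod>r<n. G (E (1 + r)) (y (inv \<tau> r))) = (\<Prod>j<n. G (E (1 + \<tau> j)) (y j))"
        using prod.permute[OF \<tau>, of "\<lambda>r. G (E (1 + r)) (y (inv \<tau> r))"] permutes_inverses(2)[OF \<tau>]
        by (simp add: o_def)
    qed
    finally show ?thesis .
  qed
  have "(\<Sum>\<sigma>\<in>?S. of_int (sign \<sigma>) * M.basis_form [1..<n + 1] (?y \<sigma>)) =
    (\<Sum>\<sigma>\<in>?S. \<Sum>\<tau>\<in>?S. of_int (sign \<tau>) * (of_int (sign \<sigma>) * (\<Prod>j<n. lifted_metric (lifted_frame (?a \<tau> j)) (v (\<sigma> j)))))"
  proof (rule sum.cong)
    fix \<sigma> assume "\<sigma> \<in> ?S"
    have "G (E (1 + \<tau> j)) (?y \<sigma> j) = lifted_metric (lifted_frame (?a \<tau> j)) (v (\<sigma> j))" if \<tau>: "\<tau> \<in> ?S" and j: "j < n" for \<tau> j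
    proof -
      have "\<tau> j < n" using permutes_in_image[of \<tau> "{..<n}" j] \<tau> j by simp
      then show ?thesis using lifted_metric_hor[of "1 + \<tau> j"] lifted_metric_ver[of "1 + \<tau> j"] by (simp add: ac_simps)
    qed
    then show "of_int (sign \<sigma>) * M.basis_form [1..<n + 1] (?y \<sigma>) =
      (\<Sum>\<tau>\<in>?S. of_int (sign \<tau>) * (of_int (sign \<sigma>) * (\<Prod>j<n. lifted_metric (lifted_frame (?a \<tau> j)) (v (\<sigma> j)))))"
      unfolding M sum_distrib_left by (intro sum.cong refl) (simp add: mult.left_commute)
  qed simp
  also have "\<dots> = (\<Sum>\<tau>\<in>?S. of_int (sign \<tau>) * (\<Sum>\<sigma>\<in>?S. of_int (sign \<sigma>) * (\<Prod>j<n. lifted_metric (lifted_frame (?a \<tau> j)) (v (\<sigma> j)))))"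
    by (subst sum.swap) (simp only: sum_distrib_left)
  also have "\<dots> = (\<Sum>\<tau>\<in>?S. of_int (sign \<tau>) * S.basis_form (map (?a \<tau>) [0..<n]) v)"
    by (simp add: S.basis_form_def ext_prod_def)
  finally show ?thesis .
qed

lemma vertical_volume_frame: "M.basis_form [0..<n + 1] (case_nat (E 0) (\<lambda>i. ver (v i))) = S.basis_form [n + 1..<2 * n + 1] v"
proof -
  have "map (\<lambda>\<phi> x. \<phi> (ver x)) (map (\<lambda>j. G (E j)) [1..<n + 1]) = map (\<lambda>j. lifted_metric (lifted_frame j)) [n + 1..<2 * n + 1]"
  proof (rule nth_equalityI)
    fix i assume "i < length (map (\<lambda>\<phi> x. \<phi> (ver x)) (map (\<lambda>j. G (E j)) [1..<n + 1]))"
    then have "i < n" by (simp del: upt_Suc)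
    then show "map (\<lambda>\<phi> x. \<phi> (ver x)) (map (\<lambda>j. G (E j)) [1..<n + 1]) ! i = map (\<lambda>j. lifted_metric (lifted_frame j)) [n + 1..<2 * n + 1] ! i"
      using lifted_metric_ver[of "1 + i"] by (simp del: upt_Suc)
  qed simp
  then show ?thesis
    unfolding basis_form_vertical_frame by (simp only: M.basis_form_def S.basis_form_def ext_prod_precompose)
qed

end

section \<open>The Hodge duals on the tangent sphere bundle\<close>

theorem proposition2p2:
  fixes A :: "('a, real^'m) chart set"
    and g :: "'a \<Rightarrow> real^'m \<Rightarrow> real^'m \<Rightarrow> real"
    and ori :: "'a \<Rightarrow> (nat \<Rightarrow> real^'m) set"
    and D :: "('a, real^'m) connection"
    and AS :: "('a \<times> (real^'m), 'k::euclidean_space) chart set"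
    and s :: real and n i :: nat
  assumes "smooth_manifold A"
    and "CARD('m) = n + 1"
    and "riemannian_metric A g"
    and "manifold_orientation A ori"
    and "levi_civita A g D"
    and "s > 0"
    and "DIM('k) = 2 * n + 1"
    and "embedded_submanifold AS (tangent_atlas A) (sphere_bundle A g s)"
    and "i \<le> n"
  shows "\<forall>u \<in> sphere_bundle A g s.
    let \<theta> = sphere_form A AS (theta A g D) u;
        d\<theta> = exterior_derivative AS 1 (sphere_form A AS (theta A g D)) u;
        \<alpha> = (\<lambda>j. sphere_form A AS (alpha A g ori D n j) u);
        star = sphere_star A g ori D n AS u
    in
      star 1 \<theta> = (\<lambda>v. s * wedge n n (\<alpha> 0) (\<alpha> n) v) \<and>
      star 1 \<theta> = (\<lambda>v. s * (-1) ^ (n * (n + 1) div 2) / fact n * wedge_power 2 d\<theta> n v) \<and>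
      star (2 * i) (wedge_power 2 d\<theta> i) =
        (\<lambda>v. (-1) ^ (n * (n + 1) div 2) * (fact i / (fact (n - i) * s)) *
             wedge 1 (2 * (n - i)) \<theta> (wedge_power 2 d\<theta> (n - i)) v) \<and>
      star n (\<alpha> i) = (\<lambda>v. (-1) ^ (n - i) / s * wedge 1 n \<theta> (\<alpha> (n - i)) v) \<and>
      wedge n 2 (\<alpha> i) d\<theta> = (\<lambda>v. 0) \<and>
      (\<forall>j\<le>n. j \<noteq> n - i \<longrightarrow> wedge n n (\<alpha> i) (\<alpha> j) = (\<lambda>v. 0))"
proof
  fix u assume u: "u \<in> sphere_bundle A g s"
  interpret T: tangent_sphere A g D AS s
    by unfold_locales (use assms in \<open>auto simp: smooth_manifold_def\<close>)
  let ?p = "fst u" and ?w = "snd u"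
  note p = T.sphere_point(1)[OF u] and ww = T.sphere_point(2)[OF u]
  have ip: "inner_product (g ?p)" by (rule T.inner_g[OF p])
  have "g ?p (?w /\<^sub>R s) (?w /\<^sub>R s) = 1"
    using ww \<open>s > 0\<close>
    by (simp add: linear_cmul[OF T.linear_g[OF p]] linear_cmul[OF T.linear_g_left[OF p]] power2_eq_square field_simps)
  then obtain E where E: "orthonormal_basis (g ?p) E" "E 0 = ?w /\<^sub>R s"
    using orthonormal_frame_extend[OF ip] by blast
  have w: "?w = s *\<^sub>R E 0" using \<open>s > 0\<close> by (simp add: E(2))
  have orth: "g ?p (E 0) (T.ver u x) = 0" for x
    using T.ver_orthogonal[OF u, of x] T.g_sym[OF p, of "T.ver u x" "E 0"]
    by (simp add: E(2) linear_cmul[OF T.linear_g[OF p]])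
  have dim_m: "DIM(real^'m) = n + 1" using assms(2) by simp
  interpret F: adapted_frame "g ?p" E "T.hor u" "T.ver u" n
    by unfold_locales (rule ip, rule E, rule linear_add[OF T.linear_hor[OF u]],
      rule linear_cmul[OF T.linear_hor[OF u]], rule linear_add[OF T.linear_ver[OF u]], rule linear_cmul[OF T.linear_ver[OF u]],
      rule T.hor_ver_inj[OF u], assumption+, rule orth, rule dim_m, rule assms(7))
  obtain b where b: "ordered_basis b" "ori ?p = {c. ordered_basis c \<and> same_orientation b c}"
    using \<open>manifold_orientation A ori\<close> p unfolding manifold_orientation_def by blast
  \<comment> \<open>The basis may be negative; \<open>\<epsilon>\<close> is its sign.\<close>
  obtain \<epsilon> where \<epsilon>: "\<epsilon> * \<epsilon> = 1" "volume_form (g ?p) (ori ?p) = (\<lambda>v. \<epsilon> * F.M.basis_form [0..<n + 1] v)"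
    using volume_form_orientation[OF F.M.ortho_frame_axioms b(1)] b(2) assms(2) by auto
  define P where "P = sphere_orientation A g ori D n AS u"
  \<comment> \<open>Everything is now expressed in the frame, beginning with the metric and the orientation.\<close>
  have met: "sphere_metric A g D AS u = F.lifted_metric"
    by (intro ext) (simp add: T.sphere_metric_eq[OF u] F.lifted_metric_def)
  have vol: "sphere_form A AS (vol A g ori) u = (\<lambda>v. \<epsilon> * F.S.basis_form [0..<n + 1] v)"
    by (rule ext) (simp add: T.sphere_vol_eq[OF u] \<epsilon> F.basis_form_hor del: upt_Suc, subst F.basis_form_hor, auto)
  have top: "sphere_form A AS (alpha_top A g ori D) u = (\<lambda>v. \<epsilon> * F.S.basis_form [n + 1..<2 * n + 1] v)"
    by (rule ext) (simp only: T.sphere_alpha_top_eq[OF u] \<epsilon> E(2)[symmetric] F.vertical_volume_frame)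
  have "[0..<n + 1] @ [n + 1..<2 * n + 1] = [0..<2 * n + 1]"
  proof -
    have "2 * n + 1 = (n + 1) + n" by simp
    then show ?thesis using upt_add_eq_append[of 0 "n + 1" n] by (simp only: le0)
  qed
  then have "wedge (n + 1) n (sphere_form A AS (vol A g ori) u) (sphere_form A AS (alpha_top A g ori D) u) =
      (\<lambda>v. F.S.basis_form [0..<2 * n + 1] v)"
    unfolding vol top wedge_scale_left wedge_scale_right
    by (subst F.S.wedge_basis_form) (simp_all add: mult.assoc[symmetric] \<epsilon>(1) del: upt_Suc)
  then have P: "P = {b. ordered_basis b \<and> 0 < F.S.basis_form [0..<2 * n + 1] b}"
    by (simp add: P_def sphere_orientation_def)
  have "volume_form F.lifted_metric P = (\<lambda>v. 1 * F.S.basis_form [0..<DIM('k)] v)"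
  proof (rule F.S.volume_form_eq)
    fix b assume "b \<in> P" "orthonormal_basis F.lifted_metric b"
    then show "F.S.basis_form [0..<DIM('k)] b = 1"
      using F.S.basis_form_top_orthonormal[of b] unfolding P assms(7)
      by (metis (no_types, lifting) mem_Collect_eq less_asym neg_less_0_iff_less square_eq_1_iff zero_less_one)
  next
    show "F.lifted_frame \<in> P" using F.S.ordered_basis_E F.S.basis_form_top_self unfolding P assms(7) by simp
  qed (rule F.orthonormal_lifted, simp)
  then interpret C: contact_frame F.lifted_metric F.lifted_frame n s \<epsilon> P
    by unfold_locales (use assms \<epsilon> in auto)
  have \<theta>: "sphere_form A AS (theta A g D) u = C.contact_form"
    by (rule ext) (simp add: T.sphere_theta_eq[OF u] C.contact_form_def F.theta_frame[symmetric] w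
        linear_cmul[OF T.linear_g_left[OF p]])
  have d\<theta>: "exterior_derivative AS 1 (sphere_form A AS (theta A g D)) u = C.symplectic_form"
    by (rule ext) (simp only: T.exterior_derivative_theta[OF u] C.symplectic_form_def F.symplectic_frame)
  have \<alpha>: "sphere_form A AS (alpha A g ori D n j) u = C.mixed_form j" if "j \<le> n" for j
  proof
    fix v
    have "sphere_form A AS (alpha A g ori D n j) u v =
       (\<Sum>\<sigma> | \<sigma> permutes {..<n}. of_int (sign \<sigma>) * (\<epsilon> * F.M.basis_form [1..<n + 1]
         (\<lambda>r. if r < n - j then T.hor u (v (\<sigma> r)) else T.ver u (v (\<sigma> r))))) / (fact j * fact (n - j))"
      by (simp only: T.sphere_alpha_eq[OF u] \<epsilon>(2) E(2)[symmetric] F.basis_form_vertical_frame)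
    also have "\<dots> = \<epsilon> * (\<Sum>\<sigma> | \<sigma> permutes {..<n}. of_int (sign \<sigma>) * F.M.basis_form [1..<n + 1]
         (\<lambda>r. if r < n - j then T.hor u (v (\<sigma> r)) else T.ver u (v (\<sigma> r)))) / (fact j * fact (n - j))"
      by (simp only: sum_distrib_left mult.left_commute)
    finally show "sphere_form A AS (alpha A g ori D n j) u v = C.mixed_form j v"
      by (simp only: F.mixed_frame[OF that] C.mixed_form_def C.mixed_indices_def times_divide_eq_left)
  qed
  have star: "sphere_star A g ori D n AS u = hodge_star F.lifted_metric P"
    by (simp add: sphere_star_def met P_def)
  show "let \<theta> = sphere_form A AS (theta A g D) u;
        d\<theta> = exterior_derivative AS 1 (sphere_form A AS (theta A g D)) u;
        \<alpha> = (\<lambda>j. sphere_form A AS (alpha A g ori D n j) u);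
        star = sphere_star A g ori D n AS u
    in
      star 1 \<theta> = (\<lambda>v. s * wedge n n (\<alpha> 0) (\<alpha> n) v) \<and>
      star 1 \<theta> = (\<lambda>v. s * (-1) ^ (n * (n + 1) div 2) / fact n * wedge_power 2 d\<theta> n v) \<and>
      star (2 * i) (wedge_power 2 d\<theta> i) =
        (\<lambda>v. (-1) ^ (n * (n + 1) div 2) * (fact i / (fact (n - i) * s)) *
             wedge 1 (2 * (n - i)) \<theta> (wedge_power 2 d\<theta> (n - i)) v) \<and>
      star n (\<alpha> i) = (\<lambda>v. (-1) ^ (n - i) / s * wedge 1 n \<theta> (\<alpha> (n - i)) v) \<and>
      wedge n 2 (\<alpha> i) d\<theta> = (\<lambda>v. 0) \<and>
      (\<forall>j\<le>n. j \<noteq> n - i \<longrightarrow> wedge n n (\<alpha> i) (\<alpha> j) = (\<lambda>v. 0))"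
    unfolding Let_def \<theta> d\<theta> star \<alpha>[OF \<open>i \<le> n\<close>] \<alpha>[OF le0] \<alpha>[OF order_refl] \<alpha>[OF diff_le_self]
    using C.star_contact_mixed C.star_contact_symplectic C.star_wedge_power_symplectic[OF \<open>i \<le> n\<close>]
      C.star_mixed[OF \<open>i \<le> n\<close>] C.wedge_mixed_symplectic C.wedge_mixed_mixed[OF \<open>i \<le> n\<close>]
    by (intro conjI allI impI) (simp_all only: \<alpha>)
qed

end
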